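(* Let $m$ be a prime number, let $A$ be an abelian transitive state-closed group of degree $m$ and let $\sigma$ be the $m$-cycle automorphism $(1,2,\dots,m)$. If $\mathrm{tor}(A)$ is nontrivial, then $A^{*}$ is a torsion group conjugate to $\langle\sigma\rangle^{*}$ ($\cong(\mathbb{Z}/m\mathbb{Z})[[x]]$). If $A$ is torsion-free, then $A^{*}$ is a torsion-free group conjugate to the topological closure of $D_m(j)$ for some $j\ge1$.
   Context: Let $Y=\{1,\dots,m\}$. The vertices of the one-rooted $m$-ary tree $\mathcal{T}_m$ are the finite words over $Y$; $\mathcal{A}_m$ is its automorphism group, acting on the right. A permutation $\gamma\in \mathrm{Perm}(Y)$ is identified with the automorphism $yu\mapsto y^{\gamma}u$. Each $\alpha\in\mathcal{A}_m$ is uniquely written $\alpha=(\alpha_1,\dots,\alpha_m)\sigma(\alpha)$ with $\alpha_i\in\mathcal{A}_m$, $\sigma(\alpha)\in \mathrm{Perm}(Y)$, meaning $(iu)^{\alpha}=i^{\sigma(\alpha)}u^{\alpha_i}$. The states of $\alpha$ are the $\alpha_u$, $u$ a finite word, with $\alpha_{\emptyset}=\alpha$, $\alpha_{yu}=(\alpha_y)_u$. A subgroup $G\le\mathcal{A}_m$ is state-closed (of degree $m$) if all states of its elements lie in $G$; $G$ is transitive if the permutation group $P(G)$ it induces on $Y$ is transitive. $\mathrm{tor}(A)$ is the torsion subgroup of $A$. $\mathcal{A}_m$ is a topological group with the level stabilizers as a base of neighbourhoods of the identity, and $\overline{G}$ is the topological closure of $G$. Put $\alpha^{(0)}=\alpha$,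 $\alpha^{(1)}=(\alpha,\dots,\alpha)$, $\alpha^{(i+1)}=(\alpha^{(i)})^{(1)}$; write $\alpha^{x^i}$ for $\alpha^{(i)}$. The diagonal closure of $G$ is $\widetilde{G}=\langle G^{(i)}\mid i\ge 0\rangle$, and $G^{*}=\overline{\widetilde{G}}$ is the diagonal-topological closure. For $j\ge1$, $D_m(j)$ is the group generated by the set of states of the generalized adding machine $\alpha=(e,\dots,e,\alpha^{x^{j-1}})\sigma$ with $\sigma=(1,2,\dots,m)$. "Conjugate" means conjugate by an element of $\mathcal{A}_m$. *)

theory Defs
  imports "HOL-Analysis.Abstract_Topology" "HOL-Algebra.Generated_Groups" "HOL-Combinatorics.Cycles"
    "HOL-Number_Theory.Residues"
begin

definition words :: "nat \<Rightarrow> nat list set" where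
  "words m = lists {1..m}"

definition is_child :: "nat list \<Rightarrow> nat list \<Rightarrow> bool" where
  "is_child u v \<longleftrightarrow> (\<exists>y. v = u @ [y])"

text \<open>
  A tree automorphism is a bijection of the vertex set preserving the parent-child relation
  (hence also the root, the only vertex without a parent).  As a HOL function it is the identity
  outside the vertex set.  Automorphisms act on the right, so in the product the left factor is
  applied first.
\<close>

definition tree_aut :: "nat \<Rightarrow> (nat list \<Rightarrow> nat list) monoid" where
  "tree_aut m =
    \<lparr> carrier = {\<alpha>. \<alpha> permutes words m \<and>
         (\<forall>u\<in>words m. \<forall>v\<in>words m. is_child (\<alpha> u) (\<alpha> v) \<longleftrightarrow> is_child u v)},
      monoid.mult = (\<lambda>\<alpha> \<beta>. \<beta> \<circ> \<alpha>),
      one = id \<rparr>"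

text \<open>The element \<open>(\<alpha>\<^sub>1, \<dots>, \<alpha>\<^sub>m)\<pi>\<close>.\<close>

definition wreath :: "nat \<Rightarrow> (nat \<Rightarrow> nat list \<Rightarrow> nat list) \<Rightarrow> (nat \<Rightarrow> nat) \<Rightarrow> nat list \<Rightarrow> nat list"
  where
  "wreath m a \<pi> w =
    (if w \<in> words m then (case w of [] \<Rightarrow> [] | y # u \<Rightarrow> \<pi> y # a y u) else w)"

definition root_perm :: "nat \<Rightarrow> (nat list \<Rightarrow> nat list) \<Rightarrow> nat \<Rightarrow> nat" where
  "root_perm m \<alpha> y = (if y \<in> {1..m} then hd (\<alpha> [y]) else y)"

definition section1 :: "nat \<Rightarrow> (nat list \<Rightarrow> nat list) \<Rightarrow> nat \<Rightarrow> nat list \<Rightarrow> nat list" where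
  "section1 m \<alpha> y u = (if u \<in> words m then tl (\<alpha> (y # u)) else u)"

primrec state :: "nat \<Rightarrow> (nat list \<Rightarrow> nat list) \<Rightarrow> nat list \<Rightarrow> nat list \<Rightarrow> nat list" where
  "state m \<alpha> [] = \<alpha>"
| "state m \<alpha> (y # u) = state m (section1 m \<alpha> y) u"

definition states :: "nat \<Rightarrow> (nat list \<Rightarrow> nat list) \<Rightarrow> (nat list \<Rightarrow> nat list) set" where
  "states m \<alpha> = state m \<alpha> ` words m"

definition rigid :: "nat \<Rightarrow> (nat \<Rightarrow> nat) \<Rightarrow> nat list \<Rightarrow> nat list" where
  "rigid m \<pi> = wreath m (\<lambda>_. id) \<pi>"

definition diag :: "nat \<Rightarrow> (nat list \<Rightarrow> nat list) \<Rightarrow> nat list \<Rightarrow> nat list" where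
  "diag m \<alpha> = wreath m (\<lambda>_. \<alpha>) id"

abbreviation diag_pow :: "nat \<Rightarrow> nat \<Rightarrow> (nat list \<Rightarrow> nat list) \<Rightarrow> nat list \<Rightarrow> nat list" where
  "diag_pow m i \<equiv> diag m ^^ i"

definition full_cycle :: "nat \<Rightarrow> nat \<Rightarrow> nat" where
  "full_cycle m = cycle_of_list [1..<Suc m]"

definition state_closed :: "nat \<Rightarrow> (nat list \<Rightarrow> nat list) set \<Rightarrow> bool" where
  "state_closed m G \<longleftrightarrow> subgroup G (tree_aut m) \<and> (\<forall>\<alpha>\<in>G. states m \<alpha> \<subseteq> G)"

definition induced_perms :: "nat \<Rightarrow> (nat list \<Rightarrow> nat list) set \<Rightarrow> (nat \<Rightarrow> nat) set" where
  "induced_perms m G = root_perm m ` G"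

definition transitive_aut :: "nat \<Rightarrow> (nat list \<Rightarrow> nat list) set \<Rightarrow> bool" where
  "transitive_aut m G \<longleftrightarrow> (\<forall>y\<in>{1..m}. \<forall>z\<in>{1..m}. \<exists>\<pi>\<in>induced_perms m G. \<pi> y = z)"

abbreviation sub_aut :: "nat \<Rightarrow> (nat list \<Rightarrow> nat list) set \<Rightarrow> (nat list \<Rightarrow> nat list) monoid" where
  "sub_aut m H \<equiv> tree_aut m\<lparr>carrier := H\<rparr>"

definition torsion :: "('a, 'b) monoid_scheme \<Rightarrow> 'a set" where
  "torsion G = {x \<in> carrier G. \<exists>n::nat. 0 < n \<and> x [^]\<^bsub>G\<^esub> n = \<one>\<^bsub>G\<^esub>}"

definition torsion_group :: "('a, 'b) monoid_scheme \<Rightarrow> bool" where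
  "torsion_group G \<longleftrightarrow> group G \<and> torsion G = carrier G"

definition torsion_free_group :: "('a, 'b) monoid_scheme \<Rightarrow> bool" where
  "torsion_free_group G \<longleftrightarrow> group G \<and> torsion G = {\<one>\<^bsub>G\<^esub>}"

definition conjugate_in :: "('a, 'b) monoid_scheme \<Rightarrow> 'a set \<Rightarrow> 'a set \<Rightarrow> bool" where
  "conjugate_in G H K \<longleftrightarrow>
    (\<exists>g\<in>carrier G. K = (\<lambda>h. inv\<^bsub>G\<^esub> g \<otimes>\<^bsub>G\<^esub> h \<otimes>\<^bsub>G\<^esub> g) ` H)"

definition level_stab :: "nat \<Rightarrow> nat \<Rightarrow> (nat list \<Rightarrow> nat list) set" where
  "level_stab m n =
    {\<alpha> \<in> carrier (tree_aut m). \<forall>w\<in>words m. length w = n \<longrightarrow> \<alpha> w = w}"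

definition aut_topology :: "nat \<Rightarrow> (nat list \<Rightarrow> nat list) topology" where
  "aut_topology m = topology (\<lambda>U. U \<subseteq> carrier (tree_aut m) \<and>
     (\<forall>\<alpha>\<in>U. \<exists>n. \<alpha> <#\<^bsub>tree_aut m\<^esub> level_stab m n \<subseteq> U))"

definition top_closure :: "nat \<Rightarrow> (nat list \<Rightarrow> nat list) set \<Rightarrow> (nat list \<Rightarrow> nat list) set" where
  "top_closure m G = aut_topology m closure_of G"

definition diag_closure :: "nat \<Rightarrow> (nat list \<Rightarrow> nat list) set \<Rightarrow> (nat list \<Rightarrow> nat list) set" where
  "diag_closure m G = generate (tree_aut m) (\<Union>i. diag_pow m i ` G)"

definition diag_top_closure :: "nat \<Rightarrow> (nat list \<Rightarrow> nat list) set \<Rightarrow> (nat list \<Rightarrow> nat list) set"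
  where
  "diag_top_closure m G = top_closure m (diag_closure m G)"

text \<open>
  The defining equation is recursive; that it has exactly one solution is the lemma
  \<open>adding_machine_unique\<close> below.
\<close>

definition is_adding_machine :: "nat \<Rightarrow> nat \<Rightarrow> (nat list \<Rightarrow> nat list) \<Rightarrow> bool" where
  "is_adding_machine m j \<alpha> \<longleftrightarrow> \<alpha> \<in> carrier (tree_aut m) \<and>
     \<alpha> = wreath m (\<lambda>y. if y = m then diag_pow m (j - 1) \<alpha> else id) (full_cycle m)"

definition adding_machine :: "nat \<Rightarrow> nat \<Rightarrow> nat list \<Rightarrow> nat list" where
  "adding_machine m j = (THE \<alpha>. is_adding_machine m j \<alpha>)"

definition D_group :: "nat \<Rightarrow> nat \<Rightarrow> (nat list \<Rightarrow> nat list) set" where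
  "D_group m j = generate (tree_aut m) (states m (adding_machine m j))"

definition fps_ring :: "('a, 'b) ring_scheme \<Rightarrow> (nat \<Rightarrow> 'a) ring" where
  "fps_ring R =
    \<lparr> carrier = {f. \<forall>n. f n \<in> carrier R},
      monoid.mult = (\<lambda>f g n. \<Oplus>\<^bsub>R\<^esub>i\<in>{..n}. f i \<otimes>\<^bsub>R\<^esub> g (n - i)),
      one = (\<lambda>n. if n = 0 then \<one>\<^bsub>R\<^esub> else \<zero>\<^bsub>R\<^esub>),
      ring.zero = (\<lambda>n. \<zero>\<^bsub>R\<^esub>),
      ring.add = (\<lambda>f g n. f n \<oplus>\<^bsub>R\<^esub> g n) \<rparr>"

definition fps_var :: "('a, 'b) ring_scheme \<Rightarrow> nat \<Rightarrow> 'a" where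
  "fps_var R = (\<lambda>n. if n = 1 then \<one>\<^bsub>R\<^esub> else \<zero>\<^bsub>R\<^esub>)"

lemma cons_in_words [simp]: "y # u \<in> words m \<longleftrightarrow> y \<in> {1..m} \<and> u \<in> words m"
  and nil_in_words [simp]: "[] \<in> words m"
  and append_in_words [simp]: "u @ v \<in> words m \<longleftrightarrow> u \<in> words m \<and> v \<in> words m"
  by (auto simp: words_def)

lemma take_drop_in_words:
  assumes "u \<in> words m"
  shows "take k u \<in> words m" and "drop k u \<in> words m"
  using assms set_take_subset[of k u] set_drop_subset[of k u] by (auto simp: words_def)

lemma tree_aut_carrier_iff:
  "\<alpha> \<in> carrier (tree_aut m) \<longleftrightarrow> \<alpha> permutes words m \<and>
     (\<forall>u\<in>words m. \<forall>v\<in>words m. is_child (\<alpha> u) (\<alpha> v) \<longleftrightarrow> is_child u v)"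
  by (simp add: tree_aut_def)

lemma group_tree_aut: "group (tree_aut m)"
proof (rule groupI)
  fix \<alpha> assume a: "\<alpha> \<in> carrier (tree_aut m)"
  then have p: "\<alpha> permutes words m" by (simp add: tree_aut_carrier_iff)
  let ?i = "inv_into UNIV \<alpha>"
  have "?i \<in> carrier (tree_aut m)"
    unfolding tree_aut_carrier_iff
  proof (intro conjI ballI)
    show "?i permutes words m" using p by (rule permutes_inv)
    fix u v assume uv: "u \<in> words m" "v \<in> words m"
    have "?i u \<in> words m" "?i v \<in> words m"
      using uv permutes_in_image[OF permutes_inv[OF p]] by auto
    then show "is_child (?i u) (?i v) \<longleftrightarrow> is_child u v"
      using a permutes_inverses(1)[OF p] by (metis tree_aut_carrier_iff)
  qed
  moreover have "?i \<otimes>\<^bsub>tree_aut m\<^esub> \<alpha> = \<one>\<^bsub>tree_aut m\<^esub>"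
    using permutes_inv_o(1)[OF p] by (simp add: tree_aut_def)
  ultimately show "\<exists>\<beta>\<in>carrier (tree_aut m). \<beta> \<otimes>\<^bsub>tree_aut m\<^esub> \<alpha> = \<one>\<^bsub>tree_aut m\<^esub>" by blast
next
  fix \<alpha> \<beta> assume "\<alpha> \<in> carrier (tree_aut m)" "\<beta> \<in> carrier (tree_aut m)"
  then show "\<alpha> \<otimes>\<^bsub>tree_aut m\<^esub> \<beta> \<in> carrier (tree_aut m)"
    by (auto simp: tree_aut_def permutes_compose permutes_in_image)
qed (auto simp: tree_aut_def permutes_id o_assoc)

lemma tree_aut_nil:
  assumes "\<alpha> \<in> carrier (tree_aut m)"
  shows "\<alpha> [] = []"
proof (rule ccontr)
  assume ne: "\<alpha> [] \<noteq> []"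
  have p: "\<alpha> permutes words m" using assms by (simp add: tree_aut_carrier_iff)
  have "\<alpha> [] \<in> words m" using permutes_in_image[OF p] by simp
  then have b: "butlast (\<alpha> []) \<in> words m" using ne
    by (metis append_butlast_last_id append_in_words)
  then obtain u where u: "u \<in> words m" "\<alpha> u = butlast (\<alpha> [])"
    using permutes_image[OF p] by (metis imageE)
  have "is_child (\<alpha> u) (\<alpha> [])" unfolding is_child_def u(2)
    using ne by (metis append_butlast_last_id)
  then have "is_child u []" using assms u(1) by (simp add: tree_aut_carrier_iff)
  then show False by (simp add: is_child_def)
qed

lemma tree_aut_append:
  assumes "\<alpha> \<in> carrier (tree_aut m)" and "u @ [y] \<in> words m"
  shows "\<exists>z\<in>{1..m}. \<alpha> (u @ [y]) = \<alpha> u @ [z]"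
proof -
  have "is_child (\<alpha> u) (\<alpha> (u @ [y]))"
    using assms by (simp add: tree_aut_carrier_iff is_child_def)
  then obtain z where z: "\<alpha> (u @ [y]) = \<alpha> u @ [z]" by (auto simp: is_child_def)
  have "\<alpha> (u @ [y]) \<in> words m"
    using assms permutes_in_image by (metis tree_aut_carrier_iff)
  then show ?thesis using z by auto
qed

lemma tree_aut_cons:
  assumes "\<alpha> \<in> carrier (tree_aut m)" and "y # u \<in> words m"
  shows "\<alpha> (y # u) = root_perm m \<alpha> y # section1 m \<alpha> y u"
  using assms(2)
proof (induction u rule: rev_induct)
  case Nil
  then obtain z where "\<alpha> [y] = [z]"
    using tree_aut_append[OF assms(1), of "[]" y] tree_aut_nil[OF assms(1)] by auto
  then show ?case using Nil by (simp add: root_perm_def section1_def)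
next
  case (snoc x u)
  then obtain z where "\<alpha> (y # u @ [x]) = \<alpha> (y # u) @ [z]"
    using tree_aut_append[OF assms(1), of "y # u" x] by auto
  moreover have "\<alpha> (y # u) = root_perm m \<alpha> y # section1 m \<alpha> y u"
    using snoc by simp
  ultimately show ?case using snoc.prems by (simp add: section1_def)
qed

lemma tree_aut_decomposition:
  assumes "\<alpha> \<in> carrier (tree_aut m)"
  shows "\<alpha> = wreath m (section1 m \<alpha>) (root_perm m \<alpha>)"
proof
  fix w
  have "w \<notin> words m \<Longrightarrow> \<alpha> w = w"
    using assms by (meson permutes_not_in tree_aut_carrier_iff)
  then show "\<alpha> w = wreath m (section1 m \<alpha>) (root_perm m \<alpha>) w"
    using tree_aut_nil[OF assms] tree_aut_cons[OF assms]
    by (cases w) (auto simp: wreath_def)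
qed

lemma tree_aut_length:
  assumes "\<alpha> \<in> carrier (tree_aut m)" and "w \<in> words m"
  shows "length (\<alpha> w) = length w"
  using assms(2)
proof (induction w rule: rev_induct)
  case Nil
  then show ?case using tree_aut_nil[OF assms(1)] by simp
next
  case (snoc x u)
  then show ?case using tree_aut_append[OF assms(1), of u x] by auto
qed

lemma level_stab_mono:
  assumes "k \<le> n" and "1 \<le> m"
  shows "level_stab m n \<subseteq> level_stab m k"
proof
  fix \<alpha> assume a: "\<alpha> \<in> level_stab m n"
  then have c: "\<alpha> \<in> carrier (tree_aut m)" by (simp add: level_stab_def)
  have "\<alpha> w = w" if w: "w \<in> words m" "length w = k" for w
  proof -
    have pre: "take (length u) (\<alpha> (u @ v)) = \<alpha> u" if "u @ v \<in> words m" for u v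
      using that
    proof (induction v rule: rev_induct)
      case Nil
      then show ?case using tree_aut_length[OF c] by simp
    next
      case (snoc x v)
      then obtain z where "\<alpha> ((u @ v) @ [x]) = \<alpha> (u @ v) @ [z]"
        using tree_aut_append[OF c, of "u @ v" x] by auto
      then show ?case using snoc tree_aut_length[OF c, of "u @ v"] by simp
    qed
    have "w @ replicate (n - k) 1 \<in> words m"
      using w(1) assms(2) by (auto simp: words_def)
    moreover from this have "\<alpha> (w @ replicate (n - k) 1) = w @ replicate (n - k) 1"
      using a w(2) assms(1) by (simp add: level_stab_def)
    ultimately show ?thesis using pre[of w "replicate (n - k) 1"] by simp
  qed
  then show "\<alpha> \<in> level_stab m k" using c by (simp add: level_stab_def)
qed

lemma level_stab_subset_0: "m = 0 \<Longrightarrow> level_stab m n = carrier (tree_aut m)"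
  by (auto simp: level_stab_def words_def dest: tree_aut_nil)

lemma istopology_aut:
  "istopology (\<lambda>U. U \<subseteq> carrier (tree_aut m) \<and>
     (\<forall>\<alpha>\<in>U. \<exists>n. \<alpha> <#\<^bsub>tree_aut m\<^esub> level_stab m n \<subseteq> U))"
proof -
  have max: "level_stab m (max k n) \<subseteq> level_stab m k \<inter> level_stab m n" for k n
    using level_stab_mono[of _ _ m] level_stab_subset_0[of m]
    by (cases "m = 0") auto
  let ?L = "\<lambda>U. \<forall>\<alpha>\<in>U. \<exists>n. \<alpha> <#\<^bsub>tree_aut m\<^esub> level_stab m n \<subseteq> U"
  have "?L (S \<inter> T)" if S: "?L S" and T: "?L T" for S T
  proof
    fix \<alpha> assume "\<alpha> \<in> S \<inter> T"
    then obtain k n where "\<alpha> <#\<^bsub>tree_aut m\<^esub> level_stab m k \<subseteq> S" "\<alpha> <#\<^bsub>tree_aut m\<^esub> level_stab m n \<subseteq> T"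
      using S T by blast
    then have "\<alpha> <#\<^bsub>tree_aut m\<^esub> level_stab m (max k n) \<subseteq> S \<inter> T"
      using max[of k n] unfolding l_coset_def by fast
    then show "\<exists>n. \<alpha> <#\<^bsub>tree_aut m\<^esub> level_stab m n \<subseteq> S \<inter> T" by (rule exI)
  qed
  moreover have "?L (\<Union>\<K>)" if K: "\<forall>K\<in>\<K>. ?L K" for \<K>
  proof
    fix \<alpha> assume "\<alpha> \<in> \<Union>\<K>"
    then obtain K where "K \<in> \<K>" "\<alpha> \<in> K" by (rule UnionE)
    then obtain n where "\<alpha> <#\<^bsub>tree_aut m\<^esub> level_stab m n \<subseteq> K" using K by meson
    then have "\<alpha> <#\<^bsub>tree_aut m\<^esub> level_stab m n \<subseteq> \<Union>\<K>"
      using Union_upper[OF \<open>K \<in> \<K>\<close>] by (rule order_trans)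
    then show "\<exists>n. \<alpha> <#\<^bsub>tree_aut m\<^esub> level_stab m n \<subseteq> \<Union>\<K>" by (rule exI)
  qed
  ultimately show ?thesis
    unfolding istopology_def by (simp add: Sup_least le_infI1)
qed

lemma openin_aut_topology:
  "openin (aut_topology m) U \<longleftrightarrow> U \<subseteq> carrier (tree_aut m) \<and>
     (\<forall>\<alpha>\<in>U. \<exists>n. \<alpha> <#\<^bsub>tree_aut m\<^esub> level_stab m n \<subseteq> U)"
  unfolding aut_topology_def by (rule fun_cong[OF topology_inverse'[OF istopology_aut]])

lemma cycle_of_list_upt:
  assumes "y \<in> {k..n}"
  shows "cycle_of_list [k..<Suc n] y = (if y = n then k else Suc y)"
  using assms
proof (induction "n - k" arbitrary: k y)
  case 0
  then show ?case by simp
next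
  case (Suc d)
  then have kn: "k < n" by simp
  have eq: "cycle_of_list [k..<Suc n] = transpose k (Suc k) \<circ> cycle_of_list [Suc k..<Suc n]"
    using kn by (simp add: upt_conv_Cons del: upt_Suc)
  show ?case
  proof (cases "y = k")
    case True
    then have "cycle_of_list [Suc k..<Suc n] y = y"
      by (intro id_outside_supp) auto
    then show ?thesis using eq True kn by simp
  next
    case False
    then have "cycle_of_list [Suc k..<Suc n] y = (if y = n then Suc k else Suc y)"
      using Suc by (intro Suc.hyps(1)) auto
    then show ?thesis using eq False Suc.prems by (simp add: transpose_def)
  qed
qed

lemma full_cycle_apply:
  "y \<in> {1..m} \<Longrightarrow> full_cycle m y = (if y = m then 1 else y + 1)"
  unfolding full_cycle_def by (subst cycle_of_list_upt) auto

lemma full_cycle_permutes: "full_cycle m permutes {1..m}"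
  using cycle_permutes[of "[1..<Suc m]"] by (simp add: full_cycle_def atLeastLessThanSuc_atLeastAtMost del: upt_Suc)

lemma diag_pow_apply:
  assumes "\<alpha> [] = []" and "w \<in> words m"
  shows "diag_pow m k \<alpha> w = take k w @ \<alpha> (drop k w)"
  using assms(2)
proof (induction k arbitrary: w)
  case (Suc k)
  then show ?case using assms(1) by (cases w) (auto simp: diag_def wreath_def)
qed simp

function add_mach :: "nat \<Rightarrow> nat \<Rightarrow> nat list \<Rightarrow> nat list" where
  "add_mach m k [] = []"
| "add_mach m k (y # u) =
    (if y # u \<in> words m
     then full_cycle m y # (if y = m then take k u @ add_mach m k (drop k u) else u)
     else y # u)"
  by pat_completeness auto
termination by (relation "measure (\<lambda>(m, k, w). length w)") auto

declare add_mach.simps(2) [simp del]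

lemma add_mach_outside: "w \<notin> words m \<Longrightarrow> add_mach m k w = w"
  by (cases w) (auto simp: add_mach.simps(2))

lemma add_mach_length: "length (add_mach m k w) = length w"
  by (induction m k w rule: add_mach.induct) (auto simp: add_mach.simps(2))

lemma add_mach_words: "w \<in> words m \<Longrightarrow> add_mach m k w \<in> words m"
proof (induction m k w rule: add_mach.induct)
  case (2 m k y u)
  then show ?case
    using permutes_in_image[OF full_cycle_permutes, of m y]
    by (auto simp: add_mach.simps(2) take_drop_in_words)
qed simp

lemma add_mach_inj:
  "v \<in> words m \<Longrightarrow> w \<in> words m \<Longrightarrow> add_mach m k v = add_mach m k w \<Longrightarrow> v = w"
proof (induction m k v arbitrary: w rule: add_mach.induct)
  case (1 m k)
  then show ?case using add_mach_length[of m k w] by simp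
next
  case (2 m k y u)
  have len: "length w = Suc (length u)"
    using 2(4) add_mach_length[of m k w] add_mach_length[of m k "y # u"] by simp
  then obtain z v where w: "w = z # v" by (cases w) auto
  have "full_cycle m y = full_cycle m z"
    using 2(2-4) w by (simp add: add_mach.simps(2))
  then have z: "z = y" using permutes_inj[OF full_cycle_permutes] by (metis injD)
  show ?case
  proof (cases "y = m")
    case False
    then show ?thesis using 2(2-4) w z by (simp add: add_mach.simps(2))
  next
    case True
    then have e: "take k u @ add_mach m k (drop k u) = take k v @ add_mach m k (drop k v)"
      using 2(2-4) w z by (simp add: add_mach.simps(2))
    then have "take k u = take k v" "add_mach m k (drop k u) = add_mach m k (drop k v)"
      using len w by (simp_all add: append_eq_append_conv)
    moreover from this have "drop k u = drop k v"
      using 2(1)[of "drop k v"] 2(2,3) True w by (auto simp: take_drop_in_words)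
    ultimately show ?thesis using w z by (metis append_take_drop_id)
  qed
qed

lemma finite_words_length: "finite {w \<in> words m. length w = n}"
proof -
  have "{w \<in> words m. length w = n} = {w. set w \<subseteq> {1..m} \<and> length w = n}"
    by (auto simp: words_def)
  then show ?thesis using finite_lists_length_eq[of "{1..m}" n] by simp
qed

lemma add_mach_permutes: "add_mach m k permutes words m"
proof (rule bij_imp_permutes)
  have "add_mach m k ` {w \<in> words m. length w = n} = {w \<in> words m. length w = n}" for n
    by (rule endo_inj_surj[OF finite_words_length])
      (auto simp: add_mach_length add_mach_words inj_on_def intro: add_mach_inj)
  then have "w \<in> add_mach m k ` words m" if "w \<in> words m" for w
    using that by blast
  then show "bij_betw (add_mach m k) (words m) (words m)"
    using add_mach_words by (auto simp: bij_betw_def inj_on_def intro: add_mach_inj)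
qed (rule add_mach_outside)

lemma add_mach_append:
  "u @ [x] \<in> words m \<Longrightarrow> \<exists>z. add_mach m k (u @ [x]) = add_mach m k u @ [z]"
proof (induction m k u rule: add_mach.induct)
  case (1 m k)
  then show ?case by (auto simp: add_mach.simps(2))
next
  case (2 m k y u)
  consider "y \<noteq> m" | "y = m" "length u < k" | "y = m" "k \<le> length u" by linarith
  then show ?case
  proof cases
    case 3
    then have "\<exists>z. add_mach m k (drop k u @ [x]) = add_mach m k (drop k u) @ [z]"
      using 2 by (auto simp: take_drop_in_words)
    then show ?thesis using 2(2) 3 by (auto simp: add_mach.simps(2))
  qed (use 2(2) in \<open>auto simp: add_mach.simps(2)\<close>)
qed

lemma add_mach_carrier: "add_mach m k \<in> carrier (tree_aut m)"
  unfolding tree_aut_carrier_iff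
proof (intro conjI ballI add_mach_permutes iffI)
  fix u v assume uv: "u \<in> words m" "v \<in> words m"
  show "is_child (add_mach m k u) (add_mach m k v)" if "is_child u v"
    using that uv add_mach_append by (auto simp: is_child_def)
  assume c: "is_child (add_mach m k u) (add_mach m k v)"
  then have "v \<noteq> []" by (auto simp: is_child_def)
  then obtain v' y where v: "v = v' @ [y]" by (metis append_butlast_last_id)
  then obtain z where "add_mach m k v = add_mach m k v' @ [z]"
    using add_mach_append uv(2) by blast
  then have "add_mach m k u = add_mach m k v'" using c by (auto simp: is_child_def)
  then have "u = v'" using add_mach_inj uv v by auto
  then show "is_child u v" using v by (simp add: is_child_def)
qed

lemma is_adding_machine_add_mach: "is_adding_machine m j (add_mach m (j - 1))"
  unfolding is_adding_machine_def
proof (intro conjI add_mach_carrier ext)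
  fix w
  show "add_mach m (j - 1) w =
    wreath m (\<lambda>y. if y = m then diag_pow m (j - 1) (add_mach m (j - 1)) else id) (full_cycle m) w"
    by (cases w) (auto simp: wreath_def add_mach.simps diag_pow_apply add_mach_outside)
qed

lemma adding_machine_unique: "\<exists>!\<alpha>. is_adding_machine m j \<alpha>"
proof (rule ex1I)
  show "is_adding_machine m j (add_mach m (j - 1))" by (rule is_adding_machine_add_mach)
  fix \<beta> assume b: "is_adding_machine m j \<beta>"
  then have c: "\<beta> \<in> carrier (tree_aut m)" by (simp add: is_adding_machine_def)
  have eq: "\<beta> w = wreath m (\<lambda>y. if y = m then diag_pow m (j - 1) \<beta> else id) (full_cycle m) w" for w
    using b unfolding is_adding_machine_def by metis
  have "\<beta> w = add_mach m (j - 1) w" for w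
  proof (induction w rule: length_induct)
    case (1 w)
    show ?case
    proof (cases w)
      case Nil
      then show ?thesis using tree_aut_nil[OF c] by simp
    next
      case (Cons y u)
      then have "\<beta> (drop (j - 1) u) = add_mach m (j - 1) (drop (j - 1) u)"
        using 1 by auto
      then show ?thesis
        unfolding eq[of w] using Cons
        by (auto simp: wreath_def add_mach.simps(2) diag_pow_apply tree_aut_nil[OF c])
    qed
  qed
  then show "\<beta> = add_mach m (j - 1)" by blast
qed

lemma is_adding_machine_adding_machine: "is_adding_machine m j (adding_machine m j)"
  unfolding adding_machine_def by (rule theI'[OF adding_machine_unique])

end

theory Submission
  imports Defs "HOL-Algebra.Multiplicative_Group"
begin

text \<open>
  Write \<open>x\<close> for the diagonal map \<open>\<alpha> \<mapsto> (\<alpha>, \<dots>, \<alpha>)\<close> and \<open>p\<close> for the prime degree.  The diagonal closure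
  \<open>B\<close> of \<open>A\<close> is again abelian, transitive and state-closed, and \<open>x\<close> maps it into itself.  If an
  element of \<open>B\<close> fixes the first level, comparing both orders of composition with an element that
  moves the letter 1 to \<open>y\<close> shows that its sections at 1 and at \<open>y\<close> coincide, because the sections
  lie in the abelian group \<open>B\<close>.  So the stabilizer in \<open>B\<close> of the first level is \<open>x B\<close>, and that of
  level \<open>n\<close> is \<open>x\<^sup>n B\<close>.  Thus \<open>B\<close> is an abelian group with an injective endomorphism whose image has
  index \<open>p\<close> and whose iterated images intersect trivially (locale \<open>shift_group\<close>), and \<open>B\<close> acts
  regularly on level \<open>n\<close> modulo \<open>x\<^sup>n B\<close> (locale \<open>regular_tree_group\<close>).

  Such a group has a valuation, and it either has exponent \<open>p\<close> or is torsion-free.  Take \<open>\<beta>\<close>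
  outside \<open>x B\<close>.  If \<open>\<beta>\<^sup>p\<close> is trivial, then the whole group has exponent \<open>p\<close> (\<open>exponent_p\<close>).  Otherwise \<open>\<beta>\<^sup>p\<close> has some
  valuation \<open>j \<ge> 1\<close>, and then taking \<open>p\<close>-th powers raises every valuation by exactly \<open>j\<close>
  (\<open>pth_power_lev\<close>); hence the group is torsion-free, with bounds uniform enough to survive passing
  to the topological closure (\<open>power_bound\<close>).

  For the conjugacy, choose elements \<open>b k\<close> of valuation \<open>k\<close>: in the torsion case \<open>b k = x\<^sup>k \<beta>\<close>, and
  in the torsion-free case \<open>b k = x\<^sup>k \<beta>\<close> for \<open>k < j\<close> and \<open>b (k + j) = (b k)\<^sup>p\<close>.  The \<open>p\<close>-th power of
  \<open>b k\<close> is then trivial, respectively \<open>b (k + j)\<close>.  These relations decide whether a product of powers of the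
  \<open>b k\<close> lies in \<open>x\<^sup>n B\<close>.  If \<open>C\<close> is a second group of the same kind with elements \<open>c k\<close> satisfying the
  same relations, then sending \<open>b k\<close> to \<open>c k\<close> matches dense subgroups of \<open>B\<close> and \<open>C\<close> compatibly with
  all level stabilizers (\<open>R_fil_iff\<close>).  Mapping the image of \<open>1\<^sup>n\<close> under \<open>b\<close> to its image under the
  partner of \<open>b\<close> is therefore a well-defined tree automorphism, and it conjugates the closure of
  \<open>B\<close> to that of \<open>C\<close> (\<open>conjugate_top_closure_if_matching\<close>).  The matching has to respect only the
  group structure and the filtration, not \<open>x\<close> itself, and this is why the single number \<open>j\<close>
  classifies the torsion-free groups.

  The models are the diagonal closure of the group generated by the rigid cycle, whose generator has
  order \<open>p\<close>, and \<open>D_group p j\<close>, whose adding machine \<open>\<alpha>\<close> satisfies \<open>\<alpha>\<^sup>p = x\<^sup>j \<alpha>\<close>.  The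
  diagonal-topological closure of the first one consists of the automorphisms rotating the letters
  at each depth by an amount depending on the depth only; the sequences of these amounts are the
  power series over the integers modulo \<open>p\<close>.
\<close>

section \<open>Abelian groups with an injective endomorphism of prime index\<close>

text \<open>
  The abstract shape of an abelian transitive state-closed group that is closed under the diagonal
  map \<open>s\<close>: the images of the powers of \<open>s\<close> are the level stabilizers.
\<close>

locale shift_group = comm_group G for G (structure) +
  fixes s :: "'a \<Rightarrow> 'a" and p :: nat
  assumes s_hom: "s \<in> hom G G"
    and s_inj: "inj_on s (carrier G)"
    and prime_p: "prime p"
    and index: "card (rcosets (s ` carrier G)) = p"
    and separated: "(\<Inter>n. (s ^^ n) ` carrier G) = {\<one>}"
begin

definition fil :: "nat \<Rightarrow> 'a set" where
  "fil n = (s ^^ n) ` carrier G"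

text \<open>
  The elements of valuation exactly \<open>n\<close> for the filtration.
\<close>

definition lev :: "nat \<Rightarrow> 'a set" where
  "lev n = fil n - fil (Suc n)"

lemma s_pow_hom: "s ^^ n \<in> hom G G"
proof (induction n)
  case (Suc n)
  then show ?case using s_hom by (auto simp: hom_def Pi_iff)
qed (auto simp: hom_def)

lemma s_pow_inj: "inj_on (s ^^ n) (carrier G)"
proof (induction n)
  case (Suc n)
  have "(s ^^ n) ` carrier G \<subseteq> carrier G" using s_pow_hom by (auto simp: hom_def)
  then show ?case using comp_inj_on[OF Suc inj_on_subset[OF s_inj]] by (simp add: comp_def)
qed auto

lemma s_pow_closed [simp]: "x \<in> carrier G \<Longrightarrow> (s ^^ n) x \<in> carrier G"
  using s_pow_hom[of n] by (auto simp: hom_def)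

lemma s_pow_mult: "x \<in> carrier G \<Longrightarrow> y \<in> carrier G \<Longrightarrow> (s ^^ n) (x \<otimes> y) = (s ^^ n) x \<otimes> (s ^^ n) y"
  using s_pow_hom[of n] by (auto simp: hom_def)

lemma s_pow_pow: "x \<in> carrier G \<Longrightarrow> (s ^^ n) (x [^] (d::nat)) = (s ^^ n) x [^] d"
  by (intro hom_nat_pow s_pow_hom is_group)

lemma fil_0: "fil 0 = carrier G"
  by (simp add: fil_def)

lemma subgroup_fil: "subgroup (fil n) G"
proof -
  have "group_hom G G (s ^^ n)" by unfold_locales (rule s_pow_hom)
  then show ?thesis unfolding fil_def by (rule group_hom.img_is_subgroup)
qed

lemma fil_closed: "x \<in> fil n \<Longrightarrow> x \<in> carrier G"
  using subgroup.subset[OF subgroup_fil] by blast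

lemma fil_mult: "x \<in> fil n \<Longrightarrow> y \<in> fil n \<Longrightarrow> x \<otimes> y \<in> fil n"
  by (rule subgroup.m_closed[OF subgroup_fil])

lemma fil_inv: "x \<in> fil n \<Longrightarrow> inv x \<in> fil n"
  by (rule subgroup.m_inv_closed[OF subgroup_fil])

lemma fil_pow: "x \<in> fil n \<Longrightarrow> x [^] (d::nat) \<in> fil n"
  by (induction d) (auto simp: fil_mult subgroup.one_closed[OF subgroup_fil])

lemma fil_mult_cancel_left:
  "x \<in> fil n \<Longrightarrow> y \<in> carrier G \<Longrightarrow> x \<otimes> y \<in> fil n \<longleftrightarrow> y \<in> fil n"
  using fil_mult[of "inv x" n "x \<otimes> y"] fil_mult[of x n y] fil_inv[of x n] fil_closed[of x n]
  by (auto simp: m_assoc[symmetric])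

lemma fil_mult_cancel_right:
  "y \<in> fil n \<Longrightarrow> x \<in> carrier G \<Longrightarrow> x \<otimes> y \<in> fil n \<longleftrightarrow> x \<in> fil n"
  using fil_mult_cancel_left[of y n x] fil_closed[of y n] by (simp add: m_comm)

lemma s_pow_mem_fil: "x \<in> carrier G \<Longrightarrow> (s ^^ n) x \<in> fil (n + k) \<longleftrightarrow> x \<in> fil k"
proof
  assume x: "x \<in> carrier G" and "(s ^^ n) x \<in> fil (n + k)"
  then obtain y where y: "y \<in> carrier G" "(s ^^ n) x = (s ^^ n) ((s ^^ k) y)"
    by (auto simp: fil_def funpow_add)
  then have "x = (s ^^ k) y" using inj_onD[OF s_pow_inj y(2)] x y(1) by simp
  then show "x \<in> fil k" using y(1) by (auto simp: fil_def)
next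
  assume "x \<in> fil k"
  then obtain y where "y \<in> carrier G" "x = (s ^^ k) y" by (auto simp: fil_def)
  then show "(s ^^ n) x \<in> fil (n + k)" unfolding fil_def by (intro image_eqI[of _ _ y]) (simp_all add: funpow_add)
qed

lemma fil_antimono: "i \<le> n \<Longrightarrow> fil n \<subseteq> fil i"
proof -
  assume "i \<le> n"
  then obtain k where n: "n = i + k" using le_Suc_ex by blast
  show ?thesis
  proof
    fix x assume "x \<in> fil n"
    then obtain y where y: "y \<in> carrier G" "x = (s ^^ i) ((s ^^ k) y)" by (auto simp: n fil_def funpow_add)
    then show "x \<in> fil i" unfolding fil_def using s_pow_closed[of y k] by (intro image_eqI[of _ _ "(s ^^ k) y"])
  qed
qed

lemma lev_s_pow: "x \<in> lev 0 \<Longrightarrow> (s ^^ n) x \<in> lev n"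
  using s_pow_mem_fil[of x n 0] s_pow_mem_fil[of x n 1] by (auto simp: lev_def fil_0)

lemma lev_E:
  assumes "x \<in> lev n"
  obtains y where "y \<in> lev 0" "x = (s ^^ n) y"
proof -
  obtain y where y: "y \<in> carrier G" "x = (s ^^ n) y" using assms by (auto simp: lev_def fil_def)
  then have "y \<in> lev 0" using assms s_pow_mem_fil[of y n 1] by (auto simp: lev_def fil_0)
  then show ?thesis using y that by blast
qed

lemma fil_Inter: "(\<And>n. x \<in> fil n) \<Longrightarrow> x = \<one>"
  using separated by (auto simp: fil_def)

lemma not_one_lev:
  assumes "x \<in> carrier G" "x \<notin> fil n"
  obtains k where "k < n" "x \<in> lev k"
proof -
  define l where "l = (LEAST l. x \<notin> fil l)"
  have l: "x \<notin> fil l" "l \<le> n"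
    unfolding l_def by (rule LeastI[of "\<lambda>l. x \<notin> fil l", OF assms(2)]) (rule Least_le[of "\<lambda>l. x \<notin> fil l", OF assms(2)])
  then have l0: "l \<noteq> 0" using assms(1) fil_0 by metis
  then have "x \<in> fil (l - 1)" using not_less_Least[of "l - 1" "\<lambda>l. x \<notin> fil l"] by (simp flip: l_def)
  then have "x \<in> lev (l - 1)" using l l0 by (simp add: lev_def)
  then show ?thesis using l l0 that[of "l - 1"] by auto
qed

text \<open>
  The quotient by the first filtration step has prime order, so every nontrivial element of it is a
  generator of order \<open>p\<close>.
\<close>

lemma level_zero_pow:
  assumes x: "x \<in> lev 0"
  shows "x [^] (d::nat) \<in> fil 1 \<longleftrightarrow> p dvd d"
    and "y \<in> carrier G \<Longrightarrow> \<exists>d::nat. \<exists>z\<in>fil 1. y = x [^] d \<otimes> z"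
proof -
  have xc: "x \<in> carrier G" and x1: "x \<notin> fil 1" using x by (auto simp: lev_def fil_0)
  interpret N: normal "fil 1" G by (rule subgroup_imp_normal[OF subgroup_fil])
  let ?Q = "G Mod fil 1"
  interpret Q: group ?Q by (rule N.factorgroup_is_group)
  have coset_one: "fil 1 #> a = fil 1 \<longleftrightarrow> a \<in> fil 1" if "a \<in> carrier G" for a
    using that coset_join1[OF _ _ subgroup_fil] coset_join2[OF _ subgroup_fil] by blast
  have ordQ: "order ?Q = p" using index by (simp add: order_def FactGroup_def fil_def)
  then have fin: "finite (carrier ?Q)"
    using prime_gt_0_nat[OF prime_p] Q.order_gt_0_iff_finite by simp
  have xQ: "fil 1 #> x \<in> carrier ?Q" using xc by (auto simp: carrier_FactGroup)
  have pw: "(fil 1 #> x) [^]\<^bsub>?Q\<^esub> d = fil 1 #> x [^] d" for d :: nat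
    by (rule N.FactGroup_pow[OF xc])
  have "Q.ord (fil 1 #> x) dvd p" using Q.ord_dvd_group_order[OF xQ] ordQ by simp
  moreover have "Q.ord (fil 1 #> x) \<noteq> 1" using coset_one[OF xc] x1 Q.ord_eq_1[OF xQ] by simp
  ultimately have ord: "Q.ord (fil 1 #> x) = p" using prime_p by (auto simp: prime_nat_iff)
  show "x [^] d \<in> fil 1 \<longleftrightarrow> p dvd d"
    using Q.pow_eq_id[OF xQ, of d] ord pw coset_one[of "x [^] d"] xc by simp
  assume y: "y \<in> carrier G"
  have "generate ?Q {fil 1 #> x} = carrier ?Q"
    using Q.generate_pow_card[OF xQ] ord ordQ fin Q.generate_incl[of "{fil 1 #> x}"] xQ
    by (intro card_subset_eq) (auto simp: order_def)
  then have "fil 1 #> y \<in> generate ?Q {fil 1 #> x}" using y by (auto simp: carrier_FactGroup)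
  moreover have "Q.ord (fil 1 #> x) \<noteq> 0" using ord prime_gt_0_nat[OF prime_p] by simp
  ultimately obtain d :: nat where "fil 1 #> y = (fil 1 #> x) [^]\<^bsub>?Q\<^esub> d"
    using Q.generate_pow_nat[OF xQ] by auto
  then have "fil 1 #> y = fil 1 #> x [^] d" using pw by simp
  then have "y \<in> fil 1 #> x [^] d" using rcos_self[OF y subgroup_fil, of 1] by metis
  then obtain z where z: "z \<in> fil 1" "y = z \<otimes> x [^] d" by (auto simp: r_coset_def)
  then have "y = x [^] d \<otimes> z" using xc fil_closed[OF z(1)] by (simp add: m_comm)
  then show "\<exists>d::nat. \<exists>z\<in>fil 1. y = x [^] d \<otimes> z" using z(1) by blast
qed

lemma lev_pow:
  assumes "x \<in> lev n"
  shows "x [^] (d::nat) \<in> fil (Suc n) \<longleftrightarrow> p dvd d"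
proof -
  obtain u where u: "u \<in> lev 0" "x = (s ^^ n) u" using assms by (rule lev_E)
  have uc: "u \<in> carrier G" using u by (auto simp: lev_def fil_0)
  have "x [^] d = (s ^^ n) (u [^] d)" using u uc by (simp add: s_pow_pow)
  then show ?thesis using s_pow_mem_fil[of "u [^] d" n 1] level_zero_pow(1)[OF u(1)] uc by simp
qed

lemma lev_not_dvd: "x \<in> lev n \<Longrightarrow> \<not> p dvd d \<Longrightarrow> x [^] (d::nat) \<in> lev n"
  using lev_pow[of x n d] fil_pow[of x n d] by (auto simp: lev_def)

lemma lev_int_pow:
  assumes "x \<in> lev n"
  shows "x [^] (d::int) \<in> fil (Suc n) \<longleftrightarrow> int p dvd d"
proof -
  have xc: "x \<in> carrier G" using assms fil_closed by (auto simp: lev_def)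
  show ?thesis
  proof (cases "d \<ge> 0")
    case True
    then obtain k where "d = int k" using nonneg_int_cases by blast
    then show ?thesis using lev_pow[OF assms, of k] by (simp add: int_pow_int)
  next
    case False
    then obtain k where k: "d = - int k" by (metis int_cases2 of_nat_0_le_iff)
    have "x [^] d = inv (x [^] k)" using xc k by (simp add: int_pow_neg_int)
    moreover have "inv (x [^] k) \<in> fil (Suc n) \<longleftrightarrow> x [^] k \<in> fil (Suc n)"
      using fil_inv[of "x [^] k" "Suc n"] fil_inv[of "inv (x [^] k)" "Suc n"] xc by auto
    ultimately show ?thesis using lev_pow[OF assms, of k] k by simp
  qed
qed

text \<open>
  Each filtration quotient is isomorphic to the first one through a power of \<open>s\<close>, so it is generated
  by any element of the right valuation.
\<close>

lemma fil_decompose: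
  assumes x: "x \<in> lev n" and y: "y \<in> fil n"
  shows "\<exists>d::nat. \<exists>z\<in>fil (Suc n). y = x [^] d \<otimes> z"
proof -
  obtain u where u: "u \<in> lev 0" "x = (s ^^ n) u" using x by (rule lev_E)
  obtain v where v: "v \<in> carrier G" "y = (s ^^ n) v" using y by (auto simp: fil_def)
  have uc: "u \<in> carrier G" using u by (auto simp: lev_def fil_0)
  obtain d z where dz: "z \<in> fil 1" "v = u [^] (d::nat) \<otimes> z"
    using level_zero_pow(2)[OF u(1) v(1)] by blast
  have zc: "z \<in> carrier G" using dz fil_closed by blast
  have "y = x [^] d \<otimes> (s ^^ n) z" using dz u v uc zc by (simp add: s_pow_pow s_pow_mult)
  moreover have "(s ^^ n) z \<in> fil (Suc n)" using s_pow_mem_fil[of z n 1] zc dz by simp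
  ultimately show ?thesis by blast
qed

text \<open>
  Modulo the first filtration step \<open>y\<close> is a power of \<open>x\<close>, so \<open>y\<^sup>p\<close> is \<open>s\<close> applied to another
  \<open>p\<close>-th power.  Iterating, it lies in every filtration step.
\<close>

lemma exponent_p:
  assumes x: "x \<in> lev 0" and xp: "x [^] p = \<one>" and y: "y \<in> carrier G"
  shows "y [^] p = \<one>"
proof (rule fil_Inter)
  fix n
  have xc: "x \<in> carrier G" using x by (auto simp: lev_def fil_0)
  show "y [^] p \<in> fil n" using y
  proof (induction n arbitrary: y)
    case (Suc n)
    obtain d z where dz: "z \<in> fil 1" "y = x [^] (d::nat) \<otimes> z"
      using level_zero_pow(2)[OF x Suc.prems] by blast
    then obtain u where u: "u \<in> carrier G" "z = s u" by (auto simp: fil_def)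
    have zc: "z \<in> carrier G" using dz fil_closed by blast
    have "y [^] p = (x [^] d) [^] p \<otimes> z [^] p" using dz xc zc by (simp add: nat_pow_distrib)
    also have "(x [^] d) [^] p = (x [^] p) [^] d" using xc by (simp add: nat_pow_pow mult.commute)
    also have "z [^] p = s (u [^] p)" using u s_pow_pow[of u 1 p] by simp
    finally have "y [^] p = s (u [^] p)" using xp u s_pow_closed[of "u [^] p" 1] by simp
    then show ?case using s_pow_mem_fil[of "u [^] p" 1 n] Suc.IH[OF u(1)] u by simp
  qed (auto simp: fil_0)
qed

lemma pth_power_fil:
  assumes x: "x \<in> lev 0" and xp: "x [^] p \<in> fil j" and y: "y \<in> carrier G"
  shows "y [^] p \<in> fil j"
proof -
  have xc: "x \<in> carrier G" using x by (auto simp: lev_def fil_0)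
  have "i \<le> j \<Longrightarrow> y [^] p \<in> fil i" for i using y
  proof (induction i arbitrary: y)
    case (Suc i)
    obtain d z where dz: "z \<in> fil 1" "y = x [^] (d::nat) \<otimes> z"
      using level_zero_pow(2)[OF x Suc.prems(2)] by blast
    then obtain u where u: "u \<in> carrier G" "z = s u" by (auto simp: fil_def)
    have zc: "z \<in> carrier G" using dz fil_closed by blast
    have "y [^] p = (x [^] d) [^] p \<otimes> z [^] p" using dz xc zc by (simp add: nat_pow_distrib)
    also have "(x [^] d) [^] p = (x [^] p) [^] d" using xc by (simp add: nat_pow_pow mult.commute)
    also have "z [^] p = s (u [^] p)" using u s_pow_pow[of u 1 p] by simp
    finally have "y [^] p = (x [^] p) [^] d \<otimes> s (u [^] p)" .
    moreover have "s (u [^] p) \<in> fil (Suc i)"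
      using s_pow_mem_fil[of "u [^] p" 1 i] Suc.IH[of u] Suc.prems u by simp
    moreover have "(x [^] p) [^] d \<in> fil (Suc i)"
      using fil_pow[OF xp] fil_antimono[OF Suc.prems(1)] by blast
    ultimately show ?case by (simp add: fil_mult)
  qed (auto simp: fil_0)
  then show ?thesis by simp
qed

text \<open>
  After undoing \<open>s\<^sup>k\<close>, the element is \<open>x\<^sup>d\<close> times an element of the form \<open>s u\<close>, with \<open>d\<close> prime to \<open>p\<close>.
  The power \<open>(x\<^sup>p)\<^sup>d\<close> has valuation \<open>j\<close>, whereas the other factor contributes \<open>s (u\<^sup>p)\<close>, which lies
  one step deeper.
\<close>

lemma pth_power_lev:
  assumes x: "x \<in> lev 0" and xp: "x [^] p \<in> lev j" and y: "y \<in> lev k"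
  shows "y [^] p \<in> lev (k + j)"
proof -
  have xc: "x \<in> carrier G" using x by (auto simp: lev_def fil_0)
  obtain v where v: "v \<in> lev 0" "y = (s ^^ k) v" using y by (rule lev_E)
  have vc: "v \<in> carrier G" using v by (auto simp: lev_def fil_0)
  obtain d z where dz: "z \<in> fil 1" "v = x [^] (d::nat) \<otimes> z"
    using level_zero_pow(2)[OF x vc] by blast
  then obtain u where u: "u \<in> carrier G" "z = s u" by (auto simp: fil_def)
  have zc: "z \<in> carrier G" using dz fil_closed by blast
  have "\<not> p dvd d"
    using v(1) dz fil_mult_cancel_right[of z 1 "x [^] d"] level_zero_pow(1)[OF x, of d] xc
    by (auto simp: lev_def)
  then have d: "(x [^] p) [^] d \<in> lev j" by (rule lev_not_dvd[OF xp])
  have "v [^] p = (x [^] d) [^] p \<otimes> z [^] p" using dz xc zc by (simp add: nat_pow_distrib)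
  also have "(x [^] d) [^] p = (x [^] p) [^] d" using xc by (simp add: nat_pow_pow mult.commute)
  also have "z [^] p = s (u [^] p)" using u s_pow_pow[of u 1 p] by simp
  finally have vp: "v [^] p = (x [^] p) [^] d \<otimes> s (u [^] p)" .
  have "u [^] p \<in> fil j" using pth_power_fil[OF x _ u(1)] xp by (simp add: lev_def)
  then have su: "s (u [^] p) \<in> fil (Suc j)" using s_pow_mem_fil[of "u [^] p" 1 j] u by simp
  have "v [^] p \<notin> fil (Suc j)" using vp d fil_mult_cancel_right[OF su, of "(x [^] p) [^] d"] xc
    by (auto simp: lev_def)
  moreover have "v [^] p \<in> fil j" using pth_power_fil[OF x _ vc] xp by (simp add: lev_def)
  moreover have "y [^] p = (s ^^ k) (v [^] p)" using v vc by (simp add: s_pow_pow)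
  ultimately show ?thesis
    using s_pow_mem_fil[of "v [^] p" k j] s_pow_mem_fil[of "v [^] p" k "Suc j"] vc by (simp add: lev_def)
qed

lemma pth_power_lev_exists:
  assumes x: "x \<in> lev 0" and xp: "x [^] p \<noteq> \<one>"
  obtains j where "1 \<le> j" "x [^] p \<in> lev j"
proof -
  have xc: "x \<in> carrier G" using x by (auto simp: lev_def fil_0)
  obtain n where n: "x [^] p \<notin> fil n" using fil_Inter[of "x [^] p"] xp by blast
  then obtain j where j: "x [^] p \<in> lev j" using not_one_lev[of "x [^] p" n] xc by auto
  have "j \<noteq> 0"
    using j level_zero_pow(1)[OF x, of p] by (intro notI) (auto simp: lev_def)
  then show ?thesis using that[OF _ j] by simp
qed

text \<open>
  A form of torsion-freeness that passes to limits: the depth of \<open>y\<^sup>d\<close> is bounded in terms of the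
  depth of \<open>y\<close> and of \<open>d\<close> alone.  Exponents prime to \<open>p\<close> preserve the valuation and each factor \<open>p\<close>
  raises it by the constant \<open>j\<close>.
\<close>

lemma power_bound:
  assumes x: "x \<in> lev 0" and xp: "x [^] p \<noteq> \<one>" and d: "0 < d"
  shows "\<exists>N. \<forall>y\<in>carrier G. y \<notin> fil k \<longrightarrow> y [^] (d::nat) \<notin> fil N"
  using d
proof (induction d arbitrary: k rule: less_induct)
  case (less d)
  obtain j where j: "1 \<le> j" "x [^] p \<in> lev j" using pth_power_lev_exists[OF x xp] .
  show ?case
  proof (cases "p dvd d")
    case False
    have "y [^] d \<notin> fil k" if y: "y \<in> carrier G" "y \<notin> fil k" for y
    proof -
      obtain i where i: "i < k" "y \<in> lev i" using y by (rule not_one_lev)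
      then show ?thesis using lev_pow[OF i(2), of d] False fil_antimono[of "Suc i" k] by auto
    qed
    then show ?thesis by blast
  next
    case True
    then obtain e where e: "d = p * e" by blast
    then have e1: "0 < e" "e < d" using less.prems prime_gt_1_nat[OF prime_p] by auto
    obtain N where N: "\<And>y. y \<in> carrier G \<Longrightarrow> y \<notin> fil (k + j) \<Longrightarrow> y [^] e \<notin> fil N"
      using less.IH[OF e1(2,1), of "k + j"] by blast
    have "y [^] d \<notin> fil N" if y: "y \<in> carrier G" "y \<notin> fil k" for y
    proof -
      obtain i where i: "i < k" "y \<in> lev i" using y by (rule not_one_lev)
      have "y [^] p \<in> lev (i + j)" by (rule pth_power_lev[OF x j(2) i(2)])
      then have "y [^] p \<notin> fil (k + j)" using i(1) fil_antimono[of "Suc (i + j)" "k + j"]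
        by (auto simp: lev_def)
      then show ?thesis using N[of "y [^] p"] y e by (simp add: nat_pow_pow)
    qed
    then show ?thesis by blast
  qed
qed

text \<open>
  If \<open>x\<close> has valuation 0 and \<open>x\<^sup>p\<close> has valuation \<open>j \<ge> 1\<close>, this sequence contains one element of each
  valuation, and the \<open>p\<close>-th power map is the index shift by \<open>j\<close> on it.  The simpler choice \<open>s\<^sup>k x\<close> for
  all \<open>k\<close> would lack the second property, since \<open>x\<^sup>p\<close> may differ from \<open>s\<^sup>j x\<close>.  For \<open>j = 0\<close> the
  recursion would not terminate, so there the \<open>s\<close>-translates of \<open>x\<close> are taken throughout.
\<close>

function ladder :: "'a \<Rightarrow> nat \<Rightarrow> nat \<Rightarrow> 'a" where
  "ladder x j k = (if k < j \<or> j = 0 then (s ^^ k) x else ladder x j (k - j) [^] p)"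
  by pat_completeness auto
termination by (relation "measure (\<lambda>(x, j, k). k)") auto

declare ladder.simps [simp del]

lemma ladder_add: "1 \<le> j \<Longrightarrow> ladder x j (k + j) = ladder x j k [^] p"
  by (subst ladder.simps) simp

lemma ladder_lev:
  assumes "x \<in> lev 0" and "x [^] p \<in> lev j"
  shows "ladder x j k \<in> lev k"
proof (induction k rule: less_induct)
  case (less k)
  show ?case
  proof (cases "k < j \<or> j = 0")
    case True
    then show ?thesis using lev_s_pow[OF assms(1)] by (simp add: ladder.simps[of x j k])
  next
    case False
    then have "ladder x j (k - j) [^] p \<in> lev (k - j + j)"
      using less by (intro pth_power_lev[OF assms]) auto
    then show ?thesis using False by (simp add: ladder.simps[of x j k])
  qed
qed

end

section \<open>Matching two such groups\<close>

text \<open>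
  In an abelian group the products with one distinguished factor split off are closed under the group
  operations.
\<close>

lemma (in comm_group) generate_tail_decompose:
  fixes r :: "nat \<Rightarrow> 'a"
  assumes r: "range r \<subseteq> carrier G" and x: "x \<in> generate G (r ` {n..})"
  shows "\<exists>d::int. \<exists>y\<in>generate G (r ` {Suc n..}). x = r n [^] d \<otimes> y"
proof -
  have rn: "r k \<in> carrier G" for k using r by blast
  show ?thesis using x
  proof (induction rule: generate.induct)
    case one
    then show ?case using generate.one by (intro exI[of _ 0] bexI[of _ \<one>]) auto
  next
    case (incl h)
    then obtain k where k: "n \<le> k" "h = r k" by auto
    then show ?case
    proof (cases "k = n")
      case True
      then show ?thesis using k rn generate.one by (intro exI[of _ 1] bexI[of _ \<one>]) auto
    next
      case False
      then have "h \<in> generate G (r ` {Suc n..})" using k by (auto intro: generate.incl)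
      then show ?thesis using k rn by (intro exI[of _ 0] bexI[of _ h]) auto
    qed
  next
    case (inv h)
    then obtain k where k: "n \<le> k" "h = r k" by auto
    then show ?case
    proof (cases "k = n")
      case True
      then show ?thesis using k rn generate.one by (intro exI[of _ "-1"] bexI[of _ \<one>]) (auto simp: int_pow_neg)
    next
      case False
      then have "inv h \<in> generate G (r ` {Suc n..})" using k by (auto intro: generate.inv)
      then show ?thesis using k rn by (intro exI[of _ 0] bexI[of _ "inv h"]) auto
    qed
  next
    case (eng h1 h2)
    then obtain d1 d2 :: int and y1 y2 where y: "y1 \<in> generate G (r ` {Suc n..})"
        "y2 \<in> generate G (r ` {Suc n..})" "h1 = r n [^] d1 \<otimes> y1" "h2 = r n [^] d2 \<otimes> y2" by blast
    have yc: "y1 \<in> carrier G" "y2 \<in> carrier G" "r n \<in> carrier G"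
      using y(1,2) r generate_incl[of "r ` {Suc n..}"] by blast+
    have "h1 \<otimes> h2 = r n [^] (d1 + d2) \<otimes> (y1 \<otimes> y2)"
      using y(3,4) yc by (simp add: int_pow_mult m_ac)
    then show ?case using generate.eng[OF y(1,2)] by blast
  qed
qed

lemma comm_group_DirProd:
  assumes "comm_group G" "comm_group H"
  shows "comm_group (G \<times>\<times> H)"
proof -
  interpret G: comm_group G by fact
  interpret H: comm_group H by fact
  interpret GH: group "G \<times>\<times> H" by (intro DirProd_group G.is_group H.is_group)
  show ?thesis by (rule GH.group_comm_groupI) (auto simp: DirProd_def G.m_comm H.m_comm)
qed

lemma DirProd_fst_hom: "fst \<in> hom (G \<times>\<times> H) G" and DirProd_snd_hom: "snd \<in> hom (G \<times>\<times> H) H"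
  by (auto simp: hom_def DirProd_def)

text \<open>
  Two groups with elements \<open>b k\<close>, \<open>c k\<close> of each valuation whose \<open>p\<close>-th powers are expressed in the same
  way by later elements of the two sequences; the last assumption says this in the product group.
\<close>

locale shift_group_pair = G: shift_group G s p + H: shift_group H t p
  for G :: "('a, 'c) monoid_scheme" and s and H :: "('b, 'd) monoid_scheme" and t and p +
  fixes b :: "nat \<Rightarrow> 'a" and c :: "nat \<Rightarrow> 'b"
  assumes b_lev: "\<And>k. b k \<in> G.lev k" and c_lev: "\<And>k. c k \<in> H.lev k"
    and pth_power: "\<And>k. (b k [^]\<^bsub>G\<^esub> p, c k [^]\<^bsub>H\<^esub> p)
                \<in> generate (G \<times>\<times> H) ((\<lambda>k. (b k, c k)) ` {Suc k..})"
begin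

text \<open>
  The subgroup \<open>R 0\<close> is the graph of the correspondence taking \<open>b k\<close> to \<open>c k\<close>, and \<open>R n\<close> is the part
  generated by the elements of valuation at least \<open>n\<close>.
\<close>

definition R :: "nat \<Rightarrow> ('a \<times> 'b) set" where
  "R n = generate (G \<times>\<times> H) ((\<lambda>k. (b k, c k)) ` {n..})"

sublocale GH: comm_group "G \<times>\<times> H"
  by (intro comm_group_DirProd G.comm_group_axioms H.comm_group_axioms)

lemma b_closed: "b k \<in> carrier G" and c_closed: "c k \<in> carrier H"
  using b_lev[of k] c_lev[of k] G.fil_closed H.fil_closed by (auto simp: G.lev_def H.lev_def)

lemma subgroup_R: "subgroup (R n) (G \<times>\<times> H)"
  unfolding R_def using b_closed c_closed by (intro GH.generate_is_subgroup) auto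

lemma R_subset: "R n \<subseteq> G.fil n \<times> H.fil n"
  unfolding R_def
proof (rule GH.generate_subgroup_incl)
  show "(\<lambda>k. (b k, c k)) ` {n..} \<subseteq> G.fil n \<times> H.fil n"
    using b_lev c_lev G.fil_antimono H.fil_antimono by (fastforce simp: G.lev_def H.lev_def)
  show "subgroup (G.fil n \<times> H.fil n) (G \<times>\<times> H)"
    by (intro DirProd_subgroups G.subgroup_fil H.subgroup_fil G.is_group H.is_group)
qed

text \<open>
  Split off the power of \<open>(b n, c n)\<close> with exponent \<open>d\<close>.  If one component lies one step deeper than
  guaranteed, then \<open>p\<close> divides \<open>d\<close>, and by the common relation for \<open>p\<close>-th powers the split-off factor
  belongs to \<open>R (Suc n)\<close> as well.
\<close>

lemma R_step:
  assumes "(x, y) \<in> R n" and "x \<in> G.fil (Suc n) \<or> y \<in> H.fil (Suc n)"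
  shows "(x, y) \<in> R (Suc n)"
proof -
  let ?r = "\<lambda>k. (b k, c k)"
  have rc: "?r k \<in> carrier (G \<times>\<times> H)" for k using b_closed c_closed by simp
  obtain d :: int and z where z: "z \<in> R (Suc n)" "(x, y) = ?r n [^]\<^bsub>G \<times>\<times> H\<^esub> d \<otimes>\<^bsub>G \<times>\<times> H\<^esub> z"
    using GH.generate_tail_decompose[of ?r "(x, y)" n] assms(1) rc unfolding R_def by fastforce
  obtain z1 z2 where z12: "z = (z1, z2)" by (cases z)
  have zf: "z1 \<in> G.fil (Suc n)" "z2 \<in> H.fil (Suc n)" using R_subset z(1) z12 by auto
  have pw: "?r n [^]\<^bsub>G \<times>\<times> H\<^esub> e = (b n [^]\<^bsub>G\<^esub> e, c n [^]\<^bsub>H\<^esub> e)" for e :: int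
    using hom_int_pow[OF DirProd_fst_hom rc GH.is_group G.is_group, of n e]
      hom_int_pow[OF DirProd_snd_hom rc GH.is_group H.is_group, of n e] by (metis fst_conv snd_conv prod.collapse)
  have xy: "x = b n [^]\<^bsub>G\<^esub> d \<otimes>\<^bsub>G\<^esub> z1" "y = c n [^]\<^bsub>H\<^esub> d \<otimes>\<^bsub>H\<^esub> z2"
    using z(2) pw z12 by auto
  have "int p dvd d"
    using assms(2) xy G.fil_mult_cancel_right[OF zf(1)] H.fil_mult_cancel_right[OF zf(2)]
      b_closed c_closed G.lev_int_pow[OF b_lev] H.lev_int_pow[OF c_lev] by auto
  then obtain e where e: "d = int p * e" by blast
  have "?r n [^]\<^bsub>G \<times>\<times> H\<^esub> int p \<in> R (Suc n)"
    using pth_power[of n] pw[of "int p"] by (simp add: R_def int_pow_int)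
  then have "(?r n [^]\<^bsub>G \<times>\<times> H\<^esub> int p) [^]\<^bsub>G \<times>\<times> H\<^esub> e \<in> R (Suc n)"
    by (rule GH.subgroup_int_pow_closed[OF subgroup_R])
  then have "?r n [^]\<^bsub>G \<times>\<times> H\<^esub> d \<in> R (Suc n)" using e GH.int_pow_pow[OF rc] by simp
  then show ?thesis using z subgroup.m_closed[OF subgroup_R] by simp
qed

lemma R_fil:
  assumes "(x, y) \<in> R 0" and "x \<in> G.fil n \<or> y \<in> H.fil n"
  shows "(x, y) \<in> R n"
  using assms(2)
proof (induction n)
  case (Suc n)
  then have "x \<in> G.fil n \<or> y \<in> H.fil n" using G.fil_antimono[of n "Suc n"] H.fil_antimono[of n "Suc n"] by auto
  then show ?case using Suc R_step by blast
qed (use assms in auto)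

lemma R_fil_iff: "(x, y) \<in> R 0 \<Longrightarrow> x \<in> G.fil n \<longleftrightarrow> y \<in> H.fil n"
  using R_fil R_subset by blast

lemma R_pow: "(b n [^]\<^bsub>G\<^esub> (d::nat), c n [^]\<^bsub>H\<^esub> d) \<in> R 0"
proof (induction d)
  case 0
  then show ?case using subgroup.one_closed[OF subgroup_R, of 0] by simp
next
  case (Suc d)
  have "(b n, c n) \<in> R 0" unfolding R_def by (auto intro: generate.incl)
  from subgroup.m_closed[OF subgroup_R Suc this] show ?case by simp
qed

text \<open>
  Divide successively by suitable powers of \<open>b 0, b 1, \<dots>\<close>, each of which has a partner.
\<close>

lemma R_dense_left:
  assumes "x \<in> carrier G"
  shows "\<exists>y z w. (y, w) \<in> R 0 \<and> z \<in> G.fil n \<and> x = y \<otimes>\<^bsub>G\<^esub> z"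
proof (induction n)
  case 0
  have "(\<one>\<^bsub>G\<^esub>, \<one>\<^bsub>H\<^esub>) \<in> R 0" using subgroup.one_closed[OF subgroup_R, of 0] by simp
  moreover have "x = \<one>\<^bsub>G\<^esub> \<otimes>\<^bsub>G\<^esub> x" using assms by simp
  ultimately show ?case using assms by (metis G.fil_0)
next
  case (Suc n)
  then obtain y z w where yz: "(y, w) \<in> R 0" "z \<in> G.fil n" "x = y \<otimes>\<^bsub>G\<^esub> z" by blast
  obtain d v where v: "v \<in> G.fil (Suc n)" "z = b n [^]\<^bsub>G\<^esub> (d::nat) \<otimes>\<^bsub>G\<^esub> v"
    using G.fil_decompose[OF b_lev yz(2)] by blast
  have "(y \<otimes>\<^bsub>G\<^esub> b n [^]\<^bsub>G\<^esub> d, w \<otimes>\<^bsub>H\<^esub> c n [^]\<^bsub>H\<^esub> d) \<in> R 0"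
    using subgroup.m_closed[OF subgroup_R yz(1) R_pow] by simp
  moreover have "x = (y \<otimes>\<^bsub>G\<^esub> b n [^]\<^bsub>G\<^esub> d) \<otimes>\<^bsub>G\<^esub> v"
    using yz v b_closed G.fil_closed[OF v(1)] R_subset[of 0] by (auto simp: G.m_assoc G.fil_0)
  ultimately show ?case using v(1) by blast
qed

lemma R_dense_right:
  assumes "x \<in> carrier H"
  shows "\<exists>y z w. (w, y) \<in> R 0 \<and> z \<in> H.fil n \<and> x = y \<otimes>\<^bsub>H\<^esub> z"
proof (induction n)
  case 0
  have "(\<one>\<^bsub>G\<^esub>, \<one>\<^bsub>H\<^esub>) \<in> R 0" using subgroup.one_closed[OF subgroup_R, of 0] by simp
  moreover have "x = \<one>\<^bsub>H\<^esub> \<otimes>\<^bsub>H\<^esub> x" using assms by simp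
  ultimately show ?case using assms by (metis H.fil_0)
next
  case (Suc n)
  then obtain y z w where yz: "(w, y) \<in> R 0" "z \<in> H.fil n" "x = y \<otimes>\<^bsub>H\<^esub> z" by blast
  obtain d v where v: "v \<in> H.fil (Suc n)" "z = c n [^]\<^bsub>H\<^esub> (d::nat) \<otimes>\<^bsub>H\<^esub> v"
    using H.fil_decompose[OF c_lev yz(2)] by blast
  have "(w \<otimes>\<^bsub>G\<^esub> b n [^]\<^bsub>G\<^esub> d, y \<otimes>\<^bsub>H\<^esub> c n [^]\<^bsub>H\<^esub> d) \<in> R 0"
    using subgroup.m_closed[OF subgroup_R yz(1) R_pow] by simp
  moreover have "x = (y \<otimes>\<^bsub>H\<^esub> c n [^]\<^bsub>H\<^esub> d) \<otimes>\<^bsub>H\<^esub> v"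
    using yz v c_closed H.fil_closed[OF v(1)] R_subset[of 0] by (auto simp: H.m_assoc H.fil_0)
  ultimately show ?case using v(1) by blast
qed

end

text \<open>
  In exponent \<open>p\<close> the \<open>s\<close>-translates of one element of valuation 0 already have matching relations.
\<close>

lemma shift_group_pair_exponent_p:
  assumes "shift_group G s p" and "shift_group H t p"
    and "x \<in> shift_group.lev G s 0" and "y \<in> shift_group.lev H t 0"
    and "x [^]\<^bsub>G\<^esub> p = \<one>\<^bsub>G\<^esub>" and "y [^]\<^bsub>H\<^esub> p = \<one>\<^bsub>H\<^esub>"
  shows "shift_group_pair G s H t p (\<lambda>k. (s ^^ k) x) (\<lambda>k. (t ^^ k) y)"
proof -
  interpret G: shift_group G s p by fact
  interpret H: shift_group H t p by fact
  have one: "(s ^^ k) x [^]\<^bsub>G\<^esub> p = \<one>\<^bsub>G\<^esub>" "(t ^^ k) y [^]\<^bsub>H\<^esub> p = \<one>\<^bsub>H\<^esub>" for k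
    using G.exponent_p[OF assms(3,5)] H.exponent_p[OF assms(4,6)] assms(3,4)
    by (simp_all add: G.lev_def G.fil_0 H.lev_def H.fil_0)
  show ?thesis
  proof unfold_locales
    show "(s ^^ k) x \<in> G.lev k" "(t ^^ k) y \<in> H.lev k" for k
      by (rule G.lev_s_pow[OF assms(3)], rule H.lev_s_pow[OF assms(4)])
    show "((s ^^ k) x [^]\<^bsub>G\<^esub> p, (t ^^ k) y [^]\<^bsub>H\<^esub> p)
        \<in> generate (G \<times>\<times> H) ((\<lambda>k. ((s ^^ k) x, (t ^^ k) y)) ` {Suc k..})" for k
      using generate.one[of "G \<times>\<times> H"] one by simp
  qed
qed

text \<open>
  The only relations needed are that the \<open>p\<close>-th power of term \<open>k\<close> is term \<open>k + j\<close>; that \<open>j \<ge> 1\<close>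
  puts it among the later terms.
\<close>

lemma shift_group_pair_ladder:
  assumes "shift_group G s p" and "shift_group H t p" and "1 \<le> j"
    and "x \<in> shift_group.lev G s 0" and "y \<in> shift_group.lev H t 0"
    and "x [^]\<^bsub>G\<^esub> p \<in> shift_group.lev G s j" and "y [^]\<^bsub>H\<^esub> p \<in> shift_group.lev H t j"
  shows "shift_group_pair G s H t p (shift_group.ladder G s p x j) (shift_group.ladder H t p y j)"
proof -
  interpret G: shift_group G s p by fact
  interpret H: shift_group H t p by fact
  show ?thesis
  proof unfold_locales
    show "G.ladder x j k \<in> G.lev k" "H.ladder y j k \<in> H.lev k" for k
      using assms by (auto intro: G.ladder_lev H.ladder_lev)
    show "(G.ladder x j k [^]\<^bsub>G\<^esub> p, H.ladder y j k [^]\<^bsub>H\<^esub> p)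
        \<in> generate (G \<times>\<times> H) ((\<lambda>k. (G.ladder x j k, H.ladder y j k)) ` {Suc k..})" for k
      using assms(3) by (intro generate.incl image_eqI[of _ _ "k + j"])
        (simp_all add: G.ladder_add H.ladder_add)
  qed
qed

section \<open>Automorphisms of the tree\<close>

text \<open>
  The inverse of a function, as opposed to the inverse in a group structure.
\<close>

abbreviation finv :: "('a \<Rightarrow> 'b) \<Rightarrow> 'b \<Rightarrow> 'a" where
  "finv \<equiv> inv_into UNIV"

lemma tree_mult [simp]: "f \<otimes>\<^bsub>tree_aut m\<^esub> g = g \<circ> f"
  and tree_one [simp]: "\<one>\<^bsub>tree_aut m\<^esub> = id"
  by (simp_all add: tree_aut_def)

lemma sub_aut_pow [simp]: "f [^]\<^bsub>sub_aut m B\<^esub> (n::nat) = f ^^ n"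
  by (induction n) simp_all

lemma tree_comp: "f \<in> carrier (tree_aut m) \<Longrightarrow> g \<in> carrier (tree_aut m) \<Longrightarrow> f \<circ> g \<in> carrier (tree_aut m)"
  using monoid.m_closed[OF group.is_monoid[OF group_tree_aut], of g m f] by simp

lemma tree_id: "id \<in> carrier (tree_aut m)"
  using monoid.one_closed[OF group.is_monoid[OF group_tree_aut], of m] by simp

lemma tree_bij: "f \<in> carrier (tree_aut m) \<Longrightarrow> bij f"
  by (auto simp: tree_aut_carrier_iff dest: permutes_bij)

lemma tree_inv:
  assumes "f \<in> carrier (tree_aut m)"
  shows "inv\<^bsub>tree_aut m\<^esub> f = finv f"
proof -
  have "inv\<^bsub>tree_aut m\<^esub> f \<otimes>\<^bsub>tree_aut m\<^esub> f = \<one>\<^bsub>tree_aut m\<^esub>"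
    by (rule group.l_inv[OF group_tree_aut assms])
  then have "f \<circ> inv\<^bsub>tree_aut m\<^esub> f = id" by simp
  then have "finv f \<circ> (f \<circ> inv\<^bsub>tree_aut m\<^esub> f) = finv f" by simp
  then show ?thesis using tree_bij[OF assms] by (simp add: bij_is_inj flip: comp_assoc)
qed

lemma tree_inv_closed: "f \<in> carrier (tree_aut m) \<Longrightarrow> finv f \<in> carrier (tree_aut m)"
  using group.inv_closed[OF group_tree_aut, of f m] by (simp add: tree_inv)

lemma tree_inv_apply:
  assumes "f \<in> carrier (tree_aut m)"
  shows "finv f (f w) = w" and "f (finv f w) = w"
  using tree_bij[OF assms] by (simp_all add: bij_is_inj bij_is_surj surj_f_inv_f)

lemma tree_words: "f \<in> carrier (tree_aut m) \<Longrightarrow> f w \<in> words m \<longleftrightarrow> w \<in> words m"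
  by (auto simp: tree_aut_carrier_iff permutes_in_image)

lemma tree_outside: "f \<in> carrier (tree_aut m) \<Longrightarrow> w \<notin> words m \<Longrightarrow> f w = w"
  by (meson permutes_not_in tree_aut_carrier_iff)

lemma tree_eqI:
  assumes "f \<in> carrier (tree_aut m)" "g \<in> carrier (tree_aut m)"
    and "\<And>w. w \<in> words m \<Longrightarrow> f w = g w"
  shows "f = g"
  using assms tree_outside by (metis ext)

text \<open>
  A length-preserving injection of the vertices is bijective since the levels are finite, and it
  preserves the parent relation in both directions as soon as it does so in one.
\<close>

lemma tree_aut_I:
  assumes words: "\<And>w. w \<in> words m \<Longrightarrow> f w \<in> words m"
    and len: "\<And>w. w \<in> words m \<Longrightarrow> length (f w) = length w"
    and inj: "\<And>v w. v \<in> words m \<Longrightarrow> w \<in> words m \<Longrightarrow> f v = f w \<Longrightarrow> v = w"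
    and outside: "\<And>w. w \<notin> words m \<Longrightarrow> f w = w"
    and child: "\<And>u y. u @ [y] \<in> words m \<Longrightarrow> \<exists>z. f (u @ [y]) = f u @ [z]"
  shows "f \<in> carrier (tree_aut m)"
  unfolding tree_aut_carrier_iff
proof (intro conjI ballI iffI)
  have "f ` {w \<in> words m. length w = n} = {w \<in> words m. length w = n}" for n
    by (rule endo_inj_surj[OF finite_words_length]) (auto simp: words len inj_on_def intro: inj)
  then have "w \<in> f ` words m" if "w \<in> words m" for w using that by blast
  then have "bij_betw f (words m) (words m)"
    using words by (auto simp: bij_betw_def inj_on_def intro: inj)
  then show "f permutes words m" using outside by (rule bij_imp_permutes)
  fix u v assume uv: "u \<in> words m" "v \<in> words m"
  show "is_child (f u) (f v)" if "is_child u v"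
    using that uv child by (auto simp: is_child_def)
  assume c: "is_child (f u) (f v)"
  then have "length v \<noteq> 0" using len[OF uv(2)] by (auto simp: is_child_def)
  then obtain v' y where v: "v = v' @ [y]" by (metis append_butlast_last_id list.size(3))
  then obtain z where "f v = f v' @ [z]" using child uv(2) by blast
  then have "f u = f v'" using c by (auto simp: is_child_def)
  then have "u = v'" using inj uv v by auto
  then show "is_child u v" using v by (simp add: is_child_def)
qed

section \<open>Sections and the diagonal map\<close>

lemma root_perm_in: "f \<in> carrier (tree_aut m) \<Longrightarrow> y \<in> {1..m} \<Longrightarrow> root_perm m f y \<in> {1..m}"
  using tree_aut_cons[of f m y "[]"] tree_words[of f m "[y]"] by auto

lemma tree_apply_singleton: "f \<in> carrier (tree_aut m) \<Longrightarrow> y \<in> {1..m} \<Longrightarrow> f [y] = [root_perm m f y]"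
  using tree_aut_cons[of f m y "[]"] tree_aut_length[of f m "[y]"] by (auto simp: length_Suc_conv)

lemma section1_closed:
  assumes f: "f \<in> carrier (tree_aut m)" and y: "y \<in> {1..m}"
  shows "section1 m f y \<in> carrier (tree_aut m)"
proof (rule tree_aut_I)
  fix w assume w: "w \<in> words m"
  then have yw: "y # w \<in> words m" using y by simp
  have eq: "f (y # w) = root_perm m f y # section1 m f y w" by (rule tree_aut_cons[OF f yw])
  show "section1 m f y w \<in> words m" using eq tree_words[OF f, of "y # w"] yw by simp
  show "length (section1 m f y w) = length w" using eq tree_aut_length[OF f yw] by simp
next
  fix v w assume vw: "v \<in> words m" "w \<in> words m" "section1 m f y v = section1 m f y w"
  then have "f (y # v) = f (y # w)" using tree_aut_cons[OF f] y by simp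
  then show "v = w" using tree_inv_apply(1)[OF f] by (metis list.inject)
next
  fix w assume "w \<notin> words m"
  then show "section1 m f y w = w" by (simp add: section1_def)
next
  fix u x assume u: "u @ [x] \<in> words m"
  then obtain z where "f ((y # u) @ [x]) = f (y # u) @ [z]"
    using tree_aut_append[OF f, of "y # u" x] y by auto
  then show "\<exists>z. section1 m f y (u @ [x]) = section1 m f y u @ [z]"
    using tree_aut_cons[OF f, of y u] tree_aut_cons[OF f, of y "u @ [x]"] u y by (auto intro!: exI[of _ z])
qed

lemma root_perm_comp:
  assumes "f \<in> carrier (tree_aut m)" "g \<in> carrier (tree_aut m)" "y \<in> {1..m}"
  shows "root_perm m (f \<circ> g) y = root_perm m f (root_perm m g y)"
  using tree_apply_singleton[OF tree_comp[OF assms(1,2)] assms(3)] tree_apply_singleton[OF assms(2,3)]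
    tree_apply_singleton[OF assms(1) root_perm_in[OF assms(2,3)]] by simp

lemma section1_comp:
  assumes f: "f \<in> carrier (tree_aut m)" and g: "g \<in> carrier (tree_aut m)" and y: "y \<in> {1..m}"
  shows "section1 m (f \<circ> g) y = section1 m f (root_perm m g y) \<circ> section1 m g y"
proof
  fix u
  show "section1 m (f \<circ> g) y u = (section1 m f (root_perm m g y) \<circ> section1 m g y) u"
  proof (cases "u \<in> words m")
    case True
    then have g': "g (y # u) = root_perm m g y # section1 m g y u" using tree_aut_cons[OF g] y by simp
    have "g (y # u) \<in> words m" using tree_words[OF g, of "y # u"] True y by simp
    then have "f (g (y # u)) = root_perm m f (root_perm m g y) # section1 m f (root_perm m g y) (section1 m g y u)"
      using tree_aut_cons[OF f] g' by metis
    then show ?thesis using True by (simp add: section1_def[of m "f \<circ> g"])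
  qed (simp add: section1_def)
qed

lemma section1_id [simp]: "section1 m id y = id"
  by (auto simp: section1_def)

lemma tree_eq_sectionsI:
  assumes "f \<in> carrier (tree_aut m)" "g \<in> carrier (tree_aut m)"
    and "\<And>y. y \<in> {1..m} \<Longrightarrow> root_perm m f y = root_perm m g y"
    and "\<And>y. y \<in> {1..m} \<Longrightarrow> section1 m f y = section1 m g y"
  shows "f = g"
proof (rule tree_eqI[OF assms(1,2)])
  fix w assume "w \<in> words m"
  then show "f w = g w"
    using assms tree_aut_nil[OF assms(1)] tree_aut_nil[OF assms(2)]
      tree_aut_cons[OF assms(1)] tree_aut_cons[OF assms(2)] by (cases w) auto
qed

lemma wreath_cons: "y # u \<in> words m \<Longrightarrow> wreath m a \<pi> (y # u) = \<pi> y # a y u"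
  by (simp add: wreath_def)

lemma wreath_closed:
  assumes a: "\<And>y. y \<in> {1..m} \<Longrightarrow> a y \<in> carrier (tree_aut m)" and p: "\<pi> permutes {1..m}"
  shows "wreath m a \<pi> \<in> carrier (tree_aut m)"
proof (rule tree_aut_I)
  have pi: "\<pi> y \<in> {1..m} \<longleftrightarrow> y \<in> {1..m}" for y by (rule permutes_in_image[OF p])
  fix w assume w: "w \<in> words m"
  then show "wreath m a \<pi> w \<in> words m"
    using pi tree_words[OF a] by (auto simp: wreath_def split: list.splits)
  show "length (wreath m a \<pi> w) = length w"
    using w tree_aut_length[OF a] by (auto simp: wreath_def split: list.splits)
next
  fix v w assume vw: "v \<in> words m" "w \<in> words m" "wreath m a \<pi> v = wreath m a \<pi> w"
  show "v = w"
  proof (cases v)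
    case Nil
    then show ?thesis using vw by (cases w) (auto simp: wreath_def)
  next
    case (Cons x u)
    then obtain y t where w: "w = y # t" using vw by (cases w) (auto simp: wreath_def)
    have e: "\<pi> x = \<pi> y" "a x u = a y t" using vw Cons w by (auto simp: wreath_def)
    then have "x = y" using permutes_inj[OF p] by (auto dest: injD)
    then show ?thesis using e(2) vw(1) Cons w tree_inv_apply(1)[OF a, of x] by (metis cons_in_words)
  qed
next
  fix w assume "w \<notin> words m"
  then show "wreath m a \<pi> w = w" by (simp add: wreath_def)
next
  fix u y assume u: "u @ [y] \<in> words m"
  show "\<exists>z. wreath m a \<pi> (u @ [y]) = wreath m a \<pi> u @ [z]"
    using u tree_aut_append[OF a, of _ "tl u" y] tree_aut_nil[OF a] by (cases u) (auto simp: wreath_def)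
qed

lemma root_perm_wreath: "y \<in> {1..m} \<Longrightarrow> root_perm m (wreath m a \<pi>) y = \<pi> y"
  by (simp add: root_perm_def wreath_cons)

lemma section1_wreath:
  "a y \<in> carrier (tree_aut m) \<Longrightarrow> y \<in> {1..m} \<Longrightarrow> section1 m (wreath m a \<pi>) y = a y"
  using tree_outside[of "a y" m] by (auto simp: section1_def wreath_cons fun_eq_iff)

lemma diag_closed: "f \<in> carrier (tree_aut m) \<Longrightarrow> diag m f \<in> carrier (tree_aut m)"
  unfolding diag_def by (rule wreath_closed) (auto simp: permutes_id)

lemma diag_cons: "y # u \<in> words m \<Longrightarrow> diag m f (y # u) = y # f u"
  by (simp add: diag_def wreath_cons)

lemma section1_diag:
  assumes "f \<in> carrier (tree_aut m)" "y \<in> {1..m}"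
  shows "section1 m (diag m f) y = f"
  using assms tree_outside by (fastforce simp: section1_def diag_cons)

lemma root_perm_diag: "y \<in> {1..m} \<Longrightarrow> root_perm m (diag m f) y = y"
  by (simp add: root_perm_def diag_cons)

lemma diag_comp:
  assumes f: "f \<in> carrier (tree_aut m)" and g: "g \<in> carrier (tree_aut m)"
  shows "diag m (f \<circ> g) = diag m f \<circ> diag m g"
proof (rule tree_eq_sectionsI)
  show "diag m (f \<circ> g) \<in> carrier (tree_aut m)" "diag m f \<circ> diag m g \<in> carrier (tree_aut m)"
    by (intro diag_closed tree_comp f g)+
  fix y assume y: "y \<in> {1..m}"
  show "root_perm m (diag m (f \<circ> g)) y = root_perm m (diag m f \<circ> diag m g) y"
    using f g y by (simp add: root_perm_comp diag_closed root_perm_diag)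
  show "section1 m (diag m (f \<circ> g)) y = section1 m (diag m f \<circ> diag m g) y"
    using f g y by (simp add: section1_comp diag_closed root_perm_diag section1_diag tree_comp)
qed

lemma diag_inj:
  assumes "f \<in> carrier (tree_aut m)" "g \<in> carrier (tree_aut m)" "1 \<le> m" "diag m f = diag m g"
  shows "f = g"
  using assms section1_diag[of f m 1] section1_diag[of g m 1] by simp

lemma diag_pow_closed: "f \<in> carrier (tree_aut m) \<Longrightarrow> diag_pow m n f \<in> carrier (tree_aut m)"
  by (induction n) (auto simp: diag_closed)

lemma diag_id: "diag m id = id"
  by (auto simp: diag_def wreath_def split: list.splits)

section \<open>Levels and the topology\<close>

definition agree :: "nat \<Rightarrow> nat \<Rightarrow> (nat list \<Rightarrow> nat list) \<Rightarrow> (nat list \<Rightarrow> nat list) \<Rightarrow> bool" where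
  "agree m n f g \<longleftrightarrow> (\<forall>w\<in>words m. length w = n \<longrightarrow> f w = g w)"

lemma agree_sym: "agree m n f g \<Longrightarrow> agree m n g f"
  by (simp add: agree_def)

lemma agree_trans: "agree m n f g \<Longrightarrow> agree m n g h \<Longrightarrow> agree m n f h"
  by (simp add: agree_def)

lemma level_stab_agree: "f \<in> level_stab m n \<longleftrightarrow> f \<in> carrier (tree_aut m) \<and> agree m n f id"
  by (auto simp: level_stab_def agree_def)

lemma agree_comp:
  assumes "g \<in> carrier (tree_aut m)" "g' \<in> carrier (tree_aut m)" "agree m n f f'" "agree m n g g'"
  shows "agree m n (f \<circ> g) (f' \<circ> g')"
  using assms by (auto simp: agree_def tree_words tree_aut_length)

lemma agree_funpow:
  assumes "g \<in> carrier (tree_aut m)" "g' \<in> carrier (tree_aut m)" "agree m n g g'"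
  shows "agree m n (g ^^ k) (g' ^^ k)"
proof (induction k)
  case (Suc k)
  have c: "(h ^^ k) \<in> carrier (tree_aut m)" if "h \<in> carrier (tree_aut m)" for h
    using that by (induction k) (auto simp: tree_id intro: tree_comp)
  show ?case using agree_comp[OF c c assms(3) Suc] assms by (simp add: comp_def)
qed (simp add: agree_def)

lemma agree_inv:
  assumes "f \<in> carrier (tree_aut m)" "g \<in> carrier (tree_aut m)" "agree m n f g"
  shows "agree m n (finv f) (finv g)"
  unfolding agree_def
proof (intro ballI impI)
  fix w assume w: "w \<in> words m" "length w = n"
  note c = tree_inv_closed[OF assms(2)]
  have "f (finv g w) = g (finv g w)"
    using assms(3) w tree_words[OF c] tree_aut_length[OF c] by (auto simp: agree_def)
  then show "finv f w = finv g w" using tree_inv_apply assms(1,2) by metis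
qed

lemma agree_quotient:
  assumes f: "f \<in> carrier (tree_aut m)" and g: "g \<in> carrier (tree_aut m)"
  shows "agree m n f g \<longleftrightarrow> finv f \<circ> g \<in> level_stab m n"
proof -
  have "finv f \<circ> g \<in> carrier (tree_aut m)" by (intro tree_comp tree_inv_closed f g)
  moreover have "f w = g w \<longleftrightarrow> finv f (g w) = w" for w using tree_inv_apply[OF f] by metis
  ultimately show ?thesis by (auto simp: level_stab_def agree_def)
qed

lemma agree_mono:
  assumes "f \<in> carrier (tree_aut m)" "g \<in> carrier (tree_aut m)" "agree m n f g" "k \<le> n" "1 \<le> m"
  shows "agree m k f g"
  using assms level_stab_mono[of k n m] by (auto simp: agree_quotient)

lemma l_coset_level_stab:
  assumes a: "\<alpha> \<in> carrier (tree_aut m)"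
  shows "\<alpha> <#\<^bsub>tree_aut m\<^esub> level_stab m n = {\<beta> \<in> carrier (tree_aut m). agree m n \<alpha> \<beta>}"
proof (intro equalityI subsetI)
  fix \<beta> assume "\<beta> \<in> \<alpha> <#\<^bsub>tree_aut m\<^esub> level_stab m n"
  then obtain s where s: "s \<in> level_stab m n" "\<beta> = s \<circ> \<alpha>" by (auto simp: l_coset_def)
  then have "agree m n \<beta> \<alpha>"
    using agree_comp[OF a a, of n s id] by (auto simp: level_stab_agree agree_def)
  then show "\<beta> \<in> {\<beta> \<in> carrier (tree_aut m). agree m n \<alpha> \<beta>}"
    using s a by (auto simp: level_stab_agree agree_sym intro: tree_comp)
next
  fix \<beta> assume b: "\<beta> \<in> {\<beta> \<in> carrier (tree_aut m). agree m n \<alpha> \<beta>}"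
  let ?s = "\<beta> \<circ> finv \<alpha>"
  have i: "finv \<alpha> \<in> carrier (tree_aut m)" by (rule tree_inv_closed[OF a])
  have "agree m n ?s id"
    unfolding agree_def
  proof (intro ballI impI)
    fix w assume w: "w \<in> words m" "length w = n"
    have "finv \<alpha> w \<in> words m" "length (finv \<alpha> w) = n" using w tree_words[OF i] tree_aut_length[OF i] by auto
    then have "\<beta> (finv \<alpha> w) = \<alpha> (finv \<alpha> w)" using b by (auto simp: agree_def)
    then show "?s w = id w" using tree_inv_apply[OF a] by simp
  qed
  then have "?s \<in> level_stab m n" using b i by (auto simp: level_stab_agree intro: tree_comp)
  moreover have "\<beta> = ?s \<circ> \<alpha>" using tree_inv_apply[OF a] by auto
  ultimately show "\<beta> \<in> \<alpha> <#\<^bsub>tree_aut m\<^esub> level_stab m n" by (auto simp: l_coset_def)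
qed

lemma topspace_aut_topology: "topspace (aut_topology m) = carrier (tree_aut m)"
proof -
  have "openin (aut_topology m) (carrier (tree_aut m))"
    unfolding openin_aut_topology by (auto simp: l_coset_level_stab)
  then have "carrier (tree_aut m) \<subseteq> topspace (aut_topology m)" by (rule openin_subset)
  moreover have "topspace (aut_topology m) \<subseteq> carrier (tree_aut m)"
    using openin_topspace[of "aut_topology m"] unfolding openin_aut_topology by blast
  ultimately show ?thesis by blast
qed

text \<open>
  The cosets of the level stabilizers form a base of the topology, and lying in such a coset means
  acting in the same way on one level.
\<close>

lemma top_closure_iff:
  "\<alpha> \<in> top_closure m H \<longleftrightarrow> \<alpha> \<in> carrier (tree_aut m) \<and> (\<forall>n. \<exists>h\<in>H \<inter> carrier (tree_aut m). agree m n \<alpha> h)"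
  (is "?L \<longleftrightarrow> ?R")
proof
  assume L: ?L
  then have a: "\<alpha> \<in> carrier (tree_aut m)"
    and T: "\<And>T. \<alpha> \<in> T \<Longrightarrow> openin (aut_topology m) T \<Longrightarrow> \<exists>y\<in>H. y \<in> T"
    unfolding top_closure_def in_closure_of topspace_aut_topology by blast+
  have "\<exists>h\<in>H \<inter> carrier (tree_aut m). agree m n \<alpha> h" for n
  proof -
    let ?T = "{\<beta> \<in> carrier (tree_aut m). agree m n \<alpha> \<beta>}"
    have "\<beta> <#\<^bsub>tree_aut m\<^esub> level_stab m n \<subseteq> ?T" if "\<beta> \<in> ?T" for \<beta>
      using that by (auto simp: l_coset_level_stab intro: agree_trans)
    then have "openin (aut_topology m) ?T" unfolding openin_aut_topology by blast
    moreover have "\<alpha> \<in> ?T" using a by (simp add: agree_def)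
    ultimately have "\<exists>y\<in>H. y \<in> ?T" by (intro T)
    then show ?thesis by auto
  qed
  then show ?R using a by blast
next
  assume R: ?R
  show ?L unfolding top_closure_def in_closure_of topspace_aut_topology
  proof (intro conjI allI impI)
    fix T assume T: "\<alpha> \<in> T \<and> openin (aut_topology m) T"
    then have "\<forall>\<beta>\<in>T. \<exists>n. \<beta> <#\<^bsub>tree_aut m\<^esub> level_stab m n \<subseteq> T" unfolding openin_aut_topology by (elim conjE)
    then obtain n where n: "\<alpha> <#\<^bsub>tree_aut m\<^esub> level_stab m n \<subseteq> T" using T by meson
    obtain h where h: "h \<in> H \<inter> carrier (tree_aut m)" "agree m n \<alpha> h" using R by meson
    then have "h \<in> \<alpha> <#\<^bsub>tree_aut m\<^esub> level_stab m n" using R l_coset_level_stab[of \<alpha> m n] by simp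
    then show "\<exists>y. y \<in> H \<and> y \<in> T" using n h by (intro exI[of _ h] conjI) (simp, erule (1) subsetD)
  qed (use R in blast)
qed

lemma subgroup_top_closure:
  assumes "subgroup H (tree_aut m)"
  shows "subgroup (top_closure m H) (tree_aut m)"
proof -
  interpret H: subgroup H "tree_aut m" by fact
  note Hc = subsetD[OF H.subset]
  show ?thesis
  proof (rule group.subgroupI[OF group_tree_aut])
    show "top_closure m H \<subseteq> carrier (tree_aut m)" by (auto simp: top_closure_iff)
    have "id \<in> top_closure m H" using H.one_closed tree_id by (auto simp: top_closure_iff agree_def intro!: bexI[of _ id])
    then show "top_closure m H \<noteq> {}" by blast
  next
    fix f assume f: "f \<in> top_closure m H"
    have "\<exists>h\<in>H \<inter> carrier (tree_aut m). agree m n (finv f) h" for n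
    proof -
      obtain h where "h \<in> H" "agree m n f h" using f by (auto simp: top_closure_iff)
      then show ?thesis using f Hc[of h] H.m_inv_closed[of h] agree_inv[of f m h n] tree_inv_closed[of h m]
        by (auto simp: top_closure_iff tree_inv)
    qed
    then show "inv\<^bsub>tree_aut m\<^esub> f \<in> top_closure m H"
      using f by (simp add: top_closure_iff tree_inv tree_inv_closed)
  next
    fix f g assume f: "f \<in> top_closure m H" and g: "g \<in> top_closure m H"
    have "\<exists>h\<in>H \<inter> carrier (tree_aut m). agree m n (g \<circ> f) h" for n
    proof -
      obtain h k where hk: "h \<in> H" "agree m n f h" "k \<in> H" "agree m n g k"
        using f g by (meson Int_iff top_closure_iff)
      have "agree m n (g \<circ> f) (k \<circ> h)"
        using agree_comp[of f m h n g k] hk f Hc by (auto simp: top_closure_iff)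
      moreover have "k \<circ> h \<in> H" using H.m_closed[OF hk(1,3)] by simp
      ultimately show ?thesis using Hc by blast
    qed
    then show "f \<otimes>\<^bsub>tree_aut m\<^esub> g \<in> top_closure m H"
      using f g by (simp add: top_closure_iff tree_comp)
  qed
qed

section \<open>Conjugacy from a matching of group elements\<close>

text \<open>
  The conjugating automorphism \<open>g\<close> maps \<open>b (v n)\<close> to \<open>c (v n)\<close> for matched \<open>b\<close> and \<open>c\<close>.  This is well
  defined and injective since matched elements fix the same base vertices, it preserves the parent
  relation since the base vertices \<open>v n\<close> form a ray, and it satisfies \<open>g \<circ> b = c \<circ> g\<close> since matching is
  compatible with products.  Density then carries the conjugation over to the closures.
\<close>

lemma conjugate_top_closure_if_matching:
  fixes B C :: "(nat list \<Rightarrow> nat list) set" and v :: "nat \<Rightarrow> nat list"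
  assumes P: "subgroup P (tree_aut m \<times>\<times> tree_aut m)"
    and base: "\<And>n. v n \<in> words m" "\<And>n. length (v n) = n" "\<And>n. \<exists>y. v (Suc n) = v n @ [y]"
    and PBC: "P \<subseteq> B \<times> C"
    and stab: "\<And>b c n. (b, c) \<in> P \<Longrightarrow> b (v n) = v n \<longleftrightarrow> c (v n) = v n"
    and trans: "\<And>w. w \<in> words m \<Longrightarrow> \<exists>(b, c)\<in>P. b (v (length w)) = w"
    and denseB: "\<And>f n. f \<in> B \<Longrightarrow> \<exists>(b, c)\<in>P. agree m n f b"
    and denseC: "\<And>f n. f \<in> C \<Longrightarrow> \<exists>(b, c)\<in>P. agree m n f c"
  shows "conjugate_in (tree_aut m) (top_closure m B) (top_closure m C)"
proof -
  interpret P: subgroup P "tree_aut m \<times>\<times> tree_aut m" by fact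
  have Pc: "b \<in> carrier (tree_aut m)" "c \<in> carrier (tree_aut m)" if "(b, c) \<in> P" for b c
    using that P.subset by auto
  have Pcomp: "(b' \<circ> b, c' \<circ> c) \<in> P" if "(b, c) \<in> P" "(b', c') \<in> P" for b c b' c'
    using P.m_closed[OF that] by simp
  have Pinv: "(finv b, finv c) \<in> P" if "(b, c) \<in> P" for b c
    using P.m_inv_closed[OF that] Pc[OF that]
    by (simp add: inv_DirProd[OF group_tree_aut group_tree_aut] tree_inv)
  have eq: "b (v n) = b' (v n) \<longleftrightarrow> c (v n) = c' (v n)" if "(b, c) \<in> P" "(b', c') \<in> P" for b c b' c' n
  proof -
    have "(finv b \<circ> b', finv c \<circ> c') \<in> P" by (rule Pcomp[OF that(2) Pinv[OF that(1)]])
    from stab[OF this, of n] show ?thesis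
      using tree_inv_apply[OF Pc(1)[OF that(1)]] tree_inv_apply[OF Pc(2)[OF that(1)]]
      by (metis comp_apply)
  qed
  \<comment> \<open>Any matched pair reaching \<open>w\<close> from the base vertex may be chosen.\<close>
  define g where "g w = (if w \<in> words m then snd (SOME q. q \<in> P \<and> fst q (v (length w)) = w) (v (length w)) else w)" for w
  have g: "g (b (v n)) = c (v n)" if bc: "(b, c) \<in> P" for b c n
  proof -
    let ?w = "b (v n)"
    have w: "?w \<in> words m" "length ?w = n"
      using tree_words[OF Pc(1)[OF bc]] tree_aut_length[OF Pc(1)[OF bc]] base by auto
    let ?q = "SOME q. q \<in> P \<and> fst q (v n) = ?w"
    have "?q \<in> P \<and> fst ?q (v n) = ?w" by (rule someI[of _ "(b, c)"]) (use bc in simp)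
    then have "snd ?q (v n) = c (v n)" using eq[of "fst ?q" "snd ?q" b c n] bc by simp
    then show ?thesis using w by (simp add: g_def)
  qed
  have rep: "\<exists>b c. (b, c) \<in> P \<and> w = b (v (length w)) \<and> g w = c (v (length w))" if wm: "w \<in> words m" for w
  proof -
    obtain b c where bc: "(b, c) \<in> P" "b (v (length w)) = w" using trans[OF wm] by blast
    have "g (b (v (length w))) = c (v (length w))" by (rule g[OF bc(1)])
    then show ?thesis using bc by (intro exI[of _ b] exI[of _ c]) simp
  qed
  have vlen: "c (v n) \<in> words m" "length (c (v n)) = n" if "c \<in> carrier (tree_aut m)" for c n
    using tree_words[OF that] tree_aut_length[OF that] base by auto
  have gc: "g \<in> carrier (tree_aut m)"
  proof (rule tree_aut_I)
    fix w assume w: "w \<in> words m"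
    then obtain b c where bc: "(b, c) \<in> P" "w = b (v (length w))" "g w = c (v (length w))" using rep by blast
    then show "g w \<in> words m" "length (g w) = length w" using vlen[OF Pc(2)[OF bc(1)]] by simp_all
  next
    fix w w' assume w: "w \<in> words m" "w' \<in> words m" "g w = g w'"
    obtain b c where bc: "(b, c) \<in> P" "w = b (v (length w))" "g w = c (v (length w))" using rep w(1) by blast
    obtain b' c' where bc': "(b', c') \<in> P" "w' = b' (v (length w'))" "g w' = c' (v (length w'))" using rep w(2) by blast
    have "length w = length w'" using w(3) bc(3) bc'(3) vlen(2) Pc(2) bc(1) bc'(1) by metis
    then show "w = w'" using eq[OF bc(1) bc'(1)] bc bc' w(3) by metis
  next
    fix u y assume u: "u @ [y] \<in> words m"
    obtain b c where bc: "(b, c) \<in> P" "u @ [y] = b (v (Suc (length u)))" "g (u @ [y]) = c (v (Suc (length u)))"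
      using rep[OF u] by auto
    obtain x where x: "v (Suc (length u)) = v (length u) @ [x]" using base(3) by blast
    then have xw: "v (length u) @ [x] \<in> words m" using base(1) by metis
    obtain z where z: "c (v (Suc (length u))) = c (v (length u)) @ [z]"
      using tree_aut_append[OF Pc(2)[OF bc(1)] xw] x by auto
    obtain z' where "b (v (Suc (length u))) = b (v (length u)) @ [z']"
      using tree_aut_append[OF Pc(1)[OF bc(1)] xw] x by auto
    then have "u = b (v (length u))" using bc(2) by simp
    then have "g u = c (v (length u))" using g[OF bc(1), of "length u"] by simp
    then show "\<exists>z. g (u @ [y]) = g u @ [z]" using bc(3) z by simp
  qed (simp add: g_def)
  have twine: "g \<circ> b = c \<circ> g" if bc: "(b, c) \<in> P" for b c
  proof (rule tree_eqI)
    show "g \<circ> b \<in> carrier (tree_aut m)" "c \<circ> g \<in> carrier (tree_aut m)"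
      using gc Pc[OF bc] by (auto intro: tree_comp)
    fix w assume "w \<in> words m"
    then obtain b' c' where bc': "(b', c') \<in> P" "w = b' (v (length w))" "g w = c' (v (length w))" using rep by blast
    have "g ((b \<circ> b') (v (length w))) = (c \<circ> c') (v (length w))" by (rule g[OF Pcomp[OF bc'(1) bc]])
    then show "(g \<circ> b) w = (c \<circ> g) w" using bc' by simp
  qed
  note gi = tree_inv_closed[OF gc]
  have conj: "g \<circ> b \<circ> finv g = c" if "(b, c) \<in> P" for b c
    using twine[OF that] tree_inv_apply[OF gc] by (auto simp: fun_eq_iff)
  have conj': "finv g \<circ> c \<circ> g = b" if "(b, c) \<in> P" for b c
    using twine[OF that, symmetric] tree_inv_apply[OF gc] by (auto simp: fun_eq_iff)
  have fwd: "g \<circ> f \<circ> finv g \<in> top_closure m C" if f: "f \<in> top_closure m B" for f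
    unfolding top_closure_iff
  proof (intro conjI allI)
    have fc: "f \<in> carrier (tree_aut m)" using f by (simp add: top_closure_iff)
    then show "g \<circ> f \<circ> finv g \<in> carrier (tree_aut m)" by (intro tree_comp gc gi)
    fix n
    obtain h where h: "h \<in> B" "agree m n f h" using f by (auto simp: top_closure_iff)
    obtain b c where bc: "(b, c) \<in> P" "agree m n h b" using denseB[OF h(1), of n] by auto
    have "agree m n f b" using h bc by (blast intro: agree_trans)
    then have "agree m n (g \<circ> f \<circ> finv g) (g \<circ> b \<circ> finv g)"
      using fc Pc[OF bc(1)] gc gi by (intro agree_comp) (auto simp: agree_def)
    then show "\<exists>h\<in>C \<inter> carrier (tree_aut m). agree m n (g \<circ> f \<circ> finv g) h"
      using conj[OF bc(1)] bc(1) PBC Pc by auto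
  qed
  have bwd: "finv g \<circ> f \<circ> g \<in> top_closure m B" if f: "f \<in> top_closure m C" for f
    unfolding top_closure_iff
  proof (intro conjI allI)
    have fc: "f \<in> carrier (tree_aut m)" using f by (simp add: top_closure_iff)
    then show "finv g \<circ> f \<circ> g \<in> carrier (tree_aut m)" by (intro tree_comp gc gi)
    fix n
    obtain h where h: "h \<in> C" "agree m n f h" using f by (auto simp: top_closure_iff)
    obtain b c where bc: "(b, c) \<in> P" "agree m n h c" using denseC[OF h(1), of n] by auto
    have "agree m n f c" using h bc by (blast intro: agree_trans)
    then have "agree m n (finv g \<circ> f \<circ> g) (finv g \<circ> c \<circ> g)"
      using fc Pc[OF bc(1)] gc gi by (intro agree_comp) (auto simp: agree_def)
    then show "\<exists>h\<in>B \<inter> carrier (tree_aut m). agree m n (finv g \<circ> f \<circ> g) h"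
      using conj'[OF bc(1)] bc(1) PBC Pc by auto
  qed
  have "top_closure m C = (\<lambda>h. inv\<^bsub>tree_aut m\<^esub> g \<otimes>\<^bsub>tree_aut m\<^esub> h \<otimes>\<^bsub>tree_aut m\<^esub> g) ` top_closure m B"
  proof (intro equalityI subsetI)
    fix f assume f: "f \<in> top_closure m C"
    have "f = g \<circ> (finv g \<circ> f \<circ> g) \<circ> finv g" using tree_inv_apply[OF gc] by (auto simp: fun_eq_iff)
    then show "f \<in> (\<lambda>h. inv\<^bsub>tree_aut m\<^esub> g \<otimes>\<^bsub>tree_aut m\<^esub> h \<otimes>\<^bsub>tree_aut m\<^esub> g) ` top_closure m B"
      using bwd[OF f] by (intro image_eqI[of _ _ "finv g \<circ> f \<circ> g"]) (auto simp: tree_inv[OF gc] comp_assoc)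
  next
    fix f assume "f \<in> (\<lambda>h. inv\<^bsub>tree_aut m\<^esub> g \<otimes>\<^bsub>tree_aut m\<^esub> h \<otimes>\<^bsub>tree_aut m\<^esub> g) ` top_closure m B"
    then show "f \<in> top_closure m C" using fwd by (auto simp: tree_inv[OF gc] comp_assoc)
  qed
  then show ?thesis using gc unfolding conjugate_in_def by blast
qed

section \<open>Abelian transitive state-closed groups closed under the diagonal map\<close>

text \<open>
  The diagonal closure of an abelian transitive state-closed group has these properties.  They
  imply that its quotient by the stabilizer of a level acts regularly on that level.
\<close>

locale regular_tree_group =
  fixes m :: nat and B :: "(nat list \<Rightarrow> nat list) set"
  assumes prime_m: "prime m"
    and subgroup_B: "subgroup B (tree_aut m)"
    and B_comm: "\<And>f g. f \<in> B \<Longrightarrow> g \<in> B \<Longrightarrow> f \<circ> g = g \<circ> f"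
    and B_section: "\<And>f y. f \<in> B \<Longrightarrow> y \<in> {1..m} \<Longrightarrow> section1 m f y \<in> B"
    and B_diag: "\<And>f. f \<in> B \<Longrightarrow> diag m f \<in> B"
    and B_trans: "\<And>y z. y \<in> {1..m} \<Longrightarrow> z \<in> {1..m} \<Longrightarrow> \<exists>f\<in>B. root_perm m f y = z"
begin

lemma m_ge_1: "1 \<le> m"
  using prime_gt_1_nat[OF prime_m] by simp

lemma B_closed: "f \<in> B \<Longrightarrow> f \<in> carrier (tree_aut m)"
  using subgroup.subset[OF subgroup_B] by blast

lemma B_comp: "f \<in> B \<Longrightarrow> g \<in> B \<Longrightarrow> f \<circ> g \<in> B"
  using subgroup.m_closed[OF subgroup_B, of g f] by simp

lemma B_inv: "f \<in> B \<Longrightarrow> finv f \<in> B"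
  using subgroup.m_inv_closed[OF subgroup_B, of f] by (simp add: tree_inv B_closed)

lemma B_id: "id \<in> B"
  using subgroup.one_closed[OF subgroup_B] by simp

lemma level_transitive:
  assumes "u \<in> words m" "v \<in> words m" "length u = length v"
  shows "\<exists>f\<in>B. f u = v"
  using assms
proof (induction v arbitrary: u)
  case Nil
  then show ?case using B_id by (intro bexI[of _ id]) auto
next
  case (Cons z v)
  then obtain y t where u: "u = y # t" by (cases u) auto
  obtain f where f: "f \<in> B" "root_perm m f y = z" using B_trans[of y z] Cons.prems u by auto
  have fu: "f u = z # section1 m f y t" using tree_aut_cons[OF B_closed[OF f(1)], of y t] Cons.prems(1) u f(2) by simp
  have s: "section1 m f y \<in> carrier (tree_aut m)"
    using section1_closed[OF B_closed[OF f(1)]] Cons.prems(1) u by simp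
  have t: "section1 m f y t \<in> words m" "length (section1 m f y t) = length v"
    using tree_words[OF s] tree_aut_length[OF s, of t] Cons.prems u by simp_all
  then obtain g where g: "g \<in> B" "g (section1 m f y t) = v" using Cons.IH Cons.prems by auto
  have "(diag m g \<circ> f) u = z # v"
    using fu g(2) t(1) Cons.prems by (simp add: diag_cons)
  then show ?case using B_comp[OF B_diag[OF g(1)] f(1)] by blast
qed

text \<open>
  In a transitive abelian group point stabilizers are trivial, here applied to the action on a level.
\<close>

lemma fixes_level:
  assumes f: "f \<in> B" and w: "w \<in> words m" "f w = w"
  shows "f \<in> level_stab m (length w)"
proof -
  have "f v = v" if v: "v \<in> words m" "length v = length w" for v
  proof -
    obtain h where h: "h \<in> B" "h w = v" using level_transitive[OF w(1) v(1)] v(2) by auto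
    then show ?thesis using B_comm[OF f h(1)] w(2) by (metis comp_apply)
  qed
  then show ?thesis using B_closed[OF f] by (simp add: level_stab_def)
qed

text \<open>
  Let \<open>h\<close> take the letter 1 to \<open>y\<close>.  The sections at 1 of \<open>h \<circ> f\<close> and \<open>f \<circ> h\<close> agree, and since all sections lie in the
  abelian group, the section of \<open>h\<close> cancels.
\<close>

lemma level_one_diag:
  assumes f: "f \<in> B" and stab: "f \<in> level_stab m 1"
  shows "f = diag m (section1 m f 1)"
proof (rule tree_eq_sectionsI)
  have m1: "1 \<in> {1..m}" using m_ge_1 by simp
  note fc = B_closed[OF f] and s1 = section1_closed[OF B_closed[OF f] m1]
  show "f \<in> carrier (tree_aut m)" "diag m (section1 m f 1) \<in> carrier (tree_aut m)"
    by (intro fc diag_closed s1)+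
  fix y assume y: "y \<in> {1..m}"
  have root: "root_perm m f x = x" if "x \<in> {1..m}" for x
    using stab tree_apply_singleton[OF fc that] that by (simp add: level_stab_def)
  then show "root_perm m f y = root_perm m (diag m (section1 m f 1)) y" using y by (simp add: root_perm_diag)
  obtain h where h: "h \<in> B" "root_perm m h 1 = y" using B_trans[OF m1 y] by blast
  note hc = B_closed[OF h(1)]
  have "section1 m (h \<circ> f) 1 = section1 m (f \<circ> h) 1" using B_comm[OF h(1) f] by simp
  then have "section1 m h 1 \<circ> section1 m f 1 = section1 m f y \<circ> section1 m h 1"
    using section1_comp[OF hc fc m1] section1_comp[OF fc hc m1] root[OF m1] h(2) by simp
  also have "\<dots> = section1 m h 1 \<circ> section1 m f y"
    by (intro B_comm B_section f h y m1)
  finally have "section1 m f 1 = section1 m f y"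
    using tree_inv_apply(1)[OF section1_closed[OF hc m1]] by (metis comp_apply ext)
  then show "section1 m f y = section1 m (diag m (section1 m f 1)) y"
    using section1_diag[OF s1 y] by simp
qed

lemma level_stab_eq_diag: "B \<inter> level_stab m n = diag_pow m n ` B"
proof (induction n)
  case 0
  have "level_stab m 0 = carrier (tree_aut m)" using tree_aut_nil by (auto simp: level_stab_def)
  then show ?case using B_closed by auto
next
  case (Suc n)
  have m1: "1 \<in> {1..m}" using m_ge_1 by simp
  show ?case
  proof (intro equalityI subsetI)
    fix f assume f: "f \<in> B \<inter> level_stab m (Suc n)"
    let ?g = "section1 m f 1"
    have fd: "f = diag m ?g"
      using f level_stab_mono[of 1 "Suc n" m] m_ge_1 by (intro level_one_diag) auto
    have gB: "?g \<in> B" using f B_section m1 by blast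
    have "?g w = w" if w: "w \<in> words m" "length w = n" for w
    proof -
      have "f (1 # w) = 1 # w" using f w m1 by (simp add: level_stab_def)
      then show ?thesis using w m1 by (subst (asm) fd) (simp add: diag_cons)
    qed
    then have "?g \<in> B \<inter> level_stab m n" using gB B_closed by (simp add: level_stab_def)
    then obtain h where "h \<in> B" "?g = diag_pow m n h" using Suc by blast
    then show "f \<in> diag_pow m (Suc n) ` B" using fd by auto
  next
    fix f assume "f \<in> diag_pow m (Suc n) ` B"
    then obtain h where h: "h \<in> B" "f = diag m (diag_pow m n h)" by auto
    then have g: "diag_pow m n h \<in> B \<inter> level_stab m n" using Suc by blast
    have "f w = w" if w: "w \<in> words m" "length w = Suc n" for w
      using w g h by (cases w) (auto simp: diag_cons level_stab_def)
    moreover have "f \<in> B" using g h(2) by (auto intro: B_diag)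
    ultimately show "f \<in> B \<inter> level_stab m (Suc n)" using B_closed by (simp add: level_stab_def)
  qed
qed

lemma comm_group_B: "comm_group (sub_aut m B)"
proof (rule group.group_comm_groupI)
  show "group (sub_aut m B)" by (rule group.subgroup_imp_group[OF group_tree_aut subgroup_B])
qed (auto intro: B_comm)

text \<open>
  The cosets correspond to the letters through the image of the letter 1.
\<close>

lemma card_rcosets_diag: "card (rcosets\<^bsub>sub_aut m B\<^esub> (diag m ` B)) = m"
proof -
  have m1: "1 \<in> {1..m}" using m_ge_1 by simp
  let ?K = "\<lambda>y. {g \<in> B. root_perm m g 1 = y}"
  have coset: "diag m ` B #>\<^bsub>sub_aut m B\<^esub> f = ?K (root_perm m f 1)" if f: "f \<in> B" for f
  proof (intro equalityI subsetI)
    fix g assume "g \<in> diag m ` B #>\<^bsub>sub_aut m B\<^esub> f"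
    then obtain h where h: "h \<in> B" "g = f \<circ> diag m h" by (auto simp: r_coset_def)
    then show "g \<in> ?K (root_perm m f 1)"
      using f m1 by (simp add: B_comp B_diag root_perm_comp B_closed root_perm_diag diag_closed)
  next
    fix g assume g: "g \<in> ?K (root_perm m f 1)"
    let ?h = "finv f \<circ> g"
    have hB: "?h \<in> B" using g f by (auto intro: B_comp B_inv)
    have "g [1] = f [1]"
      using g tree_apply_singleton[OF B_closed[OF f] m1] tree_apply_singleton[OF B_closed m1, of g] by simp
    then have "?h [1] = [1]" using tree_inv_apply(1)[OF B_closed[OF f]] by simp
    then have "?h \<in> level_stab m 1" using fixes_level[OF hB, of "[1]"] m1 by simp
    then have "?h \<in> diag m ` B" using level_stab_eq_diag[of 1] hB by auto
    moreover have "g = f \<circ> ?h" using tree_inv_apply(2)[OF B_closed[OF f]] by auto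
    ultimately show "g \<in> diag m ` B #>\<^bsub>sub_aut m B\<^esub> f" by (auto simp: r_coset_def)
  qed
  have "rcosets\<^bsub>sub_aut m B\<^esub> (diag m ` B) = ?K ` {1..m}"
  proof (intro equalityI subsetI)
    fix X assume "X \<in> rcosets\<^bsub>sub_aut m B\<^esub> (diag m ` B)"
    then obtain f where f: "f \<in> B" "X = ?K (root_perm m f 1)" using coset by (auto simp: RCOSETS_def)
    then show "X \<in> ?K ` {1..m}" using root_perm_in[OF B_closed[OF f(1)] m1] by blast
  next
    fix X assume "X \<in> ?K ` {1..m}"
    then obtain y where y: "y \<in> {1..m}" "X = ?K y" by blast
    obtain f where f: "f \<in> B" "root_perm m f 1 = y" using B_trans[OF m1 y(1)] by blast
    then have "X = diag m ` B #>\<^bsub>sub_aut m B\<^esub> f" using coset y by simp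
    then show "X \<in> rcosets\<^bsub>sub_aut m B\<^esub> (diag m ` B)" using f(1) by (auto simp: RCOSETS_def)
  qed
  moreover have "inj_on ?K {1..m}"
  proof (rule inj_onI)
    fix y z assume y: "y \<in> {1..m}" and z: "z \<in> {1..m}" and eq: "?K y = ?K z"
    obtain f where "f \<in> B" "root_perm m f 1 = y" using B_trans[OF m1 y] by blast
    then have "f \<in> ?K y" by simp
    then show "y = z" using eq \<open>root_perm m f 1 = y\<close> by auto
  qed
  ultimately show ?thesis by (simp add: card_image)
qed

sublocale S: shift_group "sub_aut m B" "diag m" m
proof (intro shift_group.intro shift_group_axioms.intro)
  show "comm_group (sub_aut m B)" by (rule comm_group_B)
  show "diag m \<in> hom (sub_aut m B) (sub_aut m B)"
    by (auto simp: hom_def B_diag diag_comp B_closed)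
  show "inj_on (diag m) (carrier (sub_aut m B))"
    using diag_inj m_ge_1 B_closed by (auto simp: inj_on_def)
  show "prime m" by (rule prime_m)
  show "card (rcosets\<^bsub>sub_aut m B\<^esub> (diag m ` carrier (sub_aut m B))) = m"
    using card_rcosets_diag by simp
  have "f = id" if f: "\<And>n. f \<in> diag_pow m n ` B" for f
  proof (rule tree_eqI)
    have fB: "f \<in> B" using f[of 0] by simp
    then show "f \<in> carrier (tree_aut m)" by (rule B_closed)
    show "id \<in> carrier (tree_aut m)" by (rule tree_id)
    fix w assume "w \<in> words m"
    then show "f w = id w" using f[of "length w"] unfolding level_stab_eq_diag[symmetric] by (auto simp: level_stab_def)
  qed
  moreover have "id \<in> diag_pow m n ` B" for n
    unfolding level_stab_eq_diag[symmetric] using B_id tree_id by (auto simp: level_stab_def)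
  ultimately show "(\<Inter>n. (diag m ^^ n) ` carrier (sub_aut m B)) = {\<one>\<^bsub>sub_aut m B\<^esub>}"
    by auto
qed

lemma fil_eq: "S.fil n = B \<inter> level_stab m n"
  by (simp add: S.fil_def level_stab_eq_diag)

lemma lev_0_iff: "f \<in> S.lev 0 \<longleftrightarrow> f \<in> B \<and> f [1] \<noteq> [1]"
proof -
  have "f \<in> level_stab m 1 \<longleftrightarrow> f [1] = [1]" if "f \<in> B"
    using fixes_level[OF that, of "[1]"] m_ge_1 by (auto simp: level_stab_def)
  moreover have "f \<in> level_stab m 0" if "f \<in> B"
    using B_closed[OF that] tree_aut_nil by (auto simp: level_stab_def)
  ultimately show ?thesis by (auto simp: S.lev_def fil_eq)
qed

end

section \<open>Closures: conjugacy and torsion\<close>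

lemma sub_aut_DirProd:
  "sub_aut m B \<times>\<times> sub_aut m C = (tree_aut m \<times>\<times> tree_aut m)\<lparr>carrier := B \<times> C\<rparr>"
  by (simp add: DirProd_def)

text \<open>
  The base ray consists of the words \<open>1\<^sup>n\<close>.  Fixing \<open>1\<^sup>n\<close> is membership in the filtration step \<open>n\<close>, so
  the correspondence of \<open>shift_group_pair\<close> is a matching.
\<close>

theorem conjugate_top_closure_of_pair:
  assumes B: "regular_tree_group m B" and C: "regular_tree_group m C"
    and pair: "shift_group_pair (sub_aut m B) (diag m) (sub_aut m C) (diag m) m b c"
  shows "conjugate_in (tree_aut m) (top_closure m B) (top_closure m C)"
proof -
  interpret B: regular_tree_group m B by fact
  interpret C: regular_tree_group m C by fact
  interpret P: shift_group_pair "sub_aut m B" "diag m" "sub_aut m C" "diag m" m b c by fact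
  let ?v = "\<lambda>n. replicate n (1::nat)"
  have v: "?v n \<in> words m" for n using B.m_ge_1 by (auto simp: words_def)
  have RBC: "P.R 0 \<subseteq> B \<times> C" using P.R_subset[of 0] by (simp add: B.S.fil_0 C.S.fil_0)
  show ?thesis
  proof (rule conjugate_top_closure_if_matching[where P = "P.R 0" and v = ?v])
    have "subgroup (B \<times> C) (tree_aut m \<times>\<times> tree_aut m)"
      by (intro DirProd_subgroups B.subgroup_B C.subgroup_B group_tree_aut)
    moreover have "subgroup (P.R 0) ((tree_aut m \<times>\<times> tree_aut m)\<lparr>carrier := B \<times> C\<rparr>)"
      using P.subgroup_R[of 0] by (simp only: sub_aut_DirProd)
    ultimately show "subgroup (P.R 0) (tree_aut m \<times>\<times> tree_aut m)"
      using group.incl_subgroup[OF DirProd_group[OF group_tree_aut group_tree_aut]] by metis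
    show "P.R 0 \<subseteq> B \<times> C" by (rule RBC)
    show "?v n \<in> words m" for n by (rule v)
    show "length (?v n) = n" for n by simp
    show "\<exists>y. ?v (Suc n) = ?v n @ [y]" for n by (intro exI[of _ 1]) (simp add: replicate_append_same)
    show "f (?v n) = ?v n \<longleftrightarrow> g (?v n) = ?v n" if fg: "(f, g) \<in> P.R 0" for f g n
    proof -
      have f: "f \<in> B" and g: "g \<in> C" using RBC fg by auto
      have "f (?v n) = ?v n \<longleftrightarrow> f \<in> B.S.fil n"
        using f B.fixes_level[OF f v, of n] v by (auto simp: B.fil_eq level_stab_def)
      moreover have "g (?v n) = ?v n \<longleftrightarrow> g \<in> C.S.fil n"
        using g C.fixes_level[OF g v, of n] v by (auto simp: C.fil_eq level_stab_def)
      ultimately show ?thesis using P.R_fil_iff[OF fg] by simp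
    qed
    show denseB: "\<exists>(f', g)\<in>P.R 0. agree m n f f'" if f: "f \<in> B" for f n
    proof -
      obtain y z w where yz: "(y, w) \<in> P.R 0" "z \<in> B.S.fil n" "f = z \<circ> y"
        using P.R_dense_left[of f n] f by auto
      have y: "y \<in> carrier (tree_aut m)" using RBC yz(1) B.B_closed by blast
      have "agree m n (z \<circ> y) (id \<circ> y)"
        using yz(2) y by (intro agree_comp) (auto simp: B.fil_eq level_stab_agree agree_def)
      then show ?thesis using yz by auto
    qed
    show "\<exists>(f', g')\<in>P.R 0. agree m n g g'" if g: "g \<in> C" for g n
    proof -
      obtain y z w where yz: "(w, y) \<in> P.R 0" "z \<in> C.S.fil n" "g = z \<circ> y"
        using P.R_dense_right[of g n] g by auto
      have y: "y \<in> carrier (tree_aut m)" using RBC yz(1) C.B_closed by blast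
      have "agree m n (z \<circ> y) (id \<circ> y)"
        using yz(2) y by (intro agree_comp) (auto simp: C.fil_eq level_stab_agree agree_def)
      then show ?thesis using yz by auto
    qed
    show "\<exists>(f, g)\<in>P.R 0. f (?v (length w)) = w" if w: "w \<in> words m" for w
    proof -
      obtain f where f: "f \<in> B" "f (?v (length w)) = w" using B.level_transitive[OF v w] by auto
      then obtain f' g where fg: "(f', g) \<in> P.R 0" "agree m (length w) f f'" using denseB[of f "length w"] by auto
      then have "f' (?v (length w)) = w" using f(2) v[of "length w"] by (simp add: agree_def)
      then show ?thesis using fg(1) by blast
    qed
  qed
qed

context regular_tree_group
begin

lemma top_closure_group: "group (sub_aut m (top_closure m B))"
  by (intro group.subgroup_imp_group[OF group_tree_aut] subgroup_top_closure subgroup_B)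

lemma torsion_group_top_closure:
  assumes "\<And>f. f \<in> B \<Longrightarrow> f ^^ m = id"
  shows "torsion_group (sub_aut m (top_closure m B))"
proof -
  have "f ^^ m = id" if f: "f \<in> top_closure m B" for f
  proof
    fix w
    have fc: "f \<in> carrier (tree_aut m)" using f by (simp add: top_closure_iff)
    show "(f ^^ m) w = id w"
    proof (cases "w \<in> words m")
      case True
      obtain h where h: "h \<in> B" "agree m (length w) f h" using f by (auto simp: top_closure_iff)
      have "agree m (length w) (f ^^ m) (h ^^ m)" by (rule agree_funpow[OF fc B_closed[OF h(1)] h(2)])
      then show ?thesis using True assms[OF h(1)] by (simp add: agree_def)
    next
      case False
      then have "f w = w" by (rule tree_outside[OF fc])
      then have "(f ^^ k) w = w" for k by (induction k) auto
      then show ?thesis by simp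
    qed
  qed
  then show ?thesis using top_closure_group m_ge_1
    by (auto simp: torsion_group_def torsion_def intro!: exI[of _ m])
qed

text \<open>
  If \<open>f\<close> in the closure moves level \<open>k\<close>, so does an element \<open>h\<close> of the group that agrees with \<open>f\<close> on a
  sufficiently deep level; by \<open>power_bound\<close> the power of \<open>h\<close> is nontrivial on a level known in advance,
  where it agrees with the power of \<open>f\<close>.
\<close>

lemma torsion_free_group_top_closure:
  assumes x: "x \<in> S.lev 0" and xm: "x ^^ m \<noteq> id"
  shows "torsion_free_group (sub_aut m (top_closure m B))"
proof -
  have "f = id" if f: "f \<in> top_closure m B" and d: "0 < d" "f ^^ d = id" for f and d :: nat
  proof (rule ccontr)
    assume ne: "f \<noteq> id"
    have fc: "f \<in> carrier (tree_aut m)" using f by (simp add: top_closure_iff)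
    then obtain w where w: "w \<in> words m" "f w \<noteq> w" using tree_eqI[OF fc tree_id] ne by auto
    let ?k = "length w"
    have "x [^]\<^bsub>sub_aut m B\<^esub> m \<noteq> \<one>\<^bsub>sub_aut m B\<^esub>" using xm by simp
    then obtain N where N: "\<And>y. y \<in> B \<Longrightarrow> y \<notin> S.fil ?k \<Longrightarrow> y ^^ d \<notin> S.fil N"
      using S.power_bound[OF x _ d(1), of ?k] by auto
    obtain h where h: "h \<in> B" "agree m (max ?k N) f h" using f by (auto simp: top_closure_iff)
    note hc = B_closed[OF h(1)]
    have "agree m ?k f h" by (rule agree_mono[OF fc hc h(2) _ m_ge_1]) simp
    then have "h w \<noteq> w" using w by (simp add: agree_def)
    then have "h \<notin> S.fil ?k" using w by (auto simp: fil_eq level_stab_def)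
    then have nN: "h ^^ d \<notin> S.fil N" by (rule N[OF h(1)])
    have "agree m N f h" by (rule agree_mono[OF fc hc h(2) _ m_ge_1]) simp
    then have "agree m N (f ^^ d) (h ^^ d)" by (rule agree_funpow[OF fc hc])
    moreover have "h ^^ d \<in> B" using h(1) by (induction d) (auto simp: B_id intro: B_comp)
    ultimately have "h ^^ d \<in> S.fil N"
      using d(2) B_closed by (auto simp: fil_eq level_stab_agree agree_def)
    then show False using nN by simp
  qed
  moreover have "id \<in> top_closure m B"
    using subgroup.one_closed[OF subgroup_top_closure[OF subgroup_B]] by simp
  ultimately show ?thesis using top_closure_group
    by (auto simp: torsion_free_group_def torsion_def intro!: exI[of _ 1])
qed

end

section \<open>Constructing regular tree groups from generators\<close>

lemma finv_commute:
  assumes "f \<in> carrier (tree_aut m)" and "f \<circ> g = g \<circ> f"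
  shows "finv f \<circ> g = g \<circ> finv f"
proof
  fix w
  have "f (g (finv f w)) = g w" using assms(2) tree_inv_apply(2)[OF assms(1), of w] by (metis comp_apply)
  then have "finv f (g w) = g (finv f w)" using tree_inv_apply(1)[OF assms(1)] by metis
  then show "(finv f \<circ> g) w = (g \<circ> finv f) w" by simp
qed

lemma generate_commute:
  assumes X: "X \<subseteq> carrier (tree_aut m)" and comm: "\<And>f g. f \<in> X \<Longrightarrow> g \<in> X \<Longrightarrow> f \<circ> g = g \<circ> f"
    and f: "f \<in> generate (tree_aut m) X" and g: "g \<in> generate (tree_aut m) X"
  shows "f \<circ> g = g \<circ> f"
proof -
  have one: "f \<circ> g = g \<circ> f" if "f \<in> generate (tree_aut m) X" "\<And>x. x \<in> X \<Longrightarrow> x \<circ> g = g \<circ> x" for f g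
    using that(1)
  proof (induction rule: generate.induct)
    case (inv h)
    then have "h \<in> carrier (tree_aut m)" using X by blast
    then show ?case using finv_commute[of h m g] that(2)[OF inv] by (simp add: tree_inv)
  next
    case (eng h1 h2)
    then show ?case by (metis comp_assoc tree_mult)
  qed (use that(2) in auto)
  have "x \<circ> g = g \<circ> x" if "x \<in> X" for x
    using one[OF g, of x] comm that by metis
  then show ?thesis by (rule one[OF f])
qed

text \<open>
  All conditions pass from the generators to products and inverses.  Transitivity follows from reaching
  every letter from the letter 1.
\<close>

lemma regular_tree_group_generate:
  assumes m: "prime m" and X: "X \<subseteq> carrier (tree_aut m)"
    and comm: "\<And>f g. f \<in> X \<Longrightarrow> g \<in> X \<Longrightarrow> f \<circ> g = g \<circ> f"
    and sec: "\<And>f y. f \<in> X \<Longrightarrow> y \<in> {1..m} \<Longrightarrow> section1 m f y \<in> generate (tree_aut m) X"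
    and dia: "\<And>f. f \<in> X \<Longrightarrow> diag m f \<in> generate (tree_aut m) X"
    and trans: "\<And>y. y \<in> {1..m} \<Longrightarrow> \<exists>f\<in>generate (tree_aut m) X. root_perm m f 1 = y"
  shows "regular_tree_group m (generate (tree_aut m) X)"
proof -
  let ?B = "generate (tree_aut m) X"
  have sub: "subgroup ?B (tree_aut m)" by (rule group.generate_is_subgroup[OF group_tree_aut X])
  have comp: "f \<circ> g \<in> ?B" if "f \<in> ?B" "g \<in> ?B" for f g using generate.eng[OF that(2,1)] by simp
  have Bc: "f \<in> carrier (tree_aut m)" if "f \<in> ?B" for f using subgroup.subset[OF sub] that by blast
  have inv: "finv f \<in> ?B" if "f \<in> ?B" for f
    using subgroup.m_inv_closed[OF sub that] Bc[OF that] by (simp add: tree_inv)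
  have inv_unique: "g = finv f" if "f \<in> carrier (tree_aut m)" "f \<circ> g = id" for f g
    using that tree_inv_apply(1)[OF that(1)] by (metis comp_apply eq_id_iff ext)
  show ?thesis
  proof (rule regular_tree_group.intro)
    show "prime m" "subgroup ?B (tree_aut m)" by fact+
    show "f \<circ> g = g \<circ> f" if "f \<in> ?B" "g \<in> ?B" for f g
      by (rule generate_commute[OF X comm that])
    show "section1 m f y \<in> ?B" if "f \<in> ?B" "y \<in> {1..m}" for f y
      using that
    proof (induction arbitrary: y rule: generate.induct)
      case one
      show ?case using generate.one[of "tree_aut m" X] by (metis section1_id tree_one)
    next
      case (incl h)
      then show ?case by (rule sec)
    next
      case (inv h)
      have hc: "h \<in> carrier (tree_aut m)" using inv(1) X by blast
      note ic = tree_inv_closed[OF hc]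
      have r: "root_perm m (finv h) y \<in> {1..m}" by (rule root_perm_in[OF ic inv(2)])
      have "h \<circ> finv h = id" using tree_inv_apply(2)[OF hc] by auto
      then have "section1 m h (root_perm m (finv h) y) \<circ> section1 m (finv h) y = id"
        using section1_comp[OF hc ic inv(2)] by simp
      then have "section1 m (finv h) y = finv (section1 m h (root_perm m (finv h) y))"
        by (rule inv_unique[OF section1_closed[OF hc r]])
      then show ?case using \<open>\<And>f. f \<in> ?B \<Longrightarrow> finv f \<in> ?B\<close>[OF sec[OF inv(1) r]] hc by (simp add: tree_inv)
    next
      case (eng h1 h2)
      have hc: "h1 \<in> carrier (tree_aut m)" "h2 \<in> carrier (tree_aut m)" using Bc eng(1,2) by auto
      have "section1 m (h2 \<circ> h1) y = section1 m h2 (root_perm m h1 y) \<circ> section1 m h1 y"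
        by (rule section1_comp[OF hc(2,1) eng(5)])
      then show ?case using comp[OF eng(4)[OF root_perm_in[OF hc(1) eng(5)]] eng(3)[OF eng(5)]]
        by (simp add: comp_def)
    qed
    show "diag m f \<in> ?B" if "f \<in> ?B" for f
      using that
    proof (induction rule: generate.induct)
      case one
      show ?case using generate.one[of "tree_aut m" X] by (metis diag_id tree_one)
    next
      case (incl h)
      then show ?case by (rule dia)
    next
      case (inv h)
      have hc: "h \<in> carrier (tree_aut m)" using inv(1) X by blast
      have "h \<circ> finv h = id" using tree_inv_apply(2)[OF hc] by auto
      then have "diag m h \<circ> diag m (finv h) = id" using diag_comp[OF hc tree_inv_closed[OF hc]] by (simp add: diag_id)
      then have "diag m (finv h) = finv (diag m h)" by (rule inv_unique[OF diag_closed[OF hc]])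
      then show ?case using \<open>\<And>f. f \<in> ?B \<Longrightarrow> finv f \<in> ?B\<close>[OF dia[OF inv(1)]] hc by (simp add: tree_inv)
    next
      case (eng h1 h2)
      then show ?case using comp[OF eng(4,3)] Bc diag_comp[of h2 m h1] by (simp add: comp_def)
    qed
    fix y z assume y: "y \<in> {1..m}" and z: "z \<in> {1..m}"
    obtain f where f: "f \<in> ?B" "root_perm m f 1 = y" using trans[OF y] by blast
    obtain g where g: "g \<in> ?B" "root_perm m g 1 = z" using trans[OF z] by blast
    note fc = Bc[OF f(1)] and gc = Bc[OF g(1)]
    have m1: "1 \<in> {1..m}" using y by simp
    have "f [1] = [y]" using tree_apply_singleton[OF fc m1] f(2) by simp
    then have "finv f [y] = [1]" using tree_inv_apply(1)[OF fc] by metis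
    then have "root_perm m (finv f) y = 1" using y by (simp add: root_perm_def)
    then have "root_perm m (g \<circ> finv f) y = z"
      using root_perm_comp[OF gc tree_inv_closed[OF fc] y] g(2) by simp
    then show "\<exists>f\<in>?B. root_perm m f y = z" using comp[OF g(1) inv[OF f(1)]] by blast
  qed
qed

lemma diag_pow_comp:
  assumes "f \<in> carrier (tree_aut m)" "g \<in> carrier (tree_aut m)"
  shows "diag_pow m n (f \<circ> g) = diag_pow m n f \<circ> diag_pow m n g"
proof (induction n)
  case (Suc n)
  have "diag m (diag_pow m n (f \<circ> g)) = diag m (diag_pow m n f) \<circ> diag m (diag_pow m n g)"
    unfolding Suc by (intro diag_comp diag_pow_closed assms)
  then show ?case by (simp add: comp_def)
qed simp

text \<open>
  That \<open>f\<close> commutes with iterated diagonals of \<open>g\<close> is shown by induction on the number of iterations,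
  comparing sections: those of \<open>f\<close> are again in \<open>A\<close>.
\<close>

lemma regular_diag_closure:
  assumes m: "prime m" and A: "A \<subseteq> carrier (tree_aut m)"
    and comm: "\<And>f g. f \<in> A \<Longrightarrow> g \<in> A \<Longrightarrow> f \<circ> g = g \<circ> f"
    and sec: "\<And>f y. f \<in> A \<Longrightarrow> y \<in> {1..m} \<Longrightarrow> section1 m f y \<in> A"
    and trans: "\<And>y. y \<in> {1..m} \<Longrightarrow> \<exists>f\<in>A. root_perm m f 1 = y"
  shows "regular_tree_group m (diag_closure m A)"
  unfolding diag_closure_def
proof (rule regular_tree_group_generate[OF m])
  let ?X = "\<Union>i. diag_pow m i ` A"
  note Ac = subsetD[OF A]
  show "?X \<subseteq> carrier (tree_aut m)" using A diag_pow_closed by blast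
  have one: "f \<circ> diag_pow m k g = diag_pow m k g \<circ> f" if "f \<in> A" "g \<in> A" for f g k
    using that
  proof (induction k arbitrary: f)
    case 0
    then show ?case using comm by simp
  next
    case (Suc k)
    note fc = Ac[OF Suc.prems(1)] and gc = diag_pow_closed[OF Ac[OF Suc.prems(2)], of k]
    show ?case
    proof (rule tree_eq_sectionsI)
      show "f \<circ> diag_pow m (Suc k) g \<in> carrier (tree_aut m)" "diag_pow m (Suc k) g \<circ> f \<in> carrier (tree_aut m)"
        using fc diag_closed[OF gc] by (simp_all add: tree_comp)
      fix y assume y: "y \<in> {1..m}"
      note ry = root_perm_in[OF fc y]
      show "root_perm m (f \<circ> diag_pow m (Suc k) g) y = root_perm m (diag_pow m (Suc k) g \<circ> f) y"
        using fc diag_closed[OF gc] y ry by (simp add: root_perm_comp root_perm_diag)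
      show "section1 m (f \<circ> diag_pow m (Suc k) g) y = section1 m (diag_pow m (Suc k) g \<circ> f) y"
        using section1_comp[OF fc diag_closed[OF gc] y] section1_comp[OF diag_closed[OF gc] fc y]
          Suc.IH[OF sec[OF Suc.prems(1) y] Suc.prems(2)] y ry gc
        by (simp add: root_perm_diag section1_diag comp_def)
    qed
  qed
  have two: "diag_pow m i f \<circ> diag_pow m k g = diag_pow m k g \<circ> diag_pow m i f"
    if fg: "f \<in> A" "g \<in> A" "i \<le> k" for f g i k
  proof -
    obtain l where k: "k = i + l" using fg(3) le_Suc_ex by blast
    have "diag_pow m i (f \<circ> diag_pow m l g) = diag_pow m i (diag_pow m l g \<circ> f)" using one[OF fg(1,2)] by simp
    then show ?thesis using fg Ac by (simp add: k funpow_add diag_pow_comp diag_pow_closed)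
  qed
  show "f \<circ> g = g \<circ> f" if "f \<in> ?X" "g \<in> ?X" for f g
    using that two by (auto, metis nat_le_linear)
  show "section1 m f y \<in> generate (tree_aut m) ?X" if f: "f \<in> ?X" and y: "y \<in> {1..m}" for f y
  proof -
    obtain i a where a: "a \<in> A" "f = diag_pow m i a" using f by blast
    have "section1 m f y \<in> ?X"
    proof (cases i)
      case 0
      then have "section1 m f y \<in> diag_pow m 0 ` A" using sec[OF a(1) y] a(2) by simp
      then show ?thesis by blast
    next
      case (Suc k)
      then have "section1 m f y = diag_pow m k a" using a y by (simp add: section1_diag diag_pow_closed Ac)
      then show ?thesis using a(1) by blast
    qed
    then show ?thesis by (rule generate.incl)
  qed
  show "diag m f \<in> generate (tree_aut m) ?X" if f: "f \<in> ?X" for f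
  proof -
    obtain i a where a: "a \<in> A" "f = diag_pow m i a" using f by blast
    then have "diag m f = diag_pow m (Suc i) a" by simp
    then have "diag m f \<in> ?X" using a(1) by blast
    then show ?thesis by (rule generate.incl)
  qed
  show "\<exists>f\<in>generate (tree_aut m) ?X. root_perm m f 1 = y" if y: "y \<in> {1..m}" for y
  proof -
    obtain f where f: "f \<in> A" "root_perm m f 1 = y" using trans[OF y] by blast
    have "f \<in> diag_pow m 0 ` A" using f by simp
    then have "f \<in> ?X" by blast
    then show ?thesis using f(2) generate.incl by metis
  qed
qed

section \<open>Powers of the cycle\<close>

lemma full_cycle_pow_permutes: "full_cycle m ^^ k permutes {1..m}"
proof (induction k)
  case (Suc k)
  then show ?case using permutes_compose[OF Suc full_cycle_permutes] by (simp add: comp_def)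
next
  case 0
  show ?case unfolding funpow.simps by (rule permutes_id)
qed

lemma full_cycle_pow_apply:
  assumes "y \<in> {1..m}"
  shows "(full_cycle m ^^ k) y = (y - 1 + k) mod m + 1"
proof (induction k)
  case 0
  then show ?case using assms by auto
next
  case (Suc k)
  have "(y - 1 + k) mod m < m" using assms by simp
  then have "full_cycle m ((y - 1 + k) mod m + 1) = (if Suc ((y - 1 + k) mod m) = m then 0 else Suc ((y - 1 + k) mod m)) + 1"
    by (subst full_cycle_apply) auto
  also have "\<dots> = (y - 1 + Suc k) mod m + 1" by (simp add: mod_Suc)
  finally show ?case using Suc by simp
qed

lemma full_cycle_pow_mod: "full_cycle m ^^ (k mod m) = full_cycle m ^^ k"
proof
  fix y
  show "(full_cycle m ^^ (k mod m)) y = (full_cycle m ^^ k) y"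
  proof (cases "y \<in> {1..m}")
    case True
    then show ?thesis by (cases y) (simp_all add: full_cycle_pow_apply mod_add_right_eq)
  next
    case False
    then show ?thesis using permutes_not_in[OF full_cycle_pow_permutes] by metis
  qed
qed

lemma full_cycle_pow_m: "full_cycle m ^^ m = id"
  using full_cycle_pow_mod[where m = m and k = m] by simp

section \<open>Levelwise rotations\<close>

text \<open>
  The automorphism to which the power series with coefficients \<open>f i\<close> corresponds: it advances the
  letter at depth \<open>i\<close> cyclically by \<open>f i\<close>.
\<close>

definition rotation :: "nat \<Rightarrow> (nat \<Rightarrow> int) \<Rightarrow> nat list \<Rightarrow> nat list" where
  "rotation m f w = (if w \<in> words m then map (\<lambda>i. (full_cycle m ^^ nat (f i)) (w ! i)) [0..<length w] else w)"

lemma length_rotation [simp]: "length (rotation m f w) = length w"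
  by (simp add: rotation_def)

lemma nth_rotation: "w \<in> words m \<Longrightarrow> i < length w \<Longrightarrow> rotation m f w ! i = (full_cycle m ^^ nat (f i)) (w ! i)"
  by (simp add: rotation_def)

lemma words_nth: "w \<in> words m \<Longrightarrow> i < length w \<Longrightarrow> w ! i \<in> {1..m}"
  using nth_mem[of i w] unfolding words_def lists_eq_set by blast

lemma rotation_words: "w \<in> words m \<Longrightarrow> rotation m f w \<in> words m"
  using permutes_in_image[OF full_cycle_pow_permutes] words_nth[of w m]
  unfolding words_def[of m] lists_eq_set by (auto simp: rotation_def words_def lists_eq_set)

lemma rotation_closed: "rotation m f \<in> carrier (tree_aut m)"
proof (rule tree_aut_I)
  fix v w assume vw: "v \<in> words m" "w \<in> words m" "rotation m f v = rotation m f w"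
  then have len: "length v = length w" by (metis length_rotation)
  show "v = w"
  proof (rule nth_equalityI[OF len])
    fix i assume i: "i < length v"
    have "(full_cycle m ^^ nat (f i)) (v ! i) = (full_cycle m ^^ nat (f i)) (w ! i)"
      using nth_rotation[OF vw(1) i, of f] nth_rotation[OF vw(2), of i f] vw(3) i len by simp
    then show "v ! i = w ! i" using permutes_inj[OF full_cycle_pow_permutes] by (metis injD)
  qed
next
  fix u y assume u: "u @ [y] \<in> words m"
  have "rotation m f (u @ [y]) = rotation m f u @ [(full_cycle m ^^ nat (f (length u))) y]"
    using u by (simp add: rotation_def nth_append)
  then show "\<exists>z. rotation m f (u @ [y]) = rotation m f u @ [z]" by blast
qed (simp_all add: rotation_words, simp add: rotation_def)

lemma rotation_comp:
  assumes "\<And>n. 0 \<le> f n" "\<And>n. 0 \<le> g n"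
  shows "rotation m g \<circ> rotation m f = rotation m (\<lambda>n. (f n + g n) mod int m)"
proof (rule tree_eqI)
  show "rotation m g \<circ> rotation m f \<in> carrier (tree_aut m)" by (intro tree_comp rotation_closed)
  show "rotation m (\<lambda>n. (f n + g n) mod int m) \<in> carrier (tree_aut m)" by (rule rotation_closed)
  fix w assume w: "w \<in> words m"
  have e: "full_cycle m ^^ nat (g i) \<circ> full_cycle m ^^ nat (f i) = full_cycle m ^^ nat ((f i + g i) mod int m)" for i
  proof -
    have "nat ((f i + g i) mod int m) = (nat (g i) + nat (f i)) mod m"
      using assms[of i] by (simp add: nat_mod_distrib nat_add_distrib add.commute)
    then show ?thesis using full_cycle_pow_mod[where m = m and k = "nat (g i) + nat (f i)"]
      by (simp only: funpow_add)
  qed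
  show "(rotation m g \<circ> rotation m f) w = rotation m (\<lambda>n. (f n + g n) mod int m) w"
  proof (rule nth_equalityI)
    fix i assume i: "i < length ((rotation m g \<circ> rotation m f) w)"
    then show "(rotation m g \<circ> rotation m f) w ! i = rotation m (\<lambda>n. (f n + g n) mod int m) w ! i"
      using w e[of i] by (simp add: nth_rotation rotation_words fun_eq_iff)
  qed simp
qed

lemma diag_rotation: "diag m (rotation m f) = rotation m (\<lambda>n. if n = 0 then 0 else f (n - 1))"
proof (rule tree_eqI[OF diag_closed[OF rotation_closed] rotation_closed])
  fix w assume w: "w \<in> words m"
  show "diag m (rotation m f) w = rotation m (\<lambda>n. if n = 0 then 0 else f (n - 1)) w"
  proof (cases w)
    case (Cons y u)
    show ?thesis
    proof (rule nth_equalityI)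
      show "length (diag m (rotation m f) w) = length (rotation m (\<lambda>n. if n = 0 then 0 else f (n - 1)) w)"
        using w Cons by (simp add: diag_cons)
      fix i assume "i < length (diag m (rotation m f) w)"
      then show "diag m (rotation m f) w ! i = rotation m (\<lambda>n. if n = 0 then 0 else f (n - 1)) w ! i"
        using w Cons by (cases i) (simp_all add: diag_cons nth_rotation)
    qed
  qed (simp add: rotation_def tree_aut_nil[OF diag_closed[OF rotation_closed]])
qed

lemma rigid_full_cycle_pow:
  "rigid m (full_cycle m ^^ k) = rotation m (\<lambda>n. if n = 0 then int k else 0)"
proof (rule tree_eqI)
  show "rigid m (full_cycle m ^^ k) \<in> carrier (tree_aut m)"
    unfolding rigid_def by (intro wreath_closed tree_id full_cycle_pow_permutes)
  show "rotation m (\<lambda>n. if n = 0 then int k else 0) \<in> carrier (tree_aut m)" by (rule rotation_closed)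
  fix w assume w: "w \<in> words m"
  show "rigid m (full_cycle m ^^ k) w = rotation m (\<lambda>n. if n = 0 then int k else 0) w"
  proof (cases w)
    case Nil
    then show ?thesis by (simp add: rigid_def wreath_def rotation_def)
  next
    case (Cons y u)
    show ?thesis
    proof (rule nth_equalityI)
      show "length (rigid m (full_cycle m ^^ k) w) = length (rotation m (\<lambda>n. if n = 0 then int k else 0) w)"
        using w Cons by (simp add: rigid_def wreath_cons)
      fix i assume "i < length (rigid m (full_cycle m ^^ k) w)"
      then show "rigid m (full_cycle m ^^ k) w ! i = rotation m (\<lambda>n. if n = 0 then int k else 0) w ! i"
        using w Cons by (cases i) (simp_all add: rigid_def wreath_cons nth_rotation)
    qed
  qed
qed

text \<open>
  The amount of rotation at depth \<open>n\<close> can be read off from the image of the constant word 1.  Letters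
  start at 1, hence the final correction.
\<close>

lemma rotation_coefficient:
  assumes m: "1 \<le> m" and f: "f n \<in> {0..<int m}"
  shows "f n = int (rotation m f (replicate (Suc n) 1) ! n) - 1"
proof -
  have "replicate (Suc n) 1 \<in> words m" using m by (auto simp: words_def)
  then have "rotation m f (replicate (Suc n) 1) ! n = (full_cycle m ^^ nat (f n)) (replicate (Suc n) 1 ! n)"
    by (rule nth_rotation) simp
  also have "replicate (Suc n) 1 ! n = (1::nat)" by (rule nth_replicate) simp
  also have "(full_cycle m ^^ nat (f n)) 1 = nat (f n) mod m + 1" using m by (simp add: full_cycle_pow_apply)
  also have "nat (f n) mod m = nat (f n)" using f by auto
  finally show ?thesis using f by simp
qed

section \<open>The group generated by the rigid cycle\<close>

definition cycle_group :: "nat \<Rightarrow> (nat list \<Rightarrow> nat list) set" where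
  "cycle_group m = generate (tree_aut m) {rigid m (full_cycle m)}"

lemma rigid_closed: "rigid m (full_cycle m ^^ k) \<in> carrier (tree_aut m)"
  unfolding rigid_def by (intro wreath_closed tree_id full_cycle_pow_permutes)

lemma rigid_comp: "rigid m (full_cycle m ^^ i) \<circ> rigid m (full_cycle m ^^ k) = rigid m (full_cycle m ^^ (i + k))"
proof (rule tree_eqI)
  fix w assume w: "w \<in> words m"
  have "(full_cycle m ^^ k) y \<in> {1..m} \<longleftrightarrow> y \<in> {1..m}" for y
    by (rule permutes_in_image[OF full_cycle_pow_permutes])
  then show "(rigid m (full_cycle m ^^ i) \<circ> rigid m (full_cycle m ^^ k)) w = rigid m (full_cycle m ^^ (i + k)) w"
    using w by (cases w) (auto simp: rigid_def wreath_def funpow_add)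
qed (intro tree_comp rigid_closed)+

lemma rigid_0: "rigid m id = id"
  by (auto simp: rigid_def wreath_def split: list.splits)

lemma rigid_pow_0: "rigid m (full_cycle m ^^ 0) = id"
  unfolding funpow.simps by (rule rigid_0)

lemma cycle_group_eq: assumes "1 \<le> m" shows "cycle_group m = range (\<lambda>k. rigid m (full_cycle m ^^ k))"
proof (intro equalityI subsetI)
  fix f assume "f \<in> cycle_group m"
  then show "f \<in> range (\<lambda>k. rigid m (full_cycle m ^^ k))"
    unfolding cycle_group_def
  proof (induction rule: generate.induct)
    case one
    show ?case by (metis rangeI rigid_pow_0 tree_one)
  next
    case (incl h)
    then show ?case by (intro image_eqI[of _ _ 1]) auto
  next
    case (inv h)
    then have h: "h = rigid m (full_cycle m ^^ 1)" by simp
    have "rigid m (full_cycle m ^^ 1) \<circ> rigid m (full_cycle m ^^ (m - 1)) = id"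
      unfolding rigid_comp using assms full_cycle_pow_m rigid_0 by (simp add: id_def)
    then have "finv h = rigid m (full_cycle m ^^ (m - 1))"
      using tree_inv_apply(1)[OF rigid_closed, of m 1] unfolding h by (metis comp_apply eq_id_iff ext)
    then show ?case using rigid_closed[of m 1] h by (auto simp: tree_inv)
  next
    case (eng h1 h2)
    then obtain i k where "h1 = rigid m (full_cycle m ^^ i)" "h2 = rigid m (full_cycle m ^^ k)" by blast
    then show ?case using rigid_comp[of m k i] by auto
  qed
next
  fix f assume "f \<in> range (\<lambda>k. rigid m (full_cycle m ^^ k))"
  then obtain k where k: "f = rigid m (full_cycle m ^^ k)" by blast
  have "rigid m (full_cycle m ^^ k) \<in> cycle_group m" for k
  proof (induction k)
    case 0
    show ?case unfolding cycle_group_def by (metis generate.one rigid_pow_0 tree_one)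
  next
    case (Suc k)
    have "rigid m (full_cycle m ^^ 1) \<in> cycle_group m" unfolding cycle_group_def by (auto intro: generate.incl)
    then have "rigid m (full_cycle m ^^ k) \<otimes>\<^bsub>tree_aut m\<^esub> rigid m (full_cycle m ^^ 1) \<in> cycle_group m"
      using Suc unfolding cycle_group_def by (intro generate.eng)
    then show ?case unfolding tree_mult rigid_comp by (simp add: comp_def)
  qed
  then show "f \<in> cycle_group m" using k by blast
qed

section \<open>The isomorphism with power series\<close>

definition residue_seqs :: "nat \<Rightarrow> (nat \<Rightarrow> int) set" where
  "residue_seqs m = {f. \<forall>n. f n \<in> {0..<int m}}"

lemma rotation_inj: "1 \<le> m \<Longrightarrow> inj_on (rotation m) (residue_seqs m)"
  by (intro inj_onI ext) (metis rotation_coefficient residue_seqs_def mem_Collect_eq)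

lemma subgroup_rotation: assumes m: "1 \<le> m" shows "subgroup (rotation m ` residue_seqs m) (tree_aut m)"
proof (rule group.subgroupI[OF group_tree_aut])
  show "rotation m ` residue_seqs m \<subseteq> carrier (tree_aut m)" using rotation_closed by blast
  have "(\<lambda>_. 0) \<in> residue_seqs m" using m by (simp add: residue_seqs_def)
  then show "rotation m ` residue_seqs m \<noteq> {}" by blast
next
  fix h assume "h \<in> rotation m ` residue_seqs m"
  then obtain f where f: "f \<in> residue_seqs m" "h = rotation m f" by blast
  let ?g = "\<lambda>n. (- f n) mod int m"
  have g: "?g \<in> residue_seqs m" using m by (simp add: residue_seqs_def)
  have "(f n + (- f n) mod int m) mod int m = 0" for n by (simp add: mod_add_right_eq)
  then have "rotation m f \<circ> rotation m ?g = rotation m (\<lambda>_. 0)"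
    using rotation_comp[of ?g f m] f(1) g by (simp add: residue_seqs_def add.commute)
  also have "rotation m (\<lambda>_. 0) = id"
  proof
    show "rotation m (\<lambda>_. 0) w = id w" for w by (auto simp: rotation_def map_nth)
  qed
  finally have "finv h = rotation m ?g"
    using tree_inv_apply(1)[OF rotation_closed, of m f] unfolding f(2) by (metis comp_apply eq_id_iff ext)
  then show "inv\<^bsub>tree_aut m\<^esub> h \<in> rotation m ` residue_seqs m" using g f(2) by (simp add: tree_inv rotation_closed)
next
  fix h1 h2 assume "h1 \<in> rotation m ` residue_seqs m" "h2 \<in> rotation m ` residue_seqs m"
  then obtain f g where fg: "f \<in> residue_seqs m" "g \<in> residue_seqs m" "h1 = rotation m f" "h2 = rotation m g" by blast
  have "(\<lambda>n. (f n + g n) mod int m) \<in> residue_seqs m" using m by (simp add: residue_seqs_def)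
  moreover have "h2 \<circ> h1 = rotation m (\<lambda>n. (f n + g n) mod int m)"
    unfolding fg(3,4) by (rule rotation_comp) (use fg(1,2) in \<open>auto simp: residue_seqs_def\<close>)
  ultimately show "h1 \<otimes>\<^bsub>tree_aut m\<^esub> h2 \<in> rotation m ` residue_seqs m" by simp
qed

lemma diag_pow_rigid:
  "diag_pow m i (rigid m (full_cycle m ^^ k)) = rotation m (\<lambda>n. if n = i then int k else 0)"
proof (induction i)
  case 0
  then show ?case by (simp add: rigid_full_cycle_pow)
next
  case (Suc i)
  have "(\<lambda>n. if n = 0 then 0 else if n - 1 = i then int k else 0) = (\<lambda>n. if n = Suc i then int k else 0)"
    by (rule ext) auto
  then show ?case using Suc diag_rotation[of m "\<lambda>n. if n = i then int k else 0"] by simp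
qed

lemma diag_closure_cycle_group_subset:
  assumes m: "1 \<le> m"
  shows "diag_closure m (cycle_group m) \<subseteq> rotation m ` residue_seqs m"
  unfolding diag_closure_def
proof (rule group.generate_subgroup_incl[OF group_tree_aut _ subgroup_rotation[OF m]])
  have "diag_pow m i (rigid m (full_cycle m ^^ k)) \<in> rotation m ` residue_seqs m" for i k
  proof -
    have "rigid m (full_cycle m ^^ k) = rigid m (full_cycle m ^^ (k mod m))" by (simp add: full_cycle_pow_mod)
    moreover have "(\<lambda>n. if n = i then int (k mod m) else 0) \<in> residue_seqs m" using m by (simp add: residue_seqs_def)
    ultimately show ?thesis using diag_pow_rigid[of i m "k mod m"] by auto
  qed
  then show "(\<Union>i. diag_pow m i ` cycle_group m) \<subseteq> rotation m ` residue_seqs m" unfolding cycle_group_eq[OF m] by blast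
qed

text \<open>
  The iterated diagonals of the generator rotate a single depth, so finite products give all rotation
  sequences of finite support, which are dense among all sequences.  Conversely, on each level a limit of rotations
  is a rotation, and the amounts at a fixed depth stabilize.
\<close>

lemma diag_top_closure_cycle_group:
  assumes m: "1 \<le> m"
  shows "diag_top_closure m (cycle_group m) = rotation m ` residue_seqs m"
proof (intro equalityI subsetI)
  fix a assume "a \<in> diag_top_closure m (cycle_group m)"
  then have ac: "a \<in> carrier (tree_aut m)" and ex: "\<And>n. \<exists>f\<in>residue_seqs m. agree m n a (rotation m f)"
    using diag_closure_cycle_group_subset[OF m] unfolding diag_top_closure_def top_closure_iff by (blast, blast)
  obtain F where F: "\<And>n. F n \<in> residue_seqs m" "\<And>n. agree m n a (rotation m (F n))" using ex by metis
  \<comment> \<open>The amounts found on different levels agree where both are visible.\<close>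
  have FF: "F n i = F (Suc i) i" if "i < n" for n i
  proof -
    have "agree m (Suc i) a (rotation m (F n))"
      by (rule agree_mono[OF ac rotation_closed F(2)]) (use that m in auto)
    then have "agree m (Suc i) (rotation m (F n)) (rotation m (F (Suc i)))"
      using F(2) agree_sym agree_trans by blast
    moreover have "replicate (Suc i) 1 \<in> words m" using m by (auto simp: words_def)
    ultimately have "rotation m (F n) (replicate (Suc i) 1) = rotation m (F (Suc i)) (replicate (Suc i) 1)"
      by (simp add: agree_def del: replicate_Suc)
    then show ?thesis using rotation_coefficient[OF m, of "F n" i] rotation_coefficient[OF m, of "F (Suc i)" i] F(1)
      by (simp add: residue_seqs_def del: replicate_Suc)
  qed
  let ?f = "\<lambda>i. F (Suc i) i"
  have "a = rotation m ?f"
  proof (rule tree_eqI[OF ac rotation_closed])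
    fix w assume w: "w \<in> words m"
    have "a w = rotation m (F (length w)) w" using F(2)[of "length w"] w by (simp add: agree_def)
    also have "\<dots> = rotation m ?f w"
    proof (rule nth_equalityI)
      fix i assume "i < length (rotation m (F (length w)) w)"
      then have i: "i < length w" by simp
      show "rotation m (F (length w)) w ! i = rotation m ?f w ! i"
        unfolding nth_rotation[OF w i] FF[OF i] ..
    qed simp
    finally show "a w = rotation m ?f w" .
  qed
  moreover have "?f \<in> residue_seqs m" using F(1) by (simp add: residue_seqs_def)
  ultimately show "a \<in> rotation m ` residue_seqs m" by blast
next
  fix a assume "a \<in> rotation m ` residue_seqs m"
  then obtain f where f: "f \<in> residue_seqs m" "a = rotation m f" by blast
  have f0: "0 \<le> f i" "f i < int m" for i using f(1) by (simp_all add: residue_seqs_def)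
  let ?t = "\<lambda>n i. if i < n then f i else 0"
  have tC: "rotation m (?t n) \<in> diag_closure m (cycle_group m)" for n
  proof (induction n)
    case 0
    have "rotation m (\<lambda>_. 0) = id"
    proof
      show "rotation m (\<lambda>_. 0) w = id w" for w by (auto simp: rotation_def map_nth)
    qed
    then have "rotation m (?t 0) = \<one>\<^bsub>tree_aut m\<^esub>" by simp
    then show ?case unfolding diag_closure_def by (metis generate.one)
  next
    case (Suc n)
    let ?g = "\<lambda>i. if i = n then int (nat (f n)) else 0"
    have "diag_pow m n (rigid m (full_cycle m ^^ nat (f n))) \<in> (\<Union>i. diag_pow m i ` cycle_group m)"
      unfolding cycle_group_eq[OF m] by blast
    then have g: "rotation m ?g \<in> diag_closure m (cycle_group m)"
      unfolding diag_closure_def diag_pow_rigid by (rule generate.incl)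
    have "rotation m ?g \<circ> rotation m (?t n) = rotation m (\<lambda>i. (?t n i + ?g i) mod int m)"
      by (rule rotation_comp) (use f0 in auto)
    also have "(\<lambda>i. (?t n i + ?g i) mod int m) = ?t (Suc n)"
      using f0 by (auto simp: less_Suc_eq)
    finally have eq: "rotation m ?g \<circ> rotation m (?t n) = rotation m (?t (Suc n))" .
    have "rotation m (?t n) \<otimes>\<^bsub>tree_aut m\<^esub> rotation m ?g \<in> diag_closure m (cycle_group m)"
      using Suc g unfolding diag_closure_def by (rule generate.eng)
    then show ?case unfolding tree_mult eq .
  qed
  have "agree m n a (rotation m (?t n))" for n
    unfolding agree_def f(2) by (auto simp: nth_rotation intro!: nth_equalityI)
  then show "a \<in> diag_top_closure m (cycle_group m)"
    using tC f(2) rotation_closed unfolding diag_top_closure_def top_closure_iff by blast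
qed

text \<open>
  Composing rotations adds the amounts modulo \<open>m\<close>, and multiplication by the variable shifts
  coefficients by one position exactly as the diagonal map shifts depths.
\<close>

lemma rotation_iso:
  assumes m: "prime m"
  shows "rotation m \<in> iso (add_monoid (fps_ring (residue_ring (int m))))
                (sub_aut m (diag_top_closure m (cycle_group m)))"
    and "f \<in> carrier (fps_ring (residue_ring (int m))) \<Longrightarrow>
      rotation m (fps_var (residue_ring (int m)) \<otimes>\<^bsub>fps_ring (residue_ring (int m))\<^esub> f) = diag m (rotation m f)"
proof -
  have m1: "1 < m" using prime_gt_1_nat[OF m] .
  let ?R = "residue_ring (int m)"
  interpret R: residues "int m" ?R by (unfold_locales) (use m1 in auto)
  have carr: "carrier (fps_ring ?R) = residue_seqs m"
    by (auto simp: fps_ring_def residue_seqs_def R.res_carrier_eq)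
  have add: "monoid.mult (add_monoid (fps_ring ?R)) = (\<lambda>f g n. (f n + g n) mod int m)"
    by (simp add: fps_ring_def R.res_add_eq)
  show "rotation m \<in> iso (add_monoid (fps_ring ?R)) (sub_aut m (diag_top_closure m (cycle_group m)))"
  proof (rule isoI)
    show "rotation m \<in> hom (add_monoid (fps_ring ?R)) (sub_aut m (diag_top_closure m (cycle_group m)))"
    proof (rule homI)
      fix f g assume fg: "f \<in> carrier (add_monoid (fps_ring ?R))" "g \<in> carrier (add_monoid (fps_ring ?R))"
      then show "rotation m (f \<otimes>\<^bsub>add_monoid (fps_ring ?R)\<^esub> g) = rotation m f \<otimes>\<^bsub>sub_aut m (diag_top_closure m (cycle_group m))\<^esub> rotation m g"
        unfolding add using carr rotation_comp[of f g m] by (simp add: residue_seqs_def)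
    qed (use carr m1 in \<open>simp add: diag_top_closure_cycle_group\<close>)
    show "bij_betw (rotation m) (carrier (add_monoid (fps_ring ?R))) (carrier (sub_aut m (diag_top_closure m (cycle_group m))))"
      using carr m1 rotation_inj[of m] by (simp add: bij_betw_def diag_top_closure_cycle_group)
  qed
  assume f: "f \<in> carrier (fps_ring ?R)"
  have fR: "f n \<in> carrier ?R" for n using f by (simp add: fps_ring_def)
  have "(fps_var ?R \<otimes>\<^bsub>fps_ring ?R\<^esub> f) n = (if n = 0 then 0 else f (n - 1))" for n
  proof -
    have "(fps_var ?R \<otimes>\<^bsub>fps_ring ?R\<^esub> f) n = (\<Oplus>\<^bsub>?R\<^esub>i\<in>{..n}. fps_var ?R i \<otimes>\<^bsub>?R\<^esub> f (n - i))"
      by (simp add: fps_ring_def)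
    also have "\<dots> = (\<Oplus>\<^bsub>?R\<^esub>i\<in>{..n}. if 1 = i then f (n - 1) else \<zero>\<^bsub>?R\<^esub>)"
      using fR by (intro R.finsum_cong') (auto simp: fps_var_def)
    also have "\<dots> = (if n = 0 then 0 else f (n - 1))"
    proof (cases "n = 0")
      case True
      then have "(\<Oplus>\<^bsub>?R\<^esub>i\<in>{..n}. if 1 = i then f (n - 1) else \<zero>\<^bsub>?R\<^esub>) = (\<Oplus>\<^bsub>?R\<^esub>i\<in>{..n}. \<zero>\<^bsub>?R\<^esub>)"
        by (intro R.finsum_cong') auto
      also have "\<dots> = \<zero>\<^bsub>?R\<^esub>" by (rule R.finsum_zero)
      finally show ?thesis using True by (simp add: R.res_zero_eq)
    next
      case False
      then show ?thesis using R.finsum_singleton[of 1 "{..n}" "\<lambda>_. f (n - 1)"] fR by simp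
    qed
    finally show ?thesis .
  qed
  then show "rotation m (fps_var ?R \<otimes>\<^bsub>fps_ring ?R\<^esub> f) = diag m (rotation m f)"
    unfolding diag_rotation by presburger
qed

section \<open>Generalized adding machines\<close>

text \<open>
  The group generated by the states of the adding machine is already closed under the diagonal map, and
  taking \<open>m\<close>-th powers in it raises valuations by \<open>j\<close>; so it is the model for the torsion-free case.
\<close>

locale generalized_adding_machine =
  fixes m j :: nat and \<alpha> :: "nat list \<Rightarrow> nat list"
  assumes prime_m: "prime m" and j: "1 \<le> j" and \<alpha>: "is_adding_machine m j \<alpha>"
begin

lemma m_gt_1: "1 < m"
  by (rule prime_gt_1_nat[OF prime_m])

lemma closed: "\<alpha> \<in> carrier (tree_aut m)"
  using \<alpha> by (simp add: is_adding_machine_def)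

lemma shift_closed: "diag_pow m k \<alpha> \<in> carrier (tree_aut m)"
  by (rule diag_pow_closed[OF closed])

lemma rec: "\<alpha> = wreath m (\<lambda>y. if y = m then diag_pow m (j - 1) \<alpha> else id) (full_cycle m)"
  using \<alpha> unfolding is_adding_machine_def by blast

lemma root: "y \<in> {1..m} \<Longrightarrow> root_perm m \<alpha> y = full_cycle m y"
  by (subst rec) (rule root_perm_wreath)

lemma sec: "y \<in> {1..m} \<Longrightarrow> section1 m \<alpha> y = (if y = m then diag_pow m (j - 1) \<alpha> else id)"
  by (subst rec) (simp add: section1_wreath tree_id shift_closed)

lemma apply_cons:
  "y # u \<in> words m \<Longrightarrow> \<alpha> (y # u) = full_cycle m y # (if y = m then diag_pow m (j - 1) \<alpha> u else u)"
  using tree_aut_cons[OF closed] root[of y] sec[of y] by auto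

lemma shift_apply: "w \<in> words m \<Longrightarrow> diag_pow m k \<alpha> w = take k w @ \<alpha> (drop k w)"
  by (rule diag_pow_apply[of \<alpha> w m k, OF tree_aut_nil[OF closed]])

lemma shift_add_apply:
  "w \<in> words m \<Longrightarrow> diag_pow m (a + c) \<alpha> w = take a w @ diag_pow m c \<alpha> (drop a w)"
  using diag_pow_apply[of "diag_pow m c \<alpha>" w m a, OF tree_aut_nil[OF shift_closed]] by (simp add: funpow_add)

text \<open>
  Commuting \<open>\<alpha>\<close> with an iterated diagonal on a word reduces, after the first letter, to commuting two
  iterated diagonals of \<open>\<alpha>\<close> on a shorter word.  Removing the common number of diagonals leaves \<open>\<alpha>\<close> and an
  iterated diagonal, so induction on the length applies.
\<close>

lemma commute_apply: "w \<in> words m \<Longrightarrow> \<alpha> (diag_pow m k \<alpha> w) = diag_pow m k \<alpha> (\<alpha> w)"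
proof (induction "length w" arbitrary: w k rule: less_induct)
  case less
  have two: "diag_pow m a \<alpha> (diag_pow m b \<alpha> u) = diag_pow m b \<alpha> (diag_pow m a \<alpha> u)"
    if u: "u \<in> words m" "length u < length w" "a \<le> b" for a b u
  proof -
    obtain c where b: "b = a + c" using u(3) le_Suc_ex by blast
    have du: "drop a u \<in> words m" "length (drop a u) < length w"
      using u take_drop_in_words(2)[OF u(1)] by auto
    have uw: "diag_pow m k \<alpha> u \<in> words m" for k using tree_words[OF shift_closed] u(1) by simp
    have nil: "\<alpha> [] = []" "diag_pow m c \<alpha> [] = []" using tree_aut_nil closed shift_closed by auto
    have 1: "take a (take a u @ v) = take a u" "drop a (take a u @ v) = v"
      if "length v = length (drop a u)" for v using that by (cases "length u \<le> a"; simp)+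
    have len: "length (\<alpha> (drop a u)) = length (drop a u)" "length (diag_pow m c \<alpha> (drop a u)) = length (drop a u)"
      using tree_aut_length[OF closed du(1)] tree_aut_length[OF shift_closed du(1)] by auto
    have "diag_pow m a \<alpha> (diag_pow m b \<alpha> u) = take a u @ \<alpha> (diag_pow m c \<alpha> (drop a u))"
      unfolding shift_apply[OF uw, of a] unfolding b shift_add_apply[OF u(1)] using 1[OF len(2)] by simp
    moreover have "diag_pow m b \<alpha> (diag_pow m a \<alpha> u) = take a u @ diag_pow m c \<alpha> (\<alpha> (drop a u))"
      unfolding b shift_add_apply[OF uw] unfolding shift_apply[OF u(1)] using 1[OF len(1)] by simp
    ultimately show ?thesis using less.hyps[OF du(2,1)] by simp
  qed
  show ?case
  proof (cases "k = 0 \<or> w = []")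
    case True
    then show ?thesis using tree_aut_nil[OF closed] tree_aut_nil[OF shift_closed] by auto
  next
    case False
    then obtain l y u where k: "k = Suc l" and w: "w = y # u" by (cases k; cases w) auto
    have yu: "y # u \<in> words m" using less.prems w by simp
    have fy: "full_cycle m y \<in> {1..m}" using permutes_in_image[OF full_cycle_permutes] yu by simp
    have s: "diag_pow m l \<alpha> u \<in> words m" "diag_pow m (j - 1) \<alpha> u \<in> words m"
      using tree_words[OF shift_closed] yu by auto
    have "\<alpha> (diag_pow m k \<alpha> w) = full_cycle m y # (if y = m then diag_pow m (j - 1) \<alpha> (diag_pow m l \<alpha> u) else diag_pow m l \<alpha> u)"
      using yu s by (simp add: k w diag_cons apply_cons)
    moreover have "diag_pow m k \<alpha> (\<alpha> w) = full_cycle m y # (if y = m then diag_pow m l \<alpha> (diag_pow m (j - 1) \<alpha> u) else diag_pow m l \<alpha> u)"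
      using yu s fy by (simp add: k w diag_cons apply_cons)
    moreover have "diag_pow m (j - 1) \<alpha> (diag_pow m l \<alpha> u) = diag_pow m l \<alpha> (diag_pow m (j - 1) \<alpha> u)"
      using two[of u "j - 1" l] two[of u l "j - 1"] yu w by (cases "j - 1 \<le> l") auto
    ultimately show ?thesis by simp
  qed
qed

lemma commute: "diag_pow m a \<alpha> \<circ> diag_pow m b \<alpha> = diag_pow m b \<alpha> \<circ> diag_pow m a \<alpha>"
proof -
  have one: "\<alpha> \<circ> diag_pow m c \<alpha> = diag_pow m c \<alpha> \<circ> \<alpha>" for c
    by (rule tree_eqI[where m = m]) (auto simp: tree_comp closed shift_closed commute_apply)
  have "diag_pow m a \<alpha> \<circ> diag_pow m (a + c) \<alpha> = diag_pow m (a + c) \<alpha> \<circ> diag_pow m a \<alpha>" for a c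
    using arg_cong[OF one, of "diag_pow m a" c] diag_pow_comp[OF closed shift_closed, of a c]
      diag_pow_comp[OF shift_closed closed, of a c] by (simp add: funpow_add)
  then show ?thesis by (metis le_Suc_ex nat_le_linear)
qed

lemma pow_cons: "y # u \<in> words m \<Longrightarrow> y + k \<le> m \<Longrightarrow> (\<alpha> ^^ k) (y # u) = (y + k) # u"
  by (induction k) (auto simp: apply_cons full_cycle_apply)

text \<open>
  Going once around the cycle, every letter passes \<open>m\<close> exactly once, and only there a nontrivial section,
  the \<open>(j - 1)\<close>-fold diagonal of \<open>\<alpha>\<close>, acts on the rest of the word.
\<close>

lemma pow_m: "\<alpha> ^^ m = diag_pow m j \<alpha>"
proof
  fix w
  show "(\<alpha> ^^ m) w = diag_pow m j \<alpha> w"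
  proof (cases w)
    case Nil
    have "(\<alpha> ^^ k) [] = []" for k by (induction k) (simp_all add: tree_aut_nil[OF closed])
    then show ?thesis using Nil tree_aut_nil[OF shift_closed] by simp
  next
    case (Cons y u)
    show ?thesis
    proof (cases "w \<in> words m")
      case False
      have "(\<alpha> ^^ k) w = w" for k by (induction k) (simp_all add: tree_outside[OF closed False])
      then show ?thesis using tree_outside[OF shift_closed False] by simp
    next
      case True
      then have y: "1 \<le> y" "y \<le> m" "u \<in> words m" using Cons by auto
      have ju: "diag_pow m (j - 1) \<alpha> u \<in> words m" using tree_words[OF shift_closed] y by simp
      \<comment> \<open>\<open>m - y\<close> steps lead to the letter \<open>m\<close>, one step carries, and \<open>y - 1\<close> steps lead back to \<open>y\<close>.\<close>
      have "(\<alpha> ^^ ((y - 1) + (Suc 0 + (m - y)))) w = (\<alpha> ^^ (y - 1)) (\<alpha> ((\<alpha> ^^ (m - y)) w))"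
        by (simp only: funpow_add funpow.simps comp_apply id_apply)
      then have "(\<alpha> ^^ m) w = (\<alpha> ^^ (y - 1)) (\<alpha> ((\<alpha> ^^ (m - y)) w))" using y by simp
      also have "(\<alpha> ^^ (m - y)) w = m # u" using pow_cons[of y u "m - y"] y Cons by simp
      also have "\<alpha> (m # u) = 1 # diag_pow m (j - 1) \<alpha> u" using y by (simp add: apply_cons full_cycle_apply)
      also have "(\<alpha> ^^ (y - 1)) (1 # diag_pow m (j - 1) \<alpha> u) = y # diag_pow m (j - 1) \<alpha> u"
        using pow_cons[of 1 _ "y - 1"] y ju by simp
      also have "\<dots> = diag_pow m (Suc (j - 1)) \<alpha> w" using True Cons by (simp add: diag_cons)
      finally show ?thesis using j by simp
    qed
  qed
qed

text \<open>
  The section at \<open>m\<close> is the most nested diagonal of \<open>\<alpha>\<close> among the states; each further letter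
  removes one diagonal.
\<close>

lemma states_eq: "states m \<alpha> = insert id ((\<lambda>i. diag_pow m i \<alpha>) ` {..<j})" (is "_ = ?Y")
proof (intro equalityI subsetI)
  fix f assume "f \<in> states m \<alpha>"
  then obtain u where u: "u \<in> words m" "f = state m \<alpha> u" by (auto simp: states_def)
  have secY: "section1 m g y \<in> ?Y" if g: "g \<in> ?Y" and y: "y \<in> {1..m}" for g y
  proof (cases "g = id")
    case False
    then obtain i where i: "i < j" "g = diag_pow m i \<alpha>" using g by auto
    show ?thesis
    proof (cases i)
      case 0
      then show ?thesis using i y sec[OF y] by auto
    next
      case (Suc k)
      then have "section1 m g y = diag_pow m k \<alpha>" using i y by (simp add: section1_diag shift_closed)
      then show ?thesis using i Suc by auto
    qed
  qed simp
  have "g \<in> ?Y \<Longrightarrow> u \<in> words m \<Longrightarrow> state m g u \<in> ?Y" for g u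
  proof (induction u arbitrary: g)
    case (Cons y u)
    then show ?case using secY[of g y] by (simp only: state.simps cons_in_words)
  qed (simp only: state.simps)
  moreover have "\<alpha> \<in> ?Y" using j by (auto intro!: image_eqI[of _ _ 0])
  ultimately show "f \<in> ?Y" using u by blast
next
  fix f assume f: "f \<in> ?Y"
  show "f \<in> states m \<alpha>"
  proof (cases "f = id")
    case True
    have "state m \<alpha> [1] = id" using sec[of 1] m_gt_1 by simp
    moreover have "[1] \<in> words m" using m_gt_1 by simp
    ultimately show ?thesis unfolding states_def True by (metis imageI)
  next
    case False
    then obtain i where i: "i < j" "f = diag_pow m i \<alpha>" using f by auto
    have st: "state m (diag_pow m (a + i) \<alpha>) (replicate a 1) = diag_pow m i \<alpha>" for a
      using m_gt_1 by (induction a) (simp_all add: section1_diag shift_closed)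
    have "state m \<alpha> (m # replicate (j - 1 - i) 1) = f"
      using sec[of m] m_gt_1 st[of "j - 1 - i"] i by simp
    moreover have "m # replicate (j - 1 - i) 1 \<in> words m" using m_gt_1 by (auto simp: words_def)
    ultimately show ?thesis unfolding states_def by (metis imageI)
  qed
qed

lemma self_state: "\<alpha> \<in> states m \<alpha>"
proof -
  have "diag_pow m 0 \<alpha> \<in> states m \<alpha>" unfolding states_eq using j by (intro insertI2 imageI) simp
  then show ?thesis by simp
qed

text \<open>
  The diagonal of the last generator, the \<open>(j - 1)\<close>-fold diagonal of \<open>\<alpha>\<close>, is \<open>\<alpha>\<close> to the power \<open>m\<close>.
\<close>

lemma regular: "regular_tree_group m (generate (tree_aut m) (states m \<alpha>))"
proof (rule regular_tree_group_generate[OF prime_m])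
  let ?D = "generate (tree_aut m) (states m \<alpha>)"
  show X: "states m \<alpha> \<subseteq> carrier (tree_aut m)" unfolding states_eq using tree_id shift_closed by auto
  have sub: "subgroup ?D (tree_aut m)" by (rule group.generate_is_subgroup[OF group_tree_aut X])
  have inD: "f \<in> states m \<alpha> \<Longrightarrow> f \<in> ?D" for f by (rule generate.incl)
  have aD: "\<alpha> \<in> ?D" by (rule inD[OF self_state])
  have idD: "id \<in> ?D" using subgroup.one_closed[OF sub] unfolding tree_one .
  have powD: "\<alpha> ^^ k \<in> ?D" for k
  proof (induction k)
    case (Suc k)
    then show ?case using subgroup.m_closed[OF sub Suc aD] by (simp add: comp_def)
  next
    case 0
    show ?case unfolding funpow.simps by (rule idD)
  qed
  show "f \<circ> g = g \<circ> f" if "f \<in> states m \<alpha>" "g \<in> states m \<alpha>" for f g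
    using that commute unfolding states_eq by auto
  show "section1 m f y \<in> ?D" if f: "f \<in> states m \<alpha>" and y: "y \<in> {1..m}" for f y
  proof -
    obtain u where u: "u \<in> words m" "f = state m \<alpha> u" using f by (auto simp: states_def)
    have "section1 m (state m g u) y = state m g (u @ [y])" for g by (induction u arbitrary: g) simp_all
    then have "section1 m f y = state m \<alpha> (u @ [y])" using u by simp
    moreover have "u @ [y] \<in> words m" using u y by simp
    ultimately show ?thesis unfolding states_def by (auto intro: generate.incl)
  qed
  show "diag m f \<in> ?D" if f: "f \<in> states m \<alpha>" for f
  proof (cases "f = id")
    case True
    then show ?thesis using idD diag_id by metis
  next
    case False
    then obtain i where i: "i < j" "f = diag_pow m i \<alpha>" using f unfolding states_eq by auto
    show ?thesis
    proof (cases "Suc i < j")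
      case True
      then have "diag_pow m (Suc i) \<alpha> \<in> states m \<alpha>" unfolding states_eq by blast
      then show ?thesis using i inD by simp
    next
      case False
      then have "j = Suc i" using i by simp
      then show ?thesis using powD[of m] pow_m i by simp
    qed
  qed
  show "\<exists>f\<in>?D. root_perm m f 1 = y" if y: "y \<in> {1..m}" for y
  proof -
    have "(\<alpha> ^^ (y - 1)) [1] = [y]" using pow_cons[of 1 "[]" "y - 1"] y by simp
    then have "root_perm m (\<alpha> ^^ (y - 1)) 1 = y" using m_gt_1 by (simp add: root_perm_def)
    then show ?thesis using powD by blast
  qed
qed

sublocale D: regular_tree_group m "generate (tree_aut m) (states m \<alpha>)"
  by (rule regular)

lemma lev_0: "\<alpha> \<in> D.S.lev 0"
proof -
  have "\<alpha> \<in> generate (tree_aut m) (states m \<alpha>)" by (rule generate.incl[OF self_state])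
  moreover have "\<alpha> [1] \<noteq> [1]" using apply_cons[of 1 "[]"] m_gt_1 by (simp add: full_cycle_apply)
  ultimately show ?thesis by (simp add: D.lev_0_iff)
qed

lemma pow_m_lev: "\<alpha> ^^ m \<in> D.S.lev j"
  unfolding pow_m by (rule D.S.lev_s_pow[OF lev_0])

end

section \<open>Torsion and torsion-free groups\<close>

lemma regular_diag_closure_cycle_group:
  assumes m: "prime m"
  shows "regular_tree_group m (diag_closure m (cycle_group m))"
proof -
  have m1: "1 < m" by (rule prime_gt_1_nat[OF m])
  then have cycle_group: "cycle_group m = range (\<lambda>k. rigid m (full_cycle m ^^ k))" by (intro cycle_group_eq) simp
  show ?thesis
  proof (rule regular_diag_closure[OF m])
    show "cycle_group m \<subseteq> carrier (tree_aut m)" unfolding cycle_group using rigid_closed by blast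
    show "f \<circ> g = g \<circ> f" if "f \<in> cycle_group m" "g \<in> cycle_group m" for f g
    proof -
      obtain i k where "f = rigid m (full_cycle m ^^ i)" "g = rigid m (full_cycle m ^^ k)"
        using \<open>f \<in> cycle_group m\<close> \<open>g \<in> cycle_group m\<close> unfolding cycle_group by blast
      then show ?thesis by (simp only: rigid_comp add.commute)
    qed
    show "section1 m f y \<in> cycle_group m" if f: "f \<in> cycle_group m" and y: "y \<in> {1..m}" for f y
    proof -
      obtain k where "f = wreath m (\<lambda>_. id) (full_cycle m ^^ k)" using f unfolding cycle_group rigid_def by blast
      then have "section1 m f y = id" using section1_wreath[of "\<lambda>_. id" y m] y tree_id by metis
      then show ?thesis unfolding cycle_group by (metis rangeI rigid_pow_0)
    qed
    show "\<exists>f\<in>cycle_group m. root_perm m f 1 = y" if y: "y \<in> {1..m}" for y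
    proof -
      have "root_perm m (rigid m (full_cycle m ^^ (y - 1))) 1 = (full_cycle m ^^ (y - 1)) 1"
        unfolding rigid_def using m1 by (intro root_perm_wreath) simp
      also have "\<dots> = (y - 1) mod m + 1" using m1 by (simp add: full_cycle_pow_apply)
      also have "(y - 1) mod m = y - 1" by (rule mod_less) (use y in auto)
      also have "y - 1 + 1 = y" using y by simp
      finally show ?thesis unfolding cycle_group by blast
    qed
  qed
qed

theorem theorem4:
  fixes m :: nat and A :: "(nat list \<Rightarrow> nat list) set"
  assumes "prime m"
    and "state_closed m A" and "transitive_aut m A" and "comm_group (sub_aut m A)"
  shows "(torsion (sub_aut m A) \<noteq> {\<one>\<^bsub>tree_aut m\<^esub>} \<longrightarrow>
            torsion_group (sub_aut m (diag_top_closure m A)) \<and>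
            conjugate_in (tree_aut m) (diag_top_closure m A)
              (diag_top_closure m (generate (tree_aut m) {rigid m (full_cycle m)})) \<and>
            (\<exists>h \<in> iso (add_monoid (fps_ring (residue_ring (int m))))
                     (sub_aut m (diag_top_closure m
                       (generate (tree_aut m) {rigid m (full_cycle m)}))).
               \<forall>f \<in> carrier (fps_ring (residue_ring (int m))).
                 h (fps_var (residue_ring (int m)) \<otimes>\<^bsub>fps_ring (residue_ring (int m))\<^esub> f)
                   = diag m (h f))) \<and>
         (torsion_free_group (sub_aut m A) \<longrightarrow>
            torsion_free_group (sub_aut m (diag_top_closure m A)) \<and>
            (\<exists>j\<ge>1. conjugate_in (tree_aut m) (diag_top_closure m A)
                      (top_closure m (D_group m j))))"
proof -
  have m1: "1 < m" by (rule prime_gt_1_nat[OF assms(1)])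
  let ?B = "diag_closure m A"
  have subA: "subgroup A (tree_aut m)" using assms(2) by (simp add: state_closed_def)
  have Ac: "A \<subseteq> carrier (tree_aut m)" by (rule subgroup.subset[OF subA])
  have idA: "id \<in> A" using subgroup.one_closed[OF subA] by simp
  have transA: "\<exists>f\<in>A. root_perm m f 1 = y" if "y \<in> {1..m}" for y
    using assms(3) that m1 unfolding transitive_aut_def induced_perms_def by fastforce
  interpret B: regular_tree_group m ?B
  proof (rule regular_diag_closure[OF assms(1) Ac])
    show "f \<circ> g = g \<circ> f" if "f \<in> A" "g \<in> A" for f g
      using comm_monoid.m_comm[OF comm_group.axioms(1)[OF assms(4)], of f g] that by simp
    show "section1 m f y \<in> A" if "f \<in> A" "y \<in> {1..m}" for f y
    proof -
      have "state m f [y] \<in> states m f" unfolding states_def using that(2) by (intro imageI) simp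
      then show ?thesis using assms(2) that(1) by (auto simp: state_closed_def)
    qed
    show "\<exists>f\<in>A. root_perm m f 1 = y" if "y \<in> {1..m}" for y by (rule transA[OF that])
  qed
  have AB: "f \<in> ?B" if "f \<in> A" for f
    unfolding diag_closure_def using that by (intro generate.incl UN_I[of 0]) auto
  obtain \<beta> where \<beta>: "\<beta> \<in> A" "root_perm m \<beta> 1 = 2" using transA[of 2] m1 by auto
  \<comment> \<open>An element of valuation 0, which exists by transitivity since \<open>m \<ge> 2\<close>.\<close>
  have "\<beta> [1] \<noteq> [1]" using tree_apply_singleton[of \<beta> m 1] \<beta> Ac m1 by auto
  then have \<beta>0: "\<beta> \<in> B.S.lev 0" and \<beta>id: "\<beta> \<noteq> id" using AB[OF \<beta>(1)] by (auto simp: B.lev_0_iff)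
  show ?thesis
  proof (intro conjI impI)
    assume "torsion (sub_aut m A) \<noteq> {\<one>\<^bsub>tree_aut m\<^esub>}"
    moreover have "id \<in> torsion (sub_aut m A)" using idA by (auto simp: torsion_def intro!: exI[of _ 1])
    ultimately obtain a n where a: "a \<in> A" "a \<noteq> id" "0 < (n::nat)" "a ^^ n = id"
      by (auto simp: torsion_def)
    have \<beta>m: "\<beta> ^^ m = id"
    proof (rule ccontr)
      assume "\<beta> ^^ m \<noteq> id"
      then have ne: "\<beta> [^]\<^bsub>sub_aut m ?B\<^esub> m \<noteq> \<one>\<^bsub>sub_aut m ?B\<^esub>" by simp
      obtain k where k: "a \<notin> B.S.fil k" using B.S.fil_Inter[of a] a(2) by auto
      obtain N where "\<And>y. y \<in> ?B \<Longrightarrow> y \<notin> B.S.fil k \<Longrightarrow> y ^^ n \<notin> B.S.fil N"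
        using B.S.power_bound[OF \<beta>0 ne a(3), of k] by auto
      then have "id \<notin> B.S.fil N" using AB[OF a(1)] k a(4) by metis
      then show False using subgroup.one_closed[OF B.S.subgroup_fil, of N] by simp
    qed
    have exp: "f ^^ m = id" if "f \<in> ?B" for f
      using B.S.exponent_p[OF \<beta>0, of f] \<beta>m that by simp
    show "torsion_group (sub_aut m (diag_top_closure m A))"
      unfolding diag_top_closure_def by (rule B.torsion_group_top_closure[OF exp])
    let ?C = "diag_closure m (cycle_group m)"
    interpret C: regular_tree_group m ?C by (rule regular_diag_closure_cycle_group[OF assms(1)])
    let ?\<gamma> = "rigid m (full_cycle m ^^ 1)"
    have "?\<gamma> \<in> ?C"
      unfolding diag_closure_def cycle_group_def by (intro generate.incl UN_I[of 0]) (auto intro: generate.incl)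
    moreover have "?\<gamma> [1] \<noteq> [1]"
      using m1 by (simp add: rigid_def wreath_cons full_cycle_apply)
    ultimately have \<gamma>0: "?\<gamma> \<in> C.S.lev 0" unfolding C.lev_0_iff by blast
    have "?\<gamma> ^^ k = rigid m (full_cycle m ^^ k)" for k
    proof (induction k)
      case 0
      show ?case by (simp only: rigid_0 funpow.simps)
    next
      case (Suc k)
      then show ?case using rigid_comp[of m 1 k] by (simp only: funpow.simps(2) plus_1_eq_Suc)
    qed
    then have \<gamma>m: "?\<gamma> ^^ m = id" using full_cycle_pow_m[of m] rigid_0[of m] by metis
    have "shift_group_pair (sub_aut m ?B) (diag m) (sub_aut m ?C) (diag m) m
        (\<lambda>k. (diag m ^^ k) \<beta>) (\<lambda>k. (diag m ^^ k) ?\<gamma>)"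
      using \<beta>0 \<gamma>0 \<beta>m \<gamma>m
      by (intro shift_group_pair_exponent_p B.S.shift_group_axioms C.S.shift_group_axioms) simp_all
    then show "conjugate_in (tree_aut m) (diag_top_closure m A)
        (diag_top_closure m (generate (tree_aut m) {rigid m (full_cycle m)}))"
      unfolding diag_top_closure_def cycle_group_def[symmetric]
      by (rule conjugate_top_closure_of_pair[OF B.regular_tree_group_axioms C.regular_tree_group_axioms])
    show "\<exists>h \<in> iso (add_monoid (fps_ring (residue_ring (int m))))
                     (sub_aut m (diag_top_closure m
                       (generate (tree_aut m) {rigid m (full_cycle m)}))).
               \<forall>f \<in> carrier (fps_ring (residue_ring (int m))).
                 h (fps_var (residue_ring (int m)) \<otimes>\<^bsub>fps_ring (residue_ring (int m))\<^esub> f)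
                   = diag m (h f)"
      unfolding cycle_group_def[symmetric] using rotation_iso[OF assms(1)] by blast
  next
    assume tf: "torsion_free_group (sub_aut m A)"
    have \<beta>m: "\<beta> ^^ m \<noteq> id"
    proof
      assume "\<beta> ^^ m = id"
      then have "\<beta> \<in> torsion (sub_aut m A)" using \<beta>(1) m1 by (auto simp: torsion_def intro!: exI[of _ m])
      then show False using tf \<beta>id by (auto simp: torsion_free_group_def)
    qed
    show "torsion_free_group (sub_aut m (diag_top_closure m A))"
      unfolding diag_top_closure_def by (rule B.torsion_free_group_top_closure[OF \<beta>0 \<beta>m])
    have ne: "\<beta> [^]\<^bsub>sub_aut m ?B\<^esub> m \<noteq> \<one>\<^bsub>sub_aut m ?B\<^esub>" using \<beta>m by simp
    obtain j where j: "1 \<le> j" "\<beta> [^]\<^bsub>sub_aut m ?B\<^esub> m \<in> B.S.lev j"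
      using B.S.pth_power_lev_exists[OF \<beta>0 ne] .
    interpret M: generalized_adding_machine m j "adding_machine m j"
      by (unfold_locales) (use assms(1) j is_adding_machine_adding_machine in auto)
    have "shift_group_pair (sub_aut m ?B) (diag m) (sub_aut m (D_group m j)) (diag m) m
        (B.S.ladder \<beta> j) (M.D.S.ladder (adding_machine m j) j)"
      using \<beta>0 j M.lev_0 M.pow_m_lev unfolding D_group_def
      by (intro shift_group_pair_ladder B.S.shift_group_axioms M.D.S.shift_group_axioms) simp_all
    moreover have "regular_tree_group m (D_group m j)" unfolding D_group_def by (rule M.regular)
    ultimately have "conjugate_in (tree_aut m) (diag_top_closure m A) (top_closure m (D_group m j))"
      unfolding diag_top_closure_def
      by (intro conjugate_top_closure_of_pair[OF B.regular_tree_group_axioms])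
    then show "\<exists>j\<ge>1. conjugate_in (tree_aut m) (diag_top_closure m A) (top_closure m (D_group m j))"
      using j(1) by blast
  qed
qed

end
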